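(* Let $\Omega\subset\mathbb{R}^d$ be an open set of finite Lebesgue measure $|\Omega|$ and finite perimeter $\mathrm{Per}(\Omega)$. Let $\mathbf{X}=\{X_t\}_{t\ge0}$ be an isotropic Lévy process in $\mathbb{R}^d$ whose (radial) characteristic exponent $\psi$ is regularly varying at infinity of index $\alpha$, for some $\alpha\in(1,2]$. Let $H(t)=\int_\Omega\mathbb{P}_x(X_t\in\Omega^c)\,dx$. Then $$\lim_{t\to0^+}\psi^{-}(1/t)\,H(t)=\pi^{-1}\,\Gamma(1-1/\alpha)\,\mathrm{Per}(\Omega).$$
   Context: A Lévy process $\mathbf{X}=\{X_t\}_{t\ge0}$ in $\mathbb{R}^d$ is a càdlàg process with stationary independent increments; under $\mathbb{P}$ it starts at $X_0=0$, and $\mathbb{P}_x$ denotes the law of the process started at $x$. Its characteristic exponent $\psi$ is defined by $\mathbb{E}e^{i\langle X_t,\xi\rangle}=e^{-t\psi(\xi)}$. The process is isotropic if the distribution of $X_t$ is rotationally invariant for each $t>0$; then $$\psi(x)=\eta\|x\|^2+\int_{\mathbb{R}^d}(1-\cos\langle x,y\rangle)\,\nu(dy)$$ with $\eta\ge0$ and a rotationally invariant Lévy measure $\nu$ (i.e. $\nu(\{0\})=0$, $\int(1\wedge\|y\|^2)\,\nu(dy)<\infty$). Thus $\psi$ is radial, and one writes $\psi(r)$ for $\psi(x)$ with $\|x\|=r$. A function $f$, positive on $[x_0,\infty)$ for some $x_0>0$, is regularly varying of index $\alpha$ at infinity if $\lim_{r\to\infty}f(\lambda r)/f(r)=\lambda^\alpha$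 for every $\lambda>0$. Define $\psi^*(u)=\sup_{s\in[0,u]}\psi(s)$ for $u\ge0$, and let $\psi^-$ be its generalized inverse, $\psi^-(u)=\inf\{x\ge0:\psi^*(x)\ge u\}$. The perimeter of a measurable set $\Omega\subset\mathbb{R}^d$ is $$\mathrm{Per}(\Omega)=\sup\left\{\int_{\mathbb{R}^d}\mathbf{1}_\Omega(x)\,\mathrm{div}\,\phi(x)\,dx:\ \phi\in C_c^1(\mathbb{R}^d,\mathbb{R}^d),\ \|\phi\|_\infty\le1\right\}.$$ *)

theory Defs
  imports "HOL-Probability.Probability"
begin

definition cadlag :: "(real \<Rightarrow> 'a::topological_space) \<Rightarrow> bool" where
  "cadlag f \<longleftrightarrow>
     (\<forall>t\<ge>0. (f \<longlongrightarrow> f t) (at_right t)) \<and>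
     (\<forall>t>0. \<exists>l. (f \<longlongrightarrow> l) (at_left t))"

text \<open>The time parameter ranges over the reals; only times \<open>t \<ge> 0\<close> are ever constrained or used.
  The starting condition and path regularity are required almost surely.\<close>

locale levy_process = prob_space M
  for M :: "'w measure" and X :: "real \<Rightarrow> 'w \<Rightarrow> 'a::euclidean_space" +
  assumes random_variable [measurable]: "\<And>t. t \<ge> 0 \<Longrightarrow> X t \<in> borel_measurable M"
    and start: "AE \<omega> in M. X 0 \<omega> = 0"
    and cadlag_paths: "AE \<omega> in M. cadlag (\<lambda>t. X t \<omega>)"
    and independent_increments:
      "\<And>(n::nat) (t::nat \<Rightarrow> real). 0 \<le> t 0 \<Longrightarrow> (\<And>i. i < n \<Longrightarrow> t i < t (Suc i)) \<Longrightarrow>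
         indep_vars (\<lambda>_. borel) (\<lambda>i \<omega>. X (t (Suc i)) \<omega> - X (t i) \<omega>) {..<n}"
    and stationary_increments:
      "\<And>s h. 0 \<le> s \<Longrightarrow> 0 \<le> h \<Longrightarrow>
         distr M borel (\<lambda>\<omega>. X (s + h) \<omega> - X s \<omega>) = distr M borel (\<lambda>\<omega>. X h \<omega> - X 0 \<omega>)"

text \<open>Rotational invariance means invariance under the full orthogonal group, so that in
  dimension one it is symmetry.\<close>

definition isotropic :: "'w measure \<Rightarrow> (real \<Rightarrow> 'w \<Rightarrow> 'a::euclidean_space) \<Rightarrow> bool" where
  "isotropic M X \<longleftrightarrow>
     (\<forall>t>0. \<forall>T. orthogonal_transformation T \<longrightarrow>
        distr M borel (\<lambda>\<omega>. T (X t \<omega>)) = distr M borel (X t))"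

text \<open>Since the identity is required for all \<open>t \<ge> 0\<close>, it determines \<open>\<Psi>\<close> uniquely (no ambiguity
  by multiples of \<open>2 \<pi> \<i>\<close> remains).\<close>

definition characteristic_exponent ::
    "'w measure \<Rightarrow> (real \<Rightarrow> 'w \<Rightarrow> 'a::euclidean_space) \<Rightarrow> ('a \<Rightarrow> complex) \<Rightarrow> bool" where
  "characteristic_exponent M X \<Psi> \<longleftrightarrow>
     (\<forall>t\<ge>0. \<forall>\<xi>. (CLINT \<omega>|M. iexp (X t \<omega> \<bullet> \<xi>)) = exp (- (complex_of_real t * \<Psi> \<xi>)))"

definition regularly_varying :: "(real \<Rightarrow> real) \<Rightarrow> real \<Rightarrow> bool" where
  "regularly_varying f \<alpha> \<longleftrightarrow>
     (\<exists>x0>0. \<forall>x\<ge>x0. f x > 0) \<and>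
     (\<forall>c>0. ((\<lambda>r. f (c * r) / f r) \<longlongrightarrow> c powr \<alpha>) at_top)"

definition running_sup :: "(real \<Rightarrow> real) \<Rightarrow> real \<Rightarrow> real" where
  "running_sup \<psi> u = (SUP s\<in>{0..u}. \<psi> s)"

definition generalized_inverse :: "(real \<Rightarrow> real) \<Rightarrow> real \<Rightarrow> real" where
  "generalized_inverse \<psi> u = Inf {x. 0 \<le> x \<and> running_sup \<psi> x \<ge> u}"

text \<open>The law of \<open>X t\<close> for the process started at \<open>x\<close> is that of \<open>x + X t\<close> for the process
  started at the origin.\<close>

definition law_from ::
    "'w measure \<Rightarrow> (real \<Rightarrow> 'w \<Rightarrow> 'a::euclidean_space) \<Rightarrow> 'a \<Rightarrow> real \<Rightarrow> 'a measure" where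
  "law_from M X x t = distr M borel (\<lambda>\<omega>. x + X t \<omega>)"

definition heat_loss ::
    "'w measure \<Rightarrow> (real \<Rightarrow> 'w \<Rightarrow> 'a::euclidean_space) \<Rightarrow> 'a set \<Rightarrow> real \<Rightarrow> real" where
  "heat_loss M X \<Omega> t = (LINT x:\<Omega>|lborel. measure (law_from M X x t) (- \<Omega>))"

definition C1 :: "('a::euclidean_space \<Rightarrow> 'a) \<Rightarrow> bool" where
  "C1 \<phi> \<longleftrightarrow>
     (\<exists>D :: 'a \<Rightarrow> 'a \<Rightarrow>\<^sub>L 'a.
        (\<forall>x. (\<phi> has_derivative blinfun_apply (D x)) (at x)) \<and> continuous_on UNIV D)"

definition divergence :: "('a::euclidean_space \<Rightarrow> 'a) \<Rightarrow> 'a \<Rightarrow> real" where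
  "divergence \<phi> x = (\<Sum>b\<in>Basis. frechet_derivative \<phi> (at x) b \<bullet> b)"

definition perimeter_fields :: "('a::euclidean_space \<Rightarrow> 'a) set" where
  "perimeter_fields =
     {\<phi>. C1 \<phi> \<and> compact (closure {x. \<phi> x \<noteq> 0}) \<and> (\<forall>x. norm (\<phi> x) \<le> 1)}"

definition perimeter :: "'a::euclidean_space set \<Rightarrow> ereal" where
  "perimeter \<Omega> =
     (SUP \<phi>\<in>perimeter_fields. ereal (LINT x|lborel. indicator \<Omega> x * divergence \<phi> x))"

end

theory Submission
  imports Defs "HOL-Real_Asymp.Real_Asymp"
begin

text \<open>
  With \<open>D(y)\<close> the measure of the symmetric difference of \<open>\<Omega>\<close> and \<open>\<Omega> - y\<close>, the heat loss is
  half the expectation of \<open>D(X\<^sub>t)\<close>. If \<open>G\<close> is the gradient of a mollification of the indicator of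
  \<open>\<Omega>\<close>, then \<open>D(y)\<close> is close to \<open>\<integral> |G(x) \<bullet> y| dx\<close> for small \<open>y\<close>, and \<open>\<integral> |G|\<close> is close to the
  perimeter. By rotation invariance the expectation of \<open>|G(x) \<bullet> X\<^sub>t|\<close> over \<open>|X\<^sub>t| \<le> 1\<close> is \<open>|G(x)|\<close>
  times the truncated first moment of one coordinate, so everything reduces to that moment.
  Truncating the integral in \<open>|z| = (2/\<pi>) \<integral>\<^sub>0\<^sup>\<infinity> (1 - cos (r z)) / r\<^sup>2 dr\<close> at a positive \<open>r\<^sub>0\<close> costs
  \<open>O(t)\<close>, and \<open>(2/\<pi>) \<integral> (1 - exp (- t \<psi>(r))) / r\<^sup>2 dr\<close> is handled by the substitution
  \<open>r = \<psi>\<^sup>-(1/t) s\<close> and dominated convergence, the majorant coming from a Potter bound for \<open>\<psi>\<close>. The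
  limit is \<open>(2/\<pi>) \<integral>\<^sub>0\<^sup>\<infinity> (1 - exp (- s\<^sup>\<alpha>)) / s\<^sup>2 ds = (2/\<pi>) \<Gamma>(1 - 1/\<alpha>)\<close>.
\<close>

text \<open>Regular variation at infinity does not control large jumps, so the first moment of
  \<open>X t\<close> may be infinite and low frequencies may make the cosine integral diverge. Hence
  both cut-offs: displacements to the unit ball, frequencies to \<open>r0\<close> and above. Each
  costs a multiple of the expectation of \<open>min 1 ((norm (X t \<omega>))\<^sup>2)\<close>, which
  is O(t). Since \<alpha> > 1 makes \<psi> superlinear,
  \<open>generalized_inverse \<psi> (1 / t) * t\<close> tends to 0, and these errors vanish after
  scaling.

  The two bounds choose the mollifier in opposite order. From above, the error is an L1 distance
  that does not depend on the displacement, so the mollifier is refined with \<open>t\<close> fixed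
  and the perimeter itself appears. From below, the linearization error is
  \<open>K * (norm y)\<^sup>2\<close> with \<open>K\<close> depending on the mollifier, so one
  mollifier has to serve all \<open>t\<close>; this reaches only constants \<open>c\<close> below
  the perimeter, and \<open>c\<close> is raised last.

  The factor 2 in the first-moment asymptotics cancels the factor 1/2 in the heat loss, which leaves
  1/\<pi>.\<close>

section \<open>Regular variation\<close>

text \<open>Baire category replaces the uniform convergence theorem: a uniform bound on the increments is
  all that the Potter bound needs.\<close>

lemma increments_bounded_of_tendsto_zero:
  fixes f :: "real \<Rightarrow> real"
  assumes cont: "continuous_on UNIV f"
    and lim: "\<And>h. ((\<lambda>x. f (x + h) - f x) \<longlongrightarrow> 0) at_top"
  shows "\<exists>C x1. \<forall>x\<ge>x1. \<forall>h\<in>{0..1}. \<bar>f (x + h) - f x\<bar> \<le> C"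
proof -
  define A where "A n = {h. \<forall>x\<ge>real n. \<bar>f (x + h) - f x\<bar> \<le> 1}" for n :: nat
  have clA: "closed (A n)" for n
  proof -
    have "A n = (\<Inter>x\<in>{real n..}. {h. \<bar>f (x + h) - f x\<bar> \<le> 1})"
      by (auto simp: A_def)
    moreover have "closed {h. \<bar>f (x + h) - f x\<bar> \<le> 1}" for x
      by (intro closed_Collect_le continuous_intros continuous_on_compose2[OF cont]) auto
    ultimately show ?thesis by auto
  qed
  have ex: "\<exists>n. h \<in> A n" for h
  proof -
    have "\<forall>\<^sub>F x in at_top. dist (f (x + h) - f x) 0 < 1"
      using lim[of h] by (rule tendstoD) auto
    then obtain N where N: "\<And>x. x \<ge> N \<Longrightarrow> dist (f (x + h) - f x) 0 < 1"
      unfolding eventually_at_top_linorder by blast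
    obtain n where "N \<le> real n" using real_arch_simple by blast
    then have "h \<in> A n" using N unfolding A_def by (force simp: dist_real_def intro: less_imp_le)
    then show ?thesis ..
  qed
  \<comment> \<open>The closed sets \<open>A n\<close> cover the line, so by Baire one of them
    contains an interval, on which the bound 1 holds from a common threshold on.\<close>
  have "\<exists>n. interior (A n) \<noteq> {}"
  proof (rule ccontr)
    assume "\<not> ?thesis"
    then have e: "interior (A n) = {}" for n by blast
    have "UNIV \<subseteq> closure (\<Inter>(range (\<lambda>n. - A n)))"
    proof (rule Baire)
      fix T assume "T \<in> range (\<lambda>n. - A n)"
      then obtain n where "T = - A n" by auto
      then show "openin (top_of_set UNIV) T \<and> UNIV \<subseteq> closure T"
        using clA[of n] e[of n] by (simp add: closure_complement open_Compl)
    qed auto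
    moreover have "\<Inter>(range (\<lambda>n. - A n)) = {}" using ex by auto
    ultimately show False by (simp only: closure_empty) auto
  qed
  then obtain n a where "a \<in> interior (A n)" by blast
  then obtain e where e: "e > 0" "cball a e \<subseteq> A n"
    by (meson mem_interior_cball)
  \<comment> \<open>Beyond \<open>x1\<close> the base point \<open>x - a\<close> exceeds
    \<open>n\<close>. Comparing the increments by \<open>a\<close> and by \<open>a + h\<close> from
    that base point gives the bound 2 for every short step \<open>h\<close> at
    \<open>x\<close>.\<close>
  define x1 where "x1 = real n + \<bar>a\<bar>"
  have step: "\<bar>f (x + h) - f x\<bar> \<le> 2" if x: "x \<ge> x1" and h: "0 \<le> h" "h \<le> e" for x h
  proof -
    have "a + h \<in> A n" "a \<in> A n"
      using e h by (auto intro!: subsetD[OF e(2)] simp: dist_real_def)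
    moreover have "x - a \<ge> real n" using x by (auto simp: x1_def)
    ultimately have "\<bar>f ((x - a) + (a + h)) - f (x - a)\<bar> \<le> 1" "\<bar>f ((x - a) + a) - f (x - a)\<bar> \<le> 1"
      unfolding A_def by blast+
    moreover have "(x - a) + (a + h) = x + h" "(x - a) + a = x" by simp_all
    ultimately have "\<bar>f (x + h) - f (x - a)\<bar> \<le> 1" "\<bar>f x - f (x - a)\<bar> \<le> 1" by metis+
    then show ?thesis by linarith
  qed
  have iter: "\<bar>f (x + h) - f x\<bar> \<le> 2 * real k"
    if "x \<ge> x1" "0 \<le> h" "h \<le> real k * e" for x h k
    using that
  proof (induction k arbitrary: x h)
    case (Suc k)
    define h1 where "h1 = min h e"
    have 1: "\<bar>f (x + h1) - f x\<bar> \<le> 2"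
      using Suc.prems e by (intro step) (auto simp: h1_def)
    have "\<bar>f ((x + h1) + (h - h1)) - f (x + h1)\<bar> \<le> 2 * real k"
      using Suc.prems e by (intro Suc.IH) (auto simp: h1_def algebra_simps min_def)
    then show ?case using 1 by (simp add: algebra_simps)
  qed auto
  obtain k where "1 \<le> real k * e"
    using e reals_Archimedean3[of e] by (meson less_imp_le)
  then have "\<forall>x\<ge>x1. \<forall>h\<in>{0..1}. \<bar>f (x + h) - f x\<bar> \<le> 2 * real k"
    using iter by auto
  then show ?thesis by blast
qed

text \<open>For large arguments a unit step costs at most \<open>\<delta>\<close>, so the integer
  part of \<open>y - x\<close> produces the linear term; the fractional remainder is paid for by the
  uniform bound \<open>C\<close>.\<close>

lemma increments_sublinear_of_tendsto_zero:
  fixes f :: "real \<Rightarrow> real"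
  assumes cont: "continuous_on UNIV f"
    and lim: "\<And>h. ((\<lambda>x. f (x + h) - f x) \<longlongrightarrow> 0) at_top"
    and "\<delta> > 0"
  shows "\<exists>C x1. \<forall>x\<ge>x1. \<forall>y\<ge>x. \<bar>f y - f x\<bar> \<le> C + \<delta> * (y - x)"
proof -
  obtain C x1 where C: "\<And>x h. x \<ge> x1 \<Longrightarrow> h \<in> {0..1} \<Longrightarrow> \<bar>f (x + h) - f x\<bar> \<le> C"
    using increments_bounded_of_tendsto_zero[OF cont lim] by blast
  have "\<forall>\<^sub>F x in at_top. dist (f (x + 1) - f x) 0 < \<delta>"
    using lim[of 1] \<open>\<delta> > 0\<close> by (rule tendstoD)
  then obtain x2 where x2: "\<And>x. x \<ge> x2 \<Longrightarrow> dist (f (x + 1) - f x) 0 < \<delta>"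
    unfolding eventually_at_top_linorder by blast
  have it: "\<bar>f (x + real k) - f x\<bar> \<le> \<delta> * real k" if "x \<ge> x2" for x k
  proof (induction k)
    case (Suc k)
    have "dist (f ((x + real k) + 1) - f (x + real k)) 0 < \<delta>"
      using that by (intro x2) auto
    then show ?case using Suc by (simp add: dist_real_def algebra_simps)
  qed auto
  have "\<bar>f y - f x\<bar> \<le> C + \<delta> * (y - x)" if x: "x \<ge> max x1 x2" and y: "y \<ge> x" for x y
  proof -
    define k where "k = nat \<lfloor>y - x\<rfloor>"
    define h where "h = y - x - real k"
    have k: "real k \<le> y - x" "y - x \<le> real k + 1"
      using y unfolding k_def by (auto simp: of_nat_nat)
    have "\<bar>f ((x + real k) + h) - f (x + real k)\<bar> \<le> C"
      using x k by (intro C) (auto simp: h_def)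
    moreover have "\<bar>f (x + real k) - f x\<bar> \<le> \<delta> * real k" using x by (intro it) auto
    moreover have "\<delta> * real k \<le> \<delta> * (y - x)" using k \<open>\<delta> > 0\<close> by auto
    moreover have "x + real k + h = y" by (simp add: h_def)
    ultimately show ?thesis by fastforce
  qed
  then show ?thesis by blast
qed

text \<open>In logarithmic coordinates regular variation says that the increments of
  \<open>ln (\<psi> (exp x)) - \<alpha> * x\<close> tend to 0; exponentiating their sublinear bound
  gives the claim. Only the direction \<open>s \<le> r\<close> is kept, the one that dominates the
  rescaled exponent at small arguments.\<close>

lemma regularly_varying_Potter:
  fixes \<psi> :: "real \<Rightarrow> real"
  assumes rv: "regularly_varying \<psi> \<alpha>" and cont: "continuous_on {0..} \<psi>" and "\<delta> > 0"
  shows "\<exists>C r0. C > 0 \<and> r0 > 0 \<and> (\<forall>r\<ge>r0. \<psi> r > 0) \<and>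
    (\<forall>s r. r0 \<le> s \<longrightarrow> s \<le> r \<longrightarrow> \<psi> s \<le> C * (s / r) powr (\<alpha> - \<delta>) * \<psi> r)"
proof -
  obtain x0 where x0: "x0 > 0" "\<And>x. x \<ge> x0 \<Longrightarrow> \<psi> x > 0"
    and lim: "\<And>c. c > 0 \<Longrightarrow> ((\<lambda>r. \<psi> (c * r) / \<psi> r) \<longlongrightarrow> c powr \<alpha>) at_top"
    using rv unfolding regularly_varying_def by blast
  define l where "l = ln x0"
  \<comment> \<open>Freezing the argument at \<open>l = ln x0\<close> keeps \<psi> in its region of
    positivity, so \<open>f\<close> is continuous on the whole line without changing its behaviour
    at infinity.\<close>
  define f where "f x = ln (\<psi> (exp (max x l))) - \<alpha> * max x l" for x
  have expl: "exp (max x l) \<ge> x0" for x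
    using x0 by (simp add: l_def max_def) (smt (verit) exp_le_cancel_iff exp_ln)
  have contf: "continuous_on UNIV f"
    unfolding f_def
    by (intro continuous_intros continuous_on_compose2[OF cont])
       (use x0 expl in \<open>force intro: less_imp_le less_le_trans simp: less_imp_neq[symmetric]\<close>)+
  have limf: "((\<lambda>x. f (x + h) - f x) \<longlongrightarrow> 0) at_top" for h
  proof -
    have "((\<lambda>x. \<psi> (exp h * exp x) / \<psi> (exp x)) \<longlongrightarrow> exp h powr \<alpha>) at_top"
      by (rule filterlim_compose[OF lim exp_at_top]) simp
    then have "((\<lambda>x. ln (\<psi> (exp h * exp x) / \<psi> (exp x)) - \<alpha> * h) \<longlongrightarrow> ln (exp h powr \<alpha>) - \<alpha> * h) at_top"
      by (intro tendsto_intros) auto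
    moreover have "ln (exp h powr \<alpha>) - \<alpha> * h = 0" by (simp add: powr_def)
    moreover have "\<forall>\<^sub>F x in at_top. ln (\<psi> (exp h * exp x) / \<psi> (exp x)) - \<alpha> * h = f (x + h) - f x"
      using eventually_ge_at_top[of "max l (l - h)"]
    proof eventually_elim
      case (elim x)
      have m: "max x l = x" "max (x + h) l = x + h" using elim by auto
      have "\<psi> (exp x) > 0" "\<psi> (exp (x + h)) > 0"
        using expl[of x] expl[of "x + h"] m x0 by auto
      then show ?case
        unfolding f_def m by (simp add: exp_add[symmetric] ln_div algebra_simps)
    qed
    ultimately show ?thesis by (simp add: filterlim_cong)
  qed
  obtain C x1 where C: "\<And>x y. x \<ge> x1 \<Longrightarrow> y \<ge> x \<Longrightarrow> \<bar>f y - f x\<bar> \<le> C + \<delta> * (y - x)"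
    using increments_sublinear_of_tendsto_zero[OF contf limf \<open>\<delta> > 0\<close>] by blast
  define r0 where "r0 = max x0 (exp x1)"
  have "\<psi> s \<le> exp C * (s / r) powr (\<alpha> - \<delta>) * \<psi> r" if s: "r0 \<le> s" and r: "s \<le> r" for s r
  proof -
    have pos: "s > 0" "r > 0" using s r x0 by (auto simp: r0_def)
    have ps: "\<psi> s > 0" "\<psi> r > 0" using s r x0 by (auto simp: r0_def)
    have ls: "ln s \<ge> x1" "ln s \<ge> l" "ln r \<ge> ln s" "ln r \<ge> l"
      using s r pos x0 by (auto simp: r0_def l_def ln_ge_iff)
    have "\<bar>f (ln r) - f (ln s)\<bar> \<le> C + \<delta> * (ln r - ln s)"
      using ls by (intro C) auto
    moreover have "f (ln r) = ln (\<psi> r) - \<alpha> * ln r" "f (ln s) = ln (\<psi> s) - \<alpha> * ln s"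
      using ls pos by (auto simp: f_def max_def)
    ultimately have "ln (\<psi> s) \<le> C + (\<alpha> - \<delta>) * (ln s - ln r) + ln (\<psi> r)"
      by (simp add: algebra_simps)
    also have "\<dots> = ln (exp C * (s / r) powr (\<alpha> - \<delta>) * \<psi> r)"
      using pos ps by (simp add: ln_mult ln_div powr_def)
    finally show ?thesis using ps pos by (subst (asm) ln_le_cancel_iff) auto
  qed
  moreover have "r0 > 0" using x0 by (auto simp: r0_def)
  ultimately show ?thesis
    using x0 by (intro exI[of _ "exp C"] exI[of _ r0]) (auto simp: r0_def)
qed

text \<open>The Potter bound with \<open>s = r0\<close> fixed gives growth of order at least
  \<open>\<alpha> - \<delta> = (\<alpha> + 1) / 2\<close>, which exceeds 1. This is what makes
  errors of order \<open>t\<close> negligible in the limit.\<close>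

lemma regularly_varying_superlinear:
  fixes \<psi> :: "real \<Rightarrow> real"
  assumes rv: "regularly_varying \<psi> \<alpha>" and cont: "continuous_on {0..} \<psi>" and "\<alpha> > 1"
  shows "filterlim (\<lambda>r. \<psi> r / r) at_top at_top"
proof -
  define \<delta> where "\<delta> = (\<alpha> - 1) / 2"
  have \<delta>: "\<delta> > 0" "\<alpha> - \<delta> - 1 > 0" using \<open>\<alpha> > 1\<close> by (auto simp: \<delta>_def field_simps)
  obtain C r0 where C: "C > 0" "r0 > 0" "\<And>r. r \<ge> r0 \<Longrightarrow> \<psi> r > 0"
    "\<And>s r. r0 \<le> s \<Longrightarrow> s \<le> r \<Longrightarrow> \<psi> s \<le> C * (s / r) powr (\<alpha> - \<delta>) * \<psi> r"
    using regularly_varying_Potter[OF rv cont \<delta>(1)] by blast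
  define c where "c = \<psi> r0 / (C * r0 powr (\<alpha> - \<delta>))"
  have c: "c > 0" using C by (auto simp: c_def)
  have "filterlim (\<lambda>r::real. r powr (\<alpha> - \<delta> - 1)) at_top at_top"
    using \<delta> by real_asymp
  then have "filterlim (\<lambda>r. c * r powr (\<alpha> - \<delta> - 1)) at_top at_top"
    by (intro filterlim_tendsto_pos_mult_at_top[OF tendsto_const c])
  then show ?thesis
  proof (rule filterlim_at_top_mono)
    show "\<forall>\<^sub>F r in at_top. c * r powr (\<alpha> - \<delta> - 1) \<le> \<psi> r / r"
      using eventually_ge_at_top[of r0]
    proof eventually_elim
      case (elim r)
      have r: "r > 0" using elim C by auto
      have "\<psi> r0 \<le> C * (r0 / r) powr (\<alpha> - \<delta>) * \<psi> r" using elim by (intro C) auto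
      then have "\<psi> r0 * r powr (\<alpha> - \<delta>) \<le> C * r0 powr (\<alpha> - \<delta>) * \<psi> r"
        using r C by (simp add: powr_divide field_simps)
      then have "c * r powr (\<alpha> - \<delta>) \<le> \<psi> r"
        using C by (simp add: c_def field_simps)
      then show ?case using r by (simp add: powr_diff[of r "\<alpha> - \<delta>" 1] divide_right_mono)
    qed
  qed
qed

text \<open>The running supremum of a continuous function is a maximum, so it reaches
  \<open>u\<close> exactly from the first point \<open>m\<close> on where \<psi> does. The exact
  value at the inverse later turns \<open>t * \<psi> (R * s)\<close> into the ratio
  \<open>\<psi> (R * s) / \<psi> R\<close>.\<close>

lemma generalized_inverse_attained:
  fixes \<psi> :: "real \<Rightarrow> real"
  assumes cont: "continuous_on {0..} \<psi>" and "\<psi> 0 = 0" and lim: "filterlim \<psi> at_top at_top" and "u > 0"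
  shows "generalized_inverse \<psi> u > 0 \<and> \<psi> (generalized_inverse \<psi> u) = u"
proof -
  define T where "T = {x\<in>{0..}. u \<le> \<psi> x}"
  have "closed T" unfolding T_def
    by (rule continuous_on_closed_Collect_le[OF continuous_on_const cont]) simp
  have "\<exists>x\<ge>0. \<psi> x \<ge> u"
    using lim[unfolded filterlim_at_top, rule_format, of u] eventually_ge_at_top[of 0]
    by (metis (mono_tags, lifting) eventually_at_top_linorder eventually_conj order_refl)
  then have ne: "T \<noteq> {}" unfolding T_def by auto
  define m where "m = Inf T"
  have bdd: "bdd_below T" unfolding T_def by (auto simp: bdd_below_def)
  have mT: "m \<in> T" unfolding m_def using ne bdd \<open>closed T\<close> by (intro closed_contains_Inf)
  have min: "m \<le> x" if "x \<in> T" for x unfolding m_def using that bdd by (intro cInf_lower)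
  have m0: "0 \<le> m" "u \<le> \<psi> m" using mT by (auto simp: T_def)
  have cont': "continuous_on {0..x} \<psi>" for x by (rule continuous_on_subset[OF cont]) auto
  have "(0 \<le> x \<and> running_sup \<psi> x \<ge> u) \<longleftrightarrow> m \<le> x" for x
  proof (cases "0 \<le> x")
    case True
    have cpt: "compact (\<psi> ` {0..x})"
      by (intro compact_continuous_image cont' compact_Icc)
    have bd: "bdd_above (\<psi> ` {0..x})" using cpt by (intro bounded_imp_bdd_above compact_imp_bounded)
    show ?thesis
    proof
      assume "m \<le> x"
      then have "\<psi> m \<le> running_sup \<psi> x" unfolding running_sup_def
        using m0 bd by (intro cSUP_upper) auto
      then show "0 \<le> x \<and> running_sup \<psi> x \<ge> u" using True m0 by auto
    next
      assume *: "0 \<le> x \<and> running_sup \<psi> x \<ge> u"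
      have "Sup (\<psi> ` {0..x}) \<in> \<psi> ` {0..x}"
        using cpt bd True by (intro closed_contains_Sup compact_imp_closed) auto
      then obtain y where "y \<in> {0..x}" "\<psi> y = running_sup \<psi> x"
        unfolding running_sup_def by auto
      then show "m \<le> x" using * min[of y] by (auto simp: T_def)
    qed
  qed (use m0 in auto)
  then have g: "generalized_inverse \<psi> u = m" unfolding generalized_inverse_def by (simp add: atLeast_def[symmetric])
  \<comment> \<open>The intermediate value theorem finds the level \<open>u\<close> at some
    \<open>z \<le> m\<close>; minimality of \<open>m\<close> forces \<open>z = m\<close>, which
    upgrades the inequality at \<open>m\<close> to equality.\<close>
  obtain z where z: "0 \<le> z" "z \<le> m" "\<psi> z = u"
    using IVT'[of \<psi> 0 u m] m0 \<open>u > 0\<close> \<open>\<psi> 0 = 0\<close> cont' by auto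
  then have "m = z" using min[of z] by (auto simp: T_def)
  moreover have "z \<noteq> 0" using z \<open>u > 0\<close> \<open>\<psi> 0 = 0\<close> by auto
  ultimately show ?thesis using z g by auto
qed

text \<open>On \<open>{0..K}\<close> the continuous \<psi> is bounded, so a level above that bound
  is attained only beyond \<open>K\<close>.\<close>

lemma generalized_inverse_at_top:
  fixes \<psi> :: "real \<Rightarrow> real"
  assumes cont: "continuous_on {0..} \<psi>" and "\<psi> 0 = 0" and lim: "filterlim \<psi> at_top at_top"
  shows "filterlim (generalized_inverse \<psi>) at_top at_top"
  unfolding filterlim_at_top
proof
  fix K :: real
  have "compact (\<psi> ` {0..K})"
    by (intro compact_continuous_image continuous_on_subset[OF cont]) auto
  then obtain B where B: "\<And>x. x \<in> {0..K} \<Longrightarrow> \<psi> x \<le> B"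
    by (meson bounded_imp_bdd_above bdd_above.unfold compact_imp_bounded imageI)
  show "\<forall>\<^sub>F u in at_top. K \<le> generalized_inverse \<psi> u"
    using eventually_gt_at_top[of "max 0 B"]
  proof eventually_elim
    case (elim u)
    with generalized_inverse_attained[OF assms, of u] B[of "generalized_inverse \<psi> u"]
    show ?case by force
  qed
qed

section \<open>Cosine and Gamma integrals\<close>

text \<open>Integration by parts reduces this to the Dirichlet integral:
  \<open>Si r - (1 - cos r) / r\<close> is an antiderivative, with limits 0 at the origin and
  \<pi>/2 at infinity.\<close>

lemma nn_integral_one_minus_cos_div_sq:
  "(\<integral>\<^sup>+r. ennreal ((1 - cos r) / r\<^sup>2) * indicator {0<..} r \<partial>lborel) = ennreal (pi / 2)"
proof -
  let ?f = "\<lambda>r::real. (1 - cos r) / r\<^sup>2"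
  let ?F = "\<lambda>r::real. Si r - (1 - cos r) / r"
  have pos: "0 \<le> ?f r" for r by simp
  have D: "DERIV ?F x :> ?f x" if "0 < ereal x" for x
  proof -
    have x: "x > 0" using that by simp
    show ?thesis using x
      by (auto intro!: derivative_eq_intros DERIV_Si simp: field_simps power2_eq_square)
  qed
  have l0: "((?F \<circ> real_of_ereal) \<longlongrightarrow> 0) (at_right (0::ereal))"
  proof -
    have "((\<lambda>r::real. (1 - cos r) / r) \<longlongrightarrow> 0) (at_right 0)" by real_asymp
    moreover have "(Si \<longlongrightarrow> Si 0) (at_right 0)"
      using isCont_Si[of 0] unfolding isCont_def by (rule filterlim_mono) (auto simp: at_within_le_nhds intro: at_le)
    moreover have "Si 0 = 0" by (simp add: Si_def zero_ereal_def[symmetric])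
    ultimately have "(?F \<longlongrightarrow> 0) (at_right 0)" by (auto intro: tendsto_eq_intros)
    then show ?thesis by (simp add: zero_ereal_def ereal_tendsto_simps)
  qed
  have l1: "((?F \<circ> real_of_ereal) \<longlongrightarrow> pi / 2) (at_left \<infinity>)"
  proof -
    have "((\<lambda>r::real. (1 - cos r) / r) \<longlongrightarrow> 0) at_top" by real_asymp
    then have "(?F \<longlongrightarrow> pi / 2) at_top" using Si_at_top by (auto intro: tendsto_eq_intros)
    then show ?thesis by (simp add: ereal_tendsto_simps)
  qed
  have C: "isCont ?f x" if "0 < ereal x" for x
    using that by (intro continuous_intros) auto
  have si: "set_integrable lborel (einterval 0 \<infinity>) ?f" and eq: "(LBINT x=0..\<infinity>. ?f x) = pi / 2 - 0"
    using interval_integral_FTC_nonneg[OF _ D C _ l0 l1] by (auto simp: pos)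
  have "(\<integral>\<^sup>+r. ennreal (?f r) * indicator {0<..} r \<partial>lborel) = (\<integral>\<^sup>+r. ennreal (indicator (einterval 0 \<infinity>) r *\<^sub>R ?f r) \<partial>lborel)"
    by (intro nn_integral_cong) (auto simp: einterval_def zero_ereal_def split: split_indicator)
  also have "\<dots> = ennreal (\<integral>r. indicator (einterval 0 \<infinity>) r *\<^sub>R ?f r \<partial>lborel)"
    using si unfolding set_integrable_def by (intro nn_integral_eq_integral) (auto simp: pos)
  also have "(\<integral>r. indicator (einterval 0 \<infinity>) r *\<^sub>R ?f r \<partial>lborel) = pi / 2"
    using eq by (simp add: interval_lebesgue_integral_def set_lebesgue_integral_def)
  finally show ?thesis .
qed

lemma nn_integral_inverse_sq_atLeast:
  fixes a :: real
  assumes "a > 0"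
  shows "(\<integral>\<^sup>+r. ennreal (1 / r\<^sup>2) * indicator {a..} r \<partial>lborel) = ennreal (1 / a)"
proof -
  have "((\<lambda>r::real. - 1 / r) \<longlongrightarrow> 0) at_top" by real_asymp
  then have "(\<integral>\<^sup>+r. ennreal (1 / r\<^sup>2) * indicator {a..} r \<partial>lborel) = ennreal (0 - (- 1 / a))"
    using assms
    by (intro nn_integral_FTC_atLeast) (auto intro!: derivative_eq_intros simp: power2_eq_square)
  then show ?thesis by simp
qed

text \<open>This is the substitution of \<open>\<bar>z\<bar> * r\<close> for \<open>r\<close>. Both
  sides are first multiplied by \<open>\<bar>z\<bar>\<close>, the Jacobian, and the positive finite
  factor is cancelled at the end, which avoids division in \<open>ennreal\<close>.\<close>

lemma nn_integral_one_minus_cos_scaled: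
  fixes z :: real
  shows "(\<integral>\<^sup>+r. ennreal ((1 - cos (r * z)) / r\<^sup>2) * indicator {0<..} r \<partial>lborel) = ennreal (pi / 2 * \<bar>z\<bar>)"
proof (cases "z = 0")
  case False
  let ?c = "\<bar>z\<bar>"
  have c: "?c > 0" using False by simp
  have cos: "cos (r * z) = cos (?c * r)" for r
    by (cases "z \<ge> 0") (auto simp: mult.commute abs_if)
  have "ennreal ?c * (\<integral>\<^sup>+r. ennreal ((1 - cos (r * z)) / r\<^sup>2) * indicator {0<..} r \<partial>lborel) =
    ennreal ?c * (\<integral>\<^sup>+r. (ennreal (z\<^sup>2)) * (ennreal ((1 - cos (0 + ?c * r)) / (0 + ?c * r)\<^sup>2) * indicator {0<..} (0 + ?c * r)) \<partial>lborel)"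
    using c False
    by (intro arg_cong[where f="\<lambda>x. ennreal ?c * x"] nn_integral_cong)
       (auto simp: cos ennreal_mult[symmetric] power_mult_distrib zero_less_mult_iff split: split_indicator)
  also have "\<dots> = ennreal (z\<^sup>2) * (ennreal \<bar>?c\<bar> * (\<integral>\<^sup>+r. (ennreal ((1 - cos (0 + ?c * r)) / (0 + ?c * r)\<^sup>2) * indicator {0<..} (0 + ?c * r)) \<partial>lborel))"
    by (subst nn_integral_cmult) (auto simp: mult_ac)
  also have "\<dots> = ennreal (z\<^sup>2) * ennreal (pi / 2)"
    by (subst nn_integral_real_affine[symmetric, where c="?c" and t=0])
       (use False nn_integral_one_minus_cos_div_sq in auto)
  also have "\<dots> = ennreal ?c * ennreal (pi / 2 * ?c)"
  proof -
    have "z\<^sup>2 * (pi / 2) = ?c * (pi / 2 * ?c)" by (simp add: power2_eq_square)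
    then show ?thesis by (simp add: ennreal_mult[symmetric])
  qed
  finally show ?thesis using c
    by (subst (asm) ennreal_mult_cancel_left) auto
qed simp

text \<open>Write \<open>1 - exp (- (s powr \<alpha>))\<close> as the integral of
  \<open>exp (- u)\<close> over \<open>0 \<le> u \<le> s powr \<alpha>\<close> and exchange the
  integrals. The integral of \<open>1 / s\<^sup>2\<close> from \<open>u powr (1/\<alpha>)\<close> on
  is \<open>u powr (- 1/\<alpha>)\<close>, which leaves Euler's integral for
  \<open>Gamma (1 - 1/\<alpha>)\<close>.\<close>

lemma nn_integral_one_minus_exp_powr:
  assumes "1 < \<alpha>"
  shows "(\<integral>\<^sup>+s. ennreal ((1 - exp (- (s powr \<alpha>))) / s\<^sup>2) * indicator {0<..} s \<partial>lborel)
    = ennreal (Gamma (1 - 1 / \<alpha>))"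
proof -
  have a: "\<alpha> > 0" using assms by simp
  have 1: "ennreal ((1 - exp (- (s powr \<alpha>))) / s\<^sup>2) * indicator {0<..} s =
    (\<integral>\<^sup>+u. ennreal (exp (- u)) * (ennreal (1 / s\<^sup>2) * (indicator {0..} u * indicator {u powr (1/\<alpha>)..} s * indicator {0<..} s)) \<partial>lborel)" for s :: real
  proof (cases "s > 0")
    case True
    have iff: "u powr (1/\<alpha>) \<le> s \<longleftrightarrow> u \<le> s powr \<alpha>" if "u \<ge> 0" for u
    proof -
      have "u powr (1/\<alpha>) \<le> s \<longleftrightarrow> (u powr (1/\<alpha>)) powr \<alpha> \<le> s powr \<alpha>"
        using a True by (meson linorder_not_le powr_less_mono2 powr_mono2 less_imp_le powr_ge_zero)
      then show ?thesis using that a by (simp add: powr_powr)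
    qed
    have "(\<integral>\<^sup>+u. ennreal (exp (- u)) * (ennreal (1 / s\<^sup>2) * (indicator {0..} u * indicator {u powr (1/\<alpha>)..} s * indicator {0<..} s)) \<partial>lborel)
      = (\<integral>\<^sup>+u. ennreal (1 / s\<^sup>2) * (ennreal (exp (- u)) * indicator {0..s powr \<alpha>} u) \<partial>lborel)"
      using True iff by (intro nn_integral_cong) (auto split: split_indicator simp: mult_ac)
    also have "\<dots> = ennreal (1 / s\<^sup>2) * (\<integral>\<^sup>+u. (ennreal (exp (- u)) * indicator {0..s powr \<alpha>} u) \<partial>lborel)"
      by (intro nn_integral_cmult) auto
    also have "(\<integral>\<^sup>+u. (ennreal (exp (- u)) * indicator {0..s powr \<alpha>} u) \<partial>lborel) = ennreal (- exp (- (s powr \<alpha>)) - (- exp (- 0)))"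
      by (intro nn_integral_FTC_Icc) (auto intro!: derivative_eq_intros)
    finally show ?thesis using True by (simp add: ennreal_mult[symmetric])
  qed simp
  have "(\<integral>\<^sup>+s. ennreal ((1 - exp (- (s powr \<alpha>))) / s\<^sup>2) * indicator {0<..} s \<partial>lborel) =
    (\<integral>\<^sup>+s. (\<integral>\<^sup>+u. ennreal (exp (- u)) * (ennreal (1 / s\<^sup>2) * (indicator {0..} u * indicator {u powr (1/\<alpha>)..} s * indicator {0<..} s)) \<partial>lborel) \<partial>lborel)"
    by (simp only: 1)
  also have "\<dots> = (\<integral>\<^sup>+u. (\<integral>\<^sup>+s. ennreal (exp (- u)) * (ennreal (1 / s\<^sup>2) * (indicator {0..} u * indicator {u powr (1/\<alpha>)..} s * indicator {0<..} s)) \<partial>lborel) \<partial>lborel)"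
    by (rule lborel_pair.Fubini') (unfold indicator_def atLeast_def greaterThan_def, simp, measurable)
  also have "\<dots> = (\<integral>\<^sup>+u. ennreal (indicator {0..} u * u powr ((1 - 1/\<alpha>) - 1) / exp u) \<partial>lborel)"
  proof (rule nn_integral_cong_AE)
    \<comment> \<open>At \<open>u = 0\<close> the inner integral is infinite while the right-hand
      side is 0 because \<open>0 powr _ = 0\<close>, so this null set has to be dropped.\<close>
    have "AE u in lborel. u \<noteq> (0::real)" by (rule AE_lborel_singleton)
    then show "AE u in lborel. (\<integral>\<^sup>+s. ennreal (exp (- u)) * (ennreal (1 / s\<^sup>2) * (indicator {0..} u * indicator {u powr (1/\<alpha>)..} s * indicator {0<..} s)) \<partial>lborel)
      = ennreal (indicator {0..} u * u powr ((1 - 1/\<alpha>) - 1) / exp u)"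
    proof eventually_elim
      case (elim u)
      show ?case
      proof (cases "u > 0")
        case True
        have p: "u powr (1/\<alpha>) > 0" using True by simp
        have "(\<integral>\<^sup>+s. ennreal (exp (- u)) * (ennreal (1 / s\<^sup>2) * (indicator {0..} u * indicator {u powr (1/\<alpha>)..} s * indicator {0<..} s)) \<partial>lborel)
          = (\<integral>\<^sup>+s. ennreal (exp (- u)) * (ennreal (1 / s\<^sup>2) * indicator {u powr (1/\<alpha>)..} s) \<partial>lborel)"
          using True p by (intro nn_integral_cong) (auto split: split_indicator dest: less_le_trans[OF p])
        also have "\<dots> = ennreal (exp (- u)) * ennreal (1 / u powr (1/\<alpha>))"
          using p by (subst nn_integral_cmult) (auto simp: nn_integral_inverse_sq_atLeast)
        also have "\<dots> = ennreal (indicator {0..} u * u powr ((1 - 1/\<alpha>) - 1) / exp u)"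
          using True by (simp add: ennreal_mult[symmetric] exp_minus powr_minus field_simps)
        finally show ?thesis .
      qed (use elim in auto)
    qed
  qed
  also have "\<dots> = ennreal (Gamma (1 - 1 / \<alpha>))"
  proof -
    have "1 - 1/\<alpha> > 0" using assms by simp
    then show ?thesis
      using Gamma_conv_nn_integral_real[of "1 - 1/\<alpha>"] by simp
  qed
  finally show ?thesis .
qed

text \<open>\<open>1 - sin z / z\<close> is the mean of \<open>1 - cos (r * z)\<close> over
  \<open>0 \<le> r \<le> 1\<close>. For \<open>z \<ge> 2\<close> it is at least 1/2; for
  \<open>0 < z < 2\<close> the Taylor polynomial leaves the factor \<open>1/6 - 4/120 = 2/15\<close>
  in front of \<open>z\<^sup>2\<close>, rounded down to 1/8.\<close>

lemma one_minus_sin_div_ge: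
  fixes z :: real
  assumes "z \<noteq> 0"
  shows "min 1 (z\<^sup>2) / 8 \<le> 1 - sin z / z"
proof -
  have pos: "min 1 (z\<^sup>2) / 8 \<le> 1 - sin z / z" if "z > 0" for z :: real
  proof (cases "z \<ge> 2")
    case True
    have "sin z / z \<le> 1 / 2"
    proof -
      have "sin z \<le> 1" by (rule sin_le_one)
      then have "sin z * 2 \<le> z" using True by linarith
      then show ?thesis using True by (simp add: field_simps)
    qed
    then show ?thesis by linarith
  next
    case False
    have "\<bar>sin z - (\<Sum>m<5. sin_coeff m * z ^ m)\<bar> \<le> inverse (fact 5) * \<bar>z\<bar> ^ 5"
      by (rule Maclaurin_sin_bound)
    moreover have "(\<Sum>m<5. sin_coeff m * z ^ m) = z - z ^ 3 / 6"
    proof -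
      have "{..<5} = {0, 1, 2, 3, 4::nat}" by auto
      then show ?thesis by (simp add: sin_coeff_def fact_numeral)
    qed
    moreover have "inverse (fact 5) = (1 / 120 :: real)" by (simp add: fact_numeral)
    ultimately have "sin z \<le> z - z ^ 3 / 6 + z ^ 5 / 120"
      using \<open>z > 0\<close> by (auto simp only: abs_le_iff abs_of_pos)
    moreover have "z ^ 5 \<le> 4 * z ^ 3"
    proof -
      have "z ^ 2 \<le> 2 ^ 2" using False \<open>z > 0\<close> by (intro power_mono) auto
      then have "z ^ 2 * z ^ 3 \<le> 4 * z ^ 3" using \<open>z > 0\<close> by (intro mult_right_mono) auto
      then show ?thesis by (simp flip: power_add)
    qed
    ultimately have "sin z \<le> z - z ^ 3 / 8" using \<open>z > 0\<close> zero_less_power[of z 3] by linarith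
    then have "sin z / z \<le> 1 - z\<^sup>2 / 8"
      using \<open>z > 0\<close> by (simp add: field_simps power3_eq_cube power2_eq_square)
    then show ?thesis by linarith
  qed
  show ?thesis
    using pos[of z] pos[of "- z"] assms by (cases "z > 0") auto
qed

lemma nn_integral_one_minus_cos_Icc:
  fixes z :: real
  shows "ennreal (min 1 (z\<^sup>2) / 8) \<le> (\<integral>\<^sup>+r. ennreal (1 - cos (r * z)) * indicator {0..1} r \<partial>lborel)"
proof (cases "z = 0")
  case False
  have "(\<integral>\<^sup>+r. ennreal (1 - cos (r * z)) * indicator {0..1} r \<partial>lborel)
      = ennreal ((1 - sin (1 * z) / z) - (0 - sin (0 * z) / z))"
    using False by (intro nn_integral_FTC_Icc) (auto intro!: derivative_eq_intros)
  then show ?thesis using one_minus_sin_div_ge[OF False] by (simp add: ennreal_leI)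
qed simp

section \<open>Truncated second moments from the exponent near zero\<close>

context prob_space
begin

text \<open>The exponent is only constrained on the half-line, so the weight has to vanish off it.\<close>

lemma nn_integral_one_minus_cos_exponent:
  fixes Z :: "'a \<Rightarrow> real" and \<psi> :: "real \<Rightarrow> real" and k :: "real \<Rightarrow> ennreal"
  assumes [measurable]: "random_variable borel Z" "k \<in> borel_measurable borel"
    and cf: "\<And>r. 0 \<le> r \<Longrightarrow> expectation (\<lambda>\<omega>. cos (r * Z \<omega>)) = exp (- (t * \<psi> r))"
    and k: "\<And>r. r < 0 \<Longrightarrow> k r = 0"
  shows "(\<integral>\<^sup>+\<omega>. (\<integral>\<^sup>+r. ennreal (1 - cos (r * Z \<omega>)) * k r \<partial>lborel) \<partial>M)
    = (\<integral>\<^sup>+r. ennreal (1 - exp (- (t * \<psi> r))) * k r \<partial>lborel)"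
proof -
  interpret P: pair_sigma_finite M "lborel :: real measure" ..
  have "(\<integral>\<^sup>+\<omega>. (\<integral>\<^sup>+r. ennreal (1 - cos (r * Z \<omega>)) * k r \<partial>lborel) \<partial>M) =
     (\<integral>\<^sup>+r. (\<integral>\<^sup>+\<omega>. ennreal (1 - cos (r * Z \<omega>)) * k r \<partial>M) \<partial>lborel)"
    by (rule P.Fubini'[symmetric]) measurable
  also have "\<dots> = (\<integral>\<^sup>+r. ennreal (1 - exp (- (t * \<psi> r))) * k r \<partial>lborel)"
  proof (rule nn_integral_cong)
    fix r :: real
    show "(\<integral>\<^sup>+\<omega>. ennreal (1 - cos (r * Z \<omega>)) * k r \<partial>M) = ennreal (1 - exp (- (t * \<psi> r))) * k r"
    proof (cases "r < 0")
      case False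
      have i: "integrable M (\<lambda>\<omega>. cos (r * Z \<omega>))"
        by (intro integrable_const_bound[where B=1]) auto
      have "(\<integral>\<^sup>+\<omega>. ennreal (1 - cos (r * Z \<omega>)) * k r \<partial>M) = (\<integral>\<^sup>+\<omega>. ennreal (1 - cos (r * Z \<omega>)) \<partial>M) * k r"
        by (rule nn_integral_multc) measurable
      also have "(\<integral>\<^sup>+\<omega>. ennreal (1 - cos (r * Z \<omega>)) \<partial>M) = ennreal (expectation (\<lambda>\<omega>. 1 - cos (r * Z \<omega>)))"
        using i by (intro nn_integral_eq_integral) auto
      also have "expectation (\<lambda>\<omega>. 1 - cos (r * Z \<omega>)) = 1 - exp (- (t * \<psi> r))"
        using i False by (simp add: cf prob_space)
      finally show ?thesis .
    qed (simp add: k)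
  qed
  finally show ?thesis .
qed

text \<open>Averaging \<open>1 - cos (r * Z)\<close> over \<open>0 \<le> r \<le> 1\<close> dominates
  an eighth of the truncated square, and after taking expectations the integrand is at most
  \<open>t * \<psi> r\<close>. This linear bound in \<open>t\<close> is the source of every error
  term below.\<close>

lemma nn_integral_min_one_sq_le:
  fixes Z :: "'a \<Rightarrow> real" and \<psi> :: "real \<Rightarrow> real"
  assumes [measurable]: "random_variable borel Z"
    and cf: "\<And>r. 0 \<le> r \<Longrightarrow> expectation (\<lambda>\<omega>. cos (r * Z \<omega>)) = exp (- (t * \<psi> r))"
    and B: "\<And>r. r \<in> {0..1} \<Longrightarrow> \<psi> r \<le> B" and "t \<ge> 0"
  shows "(\<integral>\<^sup>+\<omega>. ennreal (min 1 ((Z \<omega>)\<^sup>2)) \<partial>M) \<le> ennreal (8 * B * t)"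
proof -
  have "(\<integral>\<^sup>+\<omega>. ennreal (min 1 ((Z \<omega>)\<^sup>2)) \<partial>M) =
     (\<integral>\<^sup>+\<omega>. ennreal 8 * ennreal (min 1 ((Z \<omega>)\<^sup>2) / 8) \<partial>M)"
    by (intro nn_integral_cong) (simp only: ennreal_mult'[symmetric], simp)
  also have "\<dots> = ennreal 8 * (\<integral>\<^sup>+\<omega>. ennreal (min 1 ((Z \<omega>)\<^sup>2) / 8) \<partial>M)"
    by (rule nn_integral_cmult) measurable
  also have "\<dots> \<le> ennreal 8 * (\<integral>\<^sup>+\<omega>. (\<integral>\<^sup>+r. ennreal (1 - cos (r * Z \<omega>)) * indicator {0..1} r \<partial>lborel) \<partial>M)"
    by (intro mult_left_mono nn_integral_mono nn_integral_one_minus_cos_Icc) auto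
  also have "(\<integral>\<^sup>+\<omega>. (\<integral>\<^sup>+r. ennreal (1 - cos (r * Z \<omega>)) * indicator {0..1} r \<partial>lborel) \<partial>M)
     = (\<integral>\<^sup>+r. ennreal (1 - exp (- (t * \<psi> r))) * indicator {0..1} r \<partial>lborel)"
    using cf by (intro nn_integral_one_minus_cos_exponent) auto
  also have "\<dots> \<le> (\<integral>\<^sup>+r. ennreal (B * t) * indicator {0..1::real} r \<partial>lborel)"
  proof (intro nn_integral_mono)
    fix r :: real
    have "1 - exp (- (t * \<psi> r)) \<le> B * t" if "r \<in> {0..1}"
    proof -
      have "1 - exp (- (t * \<psi> r)) \<le> t * \<psi> r"
        using exp_ge_add_one_self[of "- (t * \<psi> r)"] by linarith
      also have "\<dots> \<le> t * B" using B[OF that] \<open>t \<ge> 0\<close> by (intro mult_left_mono)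
      finally show ?thesis by (simp add: mult.commute)
    qed
    then show "ennreal (1 - exp (- (t * \<psi> r))) * indicator {0..1} r \<le> ennreal (B * t) * indicator {0..1::real} r"
      by (auto split: split_indicator intro!: ennreal_leI)
  qed
  also have "\<dots> = ennreal (B * t)" by (simp add: nn_integral_cmult_indicator)
  also have "ennreal 8 * ennreal (B * t) = ennreal (8 * B * t)"
    by (simp only: ennreal_mult'[symmetric] mult.assoc)
  finally show ?thesis by (simp add: mult_left_mono)
qed

end

text \<open>\<open>W\<close> is the cosine representation of \<open>pi / 2 * \<bar>z\<bar>\<close>
  with the frequencies below \<open>r0\<close> removed. The removed part is at most
  \<open>r0 / 2 * z\<^sup>2\<close> because
  \<open>(1 - cos (r * z)) / r\<^sup>2 \<le> z\<^sup>2 / 2\<close>. The first bound serves large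
  displacements, the other two small ones.\<close>

lemma truncated_cosine_kernel_bounds:
  fixes z r0 :: real
  assumes "r0 > 0"
  defines "W \<equiv> (\<integral>\<^sup>+r. ennreal (1 - cos (r * z)) * (ennreal (1 / r\<^sup>2) * indicator {r0..} r) \<partial>lborel)"
  shows "W \<le> ennreal (2 / r0)" "W \<le> ennreal (pi / 2 * \<bar>z\<bar>)"
    "ennreal (pi / 2 * \<bar>z\<bar>) \<le> W + ennreal (r0 / 2 * z\<^sup>2)"
proof -
  have "W \<le> (\<integral>\<^sup>+r. ennreal 2 * (ennreal (1 / r\<^sup>2) * indicator {r0..} r) \<partial>lborel)"
    unfolding W_def by (intro nn_integral_mono mult_right_mono ennreal_leI) (auto intro: order_trans[OF diff_left_mono[OF cos_ge_minus_one]])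
  also have "\<dots> = ennreal 2 * ennreal (1 / r0)"
    using assms by (subst nn_integral_cmult) (auto simp: nn_integral_inverse_sq_atLeast)
  finally show "W \<le> ennreal (2 / r0)" using assms by (simp add: ennreal_mult'[symmetric] del: ennreal_numeral)
  have W: "W = (\<integral>\<^sup>+r. ennreal ((1 - cos (r * z)) / r\<^sup>2) * indicator {r0..} r \<partial>lborel)"
    unfolding W_def by (intro nn_integral_cong) (auto split: split_indicator simp: ennreal_mult'[symmetric] ennreal_mult''[symmetric])
  have "(\<integral>\<^sup>+r. ennreal ((1 - cos (r * z)) / r\<^sup>2) * indicator {r0..} r \<partial>lborel)
     \<le> (\<integral>\<^sup>+r. ennreal ((1 - cos (r * z)) / r\<^sup>2) * indicator {0<..} r \<partial>lborel)"
    using assms by (intro nn_integral_mono) (auto split: split_indicator)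
  then show "W \<le> ennreal (pi / 2 * \<bar>z\<bar>)" unfolding W nn_integral_one_minus_cos_scaled .
  have "(\<integral>\<^sup>+r. ennreal ((1 - cos (r * z)) / r\<^sup>2) * indicator {0<..} r \<partial>lborel)
     \<le> (\<integral>\<^sup>+r. ennreal ((1 - cos (r * z)) / r\<^sup>2) * indicator {r0..} r + ennreal (z\<^sup>2 / 2) * indicator {0..r0} r \<partial>lborel)"
  proof (intro nn_integral_mono)
    fix r :: real
    have "(1 - cos (r * z)) / r\<^sup>2 \<le> z\<^sup>2 / 2" if "r > 0"
    proof -
      have "1 - cos (r * z) = 2 * (sin (r * z / 2))\<^sup>2"
        using cos_double_sin[of "r * z / 2"] by simp
      also have "\<dots> \<le> 2 * (r * z / 2)\<^sup>2"
        using abs_sin_x_le_abs_x[of "r * z / 2"] by (simp only: abs_le_square_iff mult_left_mono)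
      finally have "1 - cos (r * z) \<le> (r * z)\<^sup>2 / 2" by (simp add: power_divide)
      then show ?thesis using that by (simp add: field_simps power_mult_distrib)
    qed
    then show "ennreal ((1 - cos (r * z)) / r\<^sup>2) * indicator {0<..} r
      \<le> ennreal ((1 - cos (r * z)) / r\<^sup>2) * indicator {r0..} r + ennreal (z\<^sup>2 / 2) * indicator {0..r0} r"
      by (auto split: split_indicator intro!: ennreal_leI)
  qed
  also have "\<dots> = W + (\<integral>\<^sup>+r. ennreal (z\<^sup>2 / 2) * indicator {0..r0} r \<partial>lborel)"
    unfolding W by (rule nn_integral_add) auto
  also have "(\<integral>\<^sup>+r. ennreal (z\<^sup>2 / 2) * indicator {0..r0} r \<partial>lborel) = ennreal (r0 / 2 * z\<^sup>2)"
    using assms(1) by (subst nn_integral_cmult_indicator) (auto simp: ennreal_mult''[symmetric] mult.commute)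
  finally show "ennreal (pi / 2 * \<bar>z\<bar>) \<le> W + ennreal (r0 / 2 * z\<^sup>2)"
    unfolding nn_integral_one_minus_cos_scaled .
qed

text \<open>With \<open>R\<close> the inverse at \<open>1 / t\<close>, the substitution
  \<open>r = R * s\<close> absorbs the prefactor and replaces \<open>t * \<psi> r\<close> by
  \<open>\<psi> (R * s) / \<psi> R\<close>, which tends to \<open>s powr \<alpha>\<close>. The
  cut-off \<open>r0\<close> originates here: it is the threshold beyond which the Potter bound
  holds.\<close>

lemma scaled_exponent_integral_limit:
  fixes \<psi> :: "real \<Rightarrow> real"
  assumes rv: "regularly_varying \<psi> \<alpha>" and cont: "continuous_on {0..} \<psi>" and "\<alpha> > 1"
    and zero: "\<psi> 0 = 0" and nonneg: "\<And>r. r \<ge> 0 \<Longrightarrow> \<psi> r \<ge> 0"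
  shows "\<exists>r0>0. ((\<lambda>t. ennreal (generalized_inverse \<psi> (1 / t)) *
      (\<integral>\<^sup>+r. ennreal (1 - exp (- (t * \<psi> r))) * (ennreal (1 / r\<^sup>2) * indicator {r0..} r) \<partial>lborel))
      \<longlongrightarrow> ennreal (Gamma (1 - 1 / \<alpha>))) (at_right 0)"
proof -
  define \<delta> where "\<delta> = (\<alpha> - 1) / 2"
  have \<delta>: "\<delta> > 0" "\<alpha> - \<delta> - 2 > -1" using \<open>\<alpha> > 1\<close> by (auto simp: \<delta>_def field_simps)
  obtain C r0 where C: "C > 0" "r0 > 0" "\<And>r. r \<ge> r0 \<Longrightarrow> \<psi> r > 0"
    "\<And>s r. r0 \<le> s \<Longrightarrow> s \<le> r \<Longrightarrow> \<psi> s \<le> C * (s / r) powr (\<alpha> - \<delta>) * \<psi> r"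
    using regularly_varying_Potter[OF rv cont \<delta>(1)] by blast
  have lim\<psi>: "filterlim \<psi> at_top at_top"
  proof (rule filterlim_at_top_mono)
    show "filterlim (\<lambda>r. \<psi> r / r) at_top at_top"
      by (rule regularly_varying_superlinear[OF rv cont \<open>\<alpha> > 1\<close>])
    show "\<forall>\<^sub>F r in at_top. \<psi> r / r \<le> \<psi> r"
      using eventually_ge_at_top[of 1]
    proof eventually_elim
      case (elim r)
      then show ?case using nonneg[of r] mult_right_mono[of 1 r "\<psi> r"] by (simp add: field_simps)
    qed
  qed
  note gi = generalized_inverse_attained[OF cont zero lim\<psi>]
  note gi_top = generalized_inverse_at_top[OF cont zero lim\<psi>]
  have lim: "\<And>c. c > 0 \<Longrightarrow> ((\<lambda>r. \<psi> (c * r) / \<psi> r) \<longlongrightarrow> c powr \<alpha>) at_top"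
    using rv unfolding regularly_varying_def by blast
  \<comment> \<open>The majorant. For \<open>s \<le> 1\<close>, \<open>1 - exp (- x) \<le> x\<close>
    and the Potter bound at \<open>r = R n\<close> give the power, whose exponent is greater than
    -1; for \<open>s \<ge> 1\<close> the numerator is simply at most 1.\<close>
  define g where "g s = ennreal (C * s powr (\<alpha> - \<delta> - 2)) * indicator {0..1} s + ennreal (1 / s\<^sup>2) * indicator {1..} s" for s :: real
  let ?I = "\<lambda>t. ennreal (generalized_inverse \<psi> (1 / t)) *
      (\<integral>\<^sup>+r. ennreal (1 - exp (- (t * \<psi> r))) * (ennreal (1 / r\<^sup>2) * indicator {r0..} r) \<partial>lborel)"
  have "(?I \<longlongrightarrow> ennreal (Gamma (1 - 1 / \<alpha>))) (at_right 0)"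
  proof (rule tendsto_at_right_sequentially[of 0 1])
    fix S :: "nat \<Rightarrow> real"
    assume S: "\<And>n. 0 < S n" "S \<longlonglongrightarrow> 0"
    define R where "R n = generalized_inverse \<psi> (1 / S n)" for n
    have R: "R n > 0" "\<psi> (R n) = 1 / S n" for n
      using gi[of "1 / S n"] S by (auto simp: R_def)
    have "filterlim (\<lambda>n. 1 / S n) at_top sequentially"
      using filterlim_inverse_at_top[OF S(2)] S(1) by (simp add: inverse_eq_divide)
    then have Rtop: "filterlim R at_top sequentially"
      unfolding R_def by (rule filterlim_compose[OF gi_top])
    define F where "F n s = ennreal ((1 - exp (- (S n * \<psi> (R n * s)))) / s\<^sup>2) * indicator {r0 / R n..} s" for n s
    \<comment> \<open>The exponent is known to be continuous only on the half-line; composing with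
      \<open>max 0\<close> gives a Borel function on the whole line, equal to \<psi> wherever the
      integrand is nonzero.\<close>
    have cont_shift: "continuous_on UNIV (\<lambda>r. \<psi> (max 0 r))"
      by (intro continuous_on_compose2[OF cont] continuous_intros) auto
    have m\<psi>[measurable]: "(\<lambda>r. \<psi> (max 0 r)) \<in> borel_measurable borel"
      by (intro borel_measurable_continuous_onI cont_shift)
    have Fm: "F n = (\<lambda>s. ennreal ((1 - exp (- (S n * \<psi> (max 0 (R n * s))))) / s\<^sup>2) * indicator {r0 / R n..} s)" for n
    proof
      fix s show "F n s = ennreal ((1 - exp (- (S n * \<psi> (max 0 (R n * s))))) / s\<^sup>2) * indicator {r0 / R n..} s"
      proof (cases "s \<ge> r0 / R n")
        case True
        then have "s > 0" using R(1)[of n] C(2) by (meson divide_pos_pos less_le_trans)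
        then show ?thesis using R(1)[of n] by (simp add: F_def max_def)
      qed (simp add: F_def)
    qed
    have I: "?I (S n) = (\<integral>\<^sup>+s. F n s \<partial>lborel)" for n
    proof -
      let ?J = "\<integral>\<^sup>+s. ennreal (1 - exp (- (S n * \<psi> (max 0 (0 + R n * s))))) * (ennreal (1 / (0 + R n * s)\<^sup>2) * indicator {r0..} (0 + R n * s)) \<partial>lborel"
      have "(\<integral>\<^sup>+r. ennreal (1 - exp (- (S n * \<psi> r))) * (ennreal (1 / r\<^sup>2) * indicator {r0..} r) \<partial>lborel)
         = (\<integral>\<^sup>+r. ennreal (1 - exp (- (S n * \<psi> (max 0 r)))) * (ennreal (1 / r\<^sup>2) * indicator {r0..} r) \<partial>lborel)"
        using C by (intro nn_integral_cong) (auto split: split_indicator simp: max_def)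
      also have "\<dots> = ennreal \<bar>R n\<bar> * ?J"
        using R(1)[of n] by (intro nn_integral_real_affine) auto
      finally have "?I (S n) = ennreal (R n) * (ennreal \<bar>R n\<bar> * ?J)"
        by (simp only: R_def)
      \<comment> \<open>One factor \<open>R n\<close> is the prefactor of the statement, the other
        the Jacobian; together they cancel against the square of \<open>R n * s\<close> in the
        denominator.\<close>
      also have "\<dots> = ennreal ((R n)\<^sup>2) * ?J"
        using R(1)[of n] by (simp only: power2_eq_square abs_of_pos ennreal_mult'' less_imp_le mult.assoc)
      also have "\<dots> = (\<integral>\<^sup>+s. ennreal ((R n)\<^sup>2) * (ennreal (1 - exp (- (S n * \<psi> (max 0 (0 + R n * s))))) * (ennreal (1 / (0 + R n * s)\<^sup>2) * indicator {r0..} (0 + R n * s))) \<partial>lborel)"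
        by (rule nn_integral_cmult[symmetric]) measurable
      also have "\<dots> = (\<integral>\<^sup>+s. F n s \<partial>lborel)"
      proof (rule nn_integral_cong)
        fix s
        have iff: "r0 \<le> R n * s \<longleftrightarrow> r0 / R n \<le> s" using R(1)[of n] by (simp add: field_simps)
        show "ennreal ((R n)\<^sup>2) * (ennreal (1 - exp (- (S n * \<psi> (max 0 (0 + R n * s))))) * (ennreal (1 / (0 + R n * s)\<^sup>2) * indicator {r0..} (0 + R n * s))) = F n s"
        proof (cases "r0 / R n \<le> s")
          case True
          have e: "1 - exp (- (S n * \<psi> (max 0 (R n * s)))) \<ge> 0"
            using nonneg[of "max 0 (R n * s)"] S(1)[of n] by simp
          have "(R n)\<^sup>2 * ((1 - exp (- (S n * \<psi> (max 0 (R n * s))))) * (1 / (R n * s)\<^sup>2)) = (1 - exp (- (S n * \<psi> (max 0 (R n * s))))) / s\<^sup>2"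
            using R(1)[of n] by (simp add: power_mult_distrib)
          then show ?thesis using True iff e
            unfolding Fm by (simp add: ennreal_mult'[symmetric] ennreal_mult''[symmetric])
        qed (use iff in \<open>auto simp: F_def\<close>)
      qed
      finally show ?thesis .
    qed
    have "(\<lambda>n. \<integral>\<^sup>+s. F n s \<partial>lborel) \<longlonglongrightarrow> (\<integral>\<^sup>+s. ennreal ((1 - exp (- (s powr \<alpha>))) / s\<^sup>2) * indicator {0<..} s \<partial>lborel)"
    proof (rule nn_integral_dominated_convergence[where w=g])
      show "F n \<in> borel_measurable lborel" for n unfolding Fm by measurable
      show "g \<in> borel_measurable lborel" unfolding g_def[abs_def] by measurable
      have "(\<integral>\<^sup>+s. g s \<partial>lborel) = (\<integral>\<^sup>+s. ennreal (C * s powr (\<alpha> - \<delta> - 2)) * indicator {0..1} s \<partial>lborel) + (\<integral>\<^sup>+s. ennreal (1 / s\<^sup>2) * indicator {1..} (s::real) \<partial>lborel)"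
        unfolding g_def by (rule nn_integral_add) auto
      moreover have "(\<integral>\<^sup>+s. ennreal (1 / s\<^sup>2) * indicator {1..} (s::real) \<partial>lborel) < \<infinity>"
        by (subst nn_integral_inverse_sq_atLeast) auto
      moreover have "(\<integral>\<^sup>+s. ennreal (C * s powr (\<alpha> - \<delta> - 2)) * indicator {0..1} s \<partial>lborel) < \<infinity>"
      proof -
        have "((\<lambda>s. C * s powr (\<alpha> - \<delta> - 2)) has_integral (C * (1 powr (\<alpha> - \<delta> - 2 + 1) / (\<alpha> - \<delta> - 2 + 1)))) {0..1}"
          using \<delta> by (intro has_integral_mult_right has_integral_powr_from_0) auto
        then show ?thesis using C
          by (subst nn_integral_has_integral_lebesgue') auto
      qed
      ultimately show "(\<integral>\<^sup>+s. g s \<partial>lborel) < \<infinity>" by simp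
      show "AE s in lborel. F n s \<le> g s" for n
      proof (rule AE_I2)
        fix s
        show "F n s \<le> g s"
        proof (cases "r0 / R n \<le> s")
          case True
          then have s: "s > 0" using R(1)[of n] C(2) by (meson divide_pos_pos less_le_trans)
          have Rs: "r0 \<le> R n * s" using True R(1)[of n] by (simp add: field_simps)
          show ?thesis
          proof (cases "s \<le> 1")
            case True
            have "1 - exp (- (S n * \<psi> (R n * s))) \<le> S n * \<psi> (R n * s)"
              using exp_ge_add_one_self[of "- (S n * \<psi> (R n * s))"] by linarith
            also have "\<psi> (R n * s) \<le> C * ((R n * s) / R n) powr (\<alpha> - \<delta>) * \<psi> (R n)"
              using Rs True R(1)[of n] s by (intro C) auto
            also have "S n * \<dots> = C * s powr (\<alpha> - \<delta>)"
              using R[of n] S(1)[of n] by simp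
            finally have "1 - exp (- (S n * \<psi> (R n * s))) \<le> C * s powr (\<alpha> - \<delta>)"
              using S(1)[of n] by (simp add: mult_left_mono)
            then have "(1 - exp (- (S n * \<psi> (R n * s)))) / s\<^sup>2 \<le> C * s powr (\<alpha> - \<delta>) / s\<^sup>2"
              by (intro divide_right_mono) auto
            also have "\<dots> = C * s powr (\<alpha> - \<delta> - 2)"
              using s by (simp add: powr_diff powr_numeral)
            finally have "F n s \<le> ennreal (C * s powr (\<alpha> - \<delta> - 2)) * indicator {0..1} s"
              using True s by (auto simp: F_def intro!: ennreal_leI split: split_indicator)
            then show ?thesis unfolding g_def by (simp add: add_increasing2)
          next
            case False
            have "(1 - exp (- (S n * \<psi> (R n * s)))) / s\<^sup>2 \<le> 1 / s\<^sup>2"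
              by (intro divide_right_mono) auto
            then show ?thesis using False by (auto simp: F_def g_def intro!: ennreal_leI split: split_indicator)
          qed
        qed (simp add: F_def)
      qed
      show "AE s in lborel. (\<lambda>n. F n s) \<longlonglongrightarrow> ennreal ((1 - exp (- (s powr \<alpha>))) / s\<^sup>2) * indicator {0<..} s"
      proof (rule AE_I2)
        fix s :: real
        show "(\<lambda>n. F n s) \<longlonglongrightarrow> ennreal ((1 - exp (- (s powr \<alpha>))) / s\<^sup>2) * indicator {0<..} s"
        proof (cases "s > 0")
          case True
          have "(\<lambda>n. \<psi> (s * R n) / \<psi> (R n)) \<longlonglongrightarrow> s powr \<alpha>"
            by (rule filterlim_compose[OF lim[OF True] Rtop])
          then have "(\<lambda>n. S n * \<psi> (R n * s)) \<longlonglongrightarrow> s powr \<alpha>"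
            using R(2) by (simp add: mult.commute)
          then have *: "(\<lambda>n. ennreal ((1 - exp (- (S n * \<psi> (R n * s)))) / s\<^sup>2)) \<longlonglongrightarrow> ennreal ((1 - exp (- (s powr \<alpha>))) / s\<^sup>2)"
            using True by (intro tendsto_intros) auto
          have "\<forall>\<^sub>F n in sequentially. ennreal ((1 - exp (- (S n * \<psi> (R n * s)))) / s\<^sup>2) = F n s"
            using Rtop[unfolded filterlim_at_top, rule_format, of "r0 / s"]
          proof eventually_elim
            case (elim n)
            then have "r0 / R n \<le> s" using True R(1)[of n] by (simp add: field_simps)
            then show ?case by (simp add: F_def)
          qed
          then show ?thesis using True by (simp add: Lim_transform_eventually[OF *])
        next
          case False
          have "F n s = 0" for n
          proof -
            have "r0 / R n > 0" using R(1)[of n] C(2) by auto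
            then show ?thesis using False by (auto simp: F_def split: split_indicator)
          qed
          then show ?thesis using False by simp
        qed
      qed
    qed measurable
    then show "(\<lambda>n. ?I (S n)) \<longlonglongrightarrow> ennreal (Gamma (1 - 1 / \<alpha>))"
      unfolding I nn_integral_one_minus_exp_powr[OF \<open>\<alpha> > 1\<close>] .
  qed simp
  then show ?thesis using C(2) by blast
qed

section \<open>Mollification\<close>

lemma nn_integral_lborel_shift:
  fixes y :: "'a::euclidean_space"
  assumes [measurable]: "f \<in> borel_measurable borel"
  shows "(\<integral>\<^sup>+x. f (x + y) \<partial>lborel) = (\<integral>\<^sup>+x. f x \<partial>lborel)"
proof -
  have "(\<integral>\<^sup>+x. f x \<partial>lborel) = (\<integral>\<^sup>+x. f x \<partial>distr lborel borel ((+) y))"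
    by (simp add: lborel_distr_plus)
  also have "\<dots> = (\<integral>\<^sup>+x. f (y + x) \<partial>lborel)" by (rule nn_integral_distr) auto
  finally show ?thesis by (simp add: add.commute)
qed

lemma lborel_integral_shift:
  fixes y :: "'a::euclidean_space" and f :: "'a \<Rightarrow> 'b::{banach, second_countable_topology}"
  assumes [measurable]: "f \<in> borel_measurable borel"
  shows "(\<integral>x. f (x + y) \<partial>lborel) = (\<integral>x. f x \<partial>lborel)"
proof -
  have "(\<integral>x. f x \<partial>lborel) = (\<integral>x. f x \<partial>distr lborel borel ((+) y))"
    by (simp add: lborel_distr_plus)
  also have "\<dots> = (\<integral>x. f (y + x) \<partial>lborel)" by (rule integral_distr) auto
  finally show ?thesis by (simp add: add.commute)
qed

lemma integrable_continuous_bounded_support: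
  fixes f :: "'a::euclidean_space \<Rightarrow> 'b::{banach, second_countable_topology}"
  assumes "continuous_on UNIV f" and "\<And>x. norm x > K \<Longrightarrow> f x = 0"
  shows "integrable lborel f"
proof -
  have "integrable lborel (\<lambda>x. indicator (cball 0 K) x *\<^sub>R f x)"
    by (intro borel_integrable_compact continuous_on_subset[OF assms(1)]) auto
  moreover have "(\<lambda>x. indicator (cball 0 K) x *\<^sub>R f x) = f"
    using assms(2) by (auto simp: fun_eq_iff split: split_indicator)
  ultimately show ?thesis by simp
qed

text \<open>A quadratic remainder survives integration against an integrable function, so a
  convolution can be differentiated by integrating the Taylor bound of its kernel.\<close>

lemma has_derivative_of_quadratic_remainder:
  fixes f :: "'a::real_normed_vector \<Rightarrow> 'b::real_normed_vector"
  assumes "bounded_linear f'" and rem: "\<And>h. norm (f (x + h) - f x - f' h) \<le> K * (norm h)\<^sup>2"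
  shows "(f has_derivative f') (at x)"
  unfolding has_derivative_at
proof (intro conjI assms(1))
  have lim: "((\<lambda>h::'a. K * norm h) \<longlongrightarrow> K * norm (0::'a)) (at 0)"
    by (intro tendsto_intros)
  show "((\<lambda>h. norm (f (x + h) - f x - f' h) / norm h) \<longlongrightarrow> 0) (at 0)"
  proof (rule tendsto_sandwich[of "\<lambda>_. 0"])
    show "((\<lambda>h::'a. K * norm h) \<longlongrightarrow> 0) (at 0)" using lim by simp
    show "\<forall>\<^sub>F h in at 0. norm (f (x + h) - f x - f' h) / norm h \<le> K * norm h"
      using eventually_neq_at_within[of 0]
    proof eventually_elim
      case (elim h)
      then show ?case using rem[of h] by (simp add: divide_le_eq power2_eq_square mult.assoc)
    qed
  qed auto
qed

text \<open>The square of the positive part is the profile of the mollifying kernel: it is C1 with a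
  Lipschitz derivative, and no higher smoothness of the kernel is used.\<close>

lemma DERIV_max_zero_power2: "((\<lambda>u::real. (max 0 u)\<^sup>2) has_real_derivative 2 * max 0 u) (at u)"
  unfolding has_field_derivative_def
proof (rule has_derivative_of_quadratic_remainder[where K=1])
  fix h :: real
  have *: "\<bar>(max 0 (u + h))\<^sup>2 - (max 0 u)\<^sup>2 - 2 * max 0 u * h\<bar> \<le> h\<^sup>2"
  proof (cases "u \<ge> 0"; cases "u + h \<ge> 0")
    assume "u \<ge> 0" "u + h \<ge> 0"
    then show ?thesis by (simp add: max_def power2_eq_square algebra_simps)
  next
    assume u: "u \<ge> 0" "\<not> u + h \<ge> 0"
    have "- (u\<^sup>2) - 2 * u * h = h\<^sup>2 - (u + h)\<^sup>2" by (simp add: power2_eq_square algebra_simps)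
    moreover have "(u + h)\<^sup>2 \<le> h\<^sup>2" using u by (intro abs_le_square_iff[THEN iffD1]) auto
    moreover have "(u + h)\<^sup>2 \<ge> 0" by simp
    ultimately have "\<bar>- (u\<^sup>2) - 2 * u * h\<bar> \<le> h\<^sup>2" by linarith
    then show ?thesis using u by (simp add: max_def)
  next
    assume u: "\<not> u \<ge> 0" "u + h \<ge> 0"
    then have "(u + h)\<^sup>2 \<le> h\<^sup>2" by (intro power_mono) auto
    then show ?thesis using u by (simp add: max_def)
  next
    assume "\<not> u \<ge> 0" "\<not> u + h \<ge> 0"
    then show ?thesis by (simp add: max_def)
  qed
  then show "norm ((max 0 (u + h))\<^sup>2 - (max 0 u)\<^sup>2 - 2 * max 0 u * h) \<le> 1 * (norm h)\<^sup>2"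
    by simp
qed (rule bounded_linear_mult_right)

text \<open>The gradient \<open>g\<close> and its Lipschitz constant \<open>L\<close> are part of
  the data because the Taylor remainder of the kernel, the derivatives of convolutions and their
  continuity are all estimated through \<open>L\<close>. Oddness of \<open>g\<close> lets the
  convolution be moved from a test field to the set.\<close>

locale mollifier =
  fixes \<rho> :: "'a::euclidean_space \<Rightarrow> real" and g :: "'a \<Rightarrow> 'a" and e L :: real
  assumes e_pos: "e > 0"
    and nonneg: "\<And>x. \<rho> x \<ge> 0"
    and even: "\<And>x. \<rho> (- x) = \<rho> x"
    and supp: "\<And>x. norm x > e \<Longrightarrow> \<rho> x = 0"
    and total: "(\<integral>\<^sup>+x. ennreal (\<rho> x) \<partial>lborel) = 1"
    and deriv: "\<And>x. (\<rho> has_derivative (\<lambda>h. g x \<bullet> h)) (at x)"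
    and grad_odd: "\<And>x. g (- x) = - g x"
    and grad_supp: "\<And>x. norm x > e \<Longrightarrow> g x = 0"
    and grad_lipschitz: "\<And>x y. norm (g x - g y) \<le> L * norm (x - y)"

text \<open>The kernel is the normalized square of the positive part of
  \<open>e\<^sup>2 - x \<bullet> x\<close>, with gradient \<open>- 4 * m x / I\<close> times
  \<open>x\<close>. Since \<open>m\<close> is at most \<open>e\<^sup>2\<close> and
  \<open>2 * e\<close>-Lipschitz, \<open>m x *\<^sub>R x\<close> is Lipschitz with constant
  \<open>e\<^sup>2 + 2 * e * e\<close>.\<close>

lemma mollifier_exists:
  assumes e: "e > 0"
  shows "\<exists>(\<rho> :: 'a::euclidean_space \<Rightarrow> real) g L. mollifier \<rho> g e L"
proof -
  define m where "m x = max 0 (e\<^sup>2 - x \<bullet> x)" for x :: 'a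
  define r where "r x = (m x)\<^sup>2" for x
  have m0: "m x = 0" if "norm x \<ge> e" for x
    using power_mono[OF that, of 2] e by (simp add: m_def power2_norm_eq_inner)
  have m1: "m x = e\<^sup>2 - (norm x)\<^sup>2" if "norm x \<le> e" for x
    using power_mono[OF that, of 2] by (simp add: m_def power2_norm_eq_inner)
  have mn: "0 \<le> m x" "m x \<le> e\<^sup>2" for x by (auto simp: m_def)
  have contr: "continuous_on UNIV r" unfolding r_def m_def by (intro continuous_intros)
  have ir: "integrable lborel r"
    by (rule integrable_continuous_bounded_support[OF contr, of e]) (simp add: r_def m0)
  have rn: "r x \<ge> 0" for x by (simp add: r_def)
  define I where "I = (\<integral>x. r x \<partial>lborel)"
  \<comment> \<open>The normalizing integral is positive because \<open>m\<close> is at least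
    \<open>3/4 * e\<^sup>2\<close> on the ball of half the radius.\<close>
  have "0 < (3/4 * e\<^sup>2)\<^sup>2 * measure lborel (ball (0::'a) (e/2))"
    using e content_ball_pos[of "e/2" "0::'a"] by simp
  also have "\<dots> = (\<integral>x. (3/4 * e\<^sup>2)\<^sup>2 * indicator (ball (0::'a) (e/2)) x \<partial>lborel)" by simp
  also have "\<dots> \<le> I" unfolding I_def
  proof (rule integral_mono)
    show "integrable lborel (\<lambda>x. (3/4 * e\<^sup>2)\<^sup>2 * indicator (ball (0::'a) (e/2)) x :: real)"
      using emeasure_bounded_finite[OF bounded_ball, of "0::'a" "e/2"]
      by (intro integrable_mult_right integrable_real_indicator) auto
    fix x :: 'a
    have "(3/4 * e\<^sup>2)\<^sup>2 \<le> r x" if "norm x < e / 2"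
    proof -
      have "(norm x)\<^sup>2 \<le> (e/2)\<^sup>2" using that by (intro power_mono) auto
      then have "3/4 * e\<^sup>2 \<le> m x" using that e by (simp add: m1 power_divide)
      then show ?thesis unfolding r_def using e by (intro power_mono) auto
    qed
    then show "(3/4 * e\<^sup>2)\<^sup>2 * indicator (ball (0::'a) (e/2)) x \<le> r x"
      by (auto split: split_indicator simp: r_def)
  qed (rule ir)
  finally have I: "I > 0" .
  define \<rho> where "\<rho> x = r x / I" for x
  define g where "g x = (- 4 * m x / I) *\<^sub>R x" for x
  have lip_m: "\<bar>m x - m y\<bar> \<le> 2 * e * norm (x - y)" if "norm y \<le> norm x" for x y
  proof (cases "norm y < e")
    case True
    \<comment> \<open>Capping the norm at \<open>e\<close> gives the single formula
      \<open>e\<^sup>2 - a\<^sup>2\<close> for \<open>m x\<close> inside and outside the support, so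
      no case distinction on \<open>x\<close> is needed.\<close>
    define a where "a = min (norm x) e"
    have a: "m x = e\<^sup>2 - a\<^sup>2" by (auto simp: a_def min_def m1 m0)
    have "m y = e\<^sup>2 - (norm y)\<^sup>2" using True by (simp add: m1)
    then have "\<bar>m x - m y\<bar> = \<bar>(a - norm y) * (a + norm y)\<bar>"
      unfolding a by (simp add: power2_eq_square algebra_simps)
    also have "\<dots> = (a - norm y) * (a + norm y)"
      using that True e by (simp add: a_def abs_mult)
    also have "\<dots> \<le> norm (x - y) * (2 * e)"
    proof (rule mult_mono)
      show "a - norm y \<le> norm (x - y)"
        using norm_triangle_ineq2[of x y] by (auto simp: a_def)
      show "a + norm y \<le> 2 * e" using True by (auto simp: a_def)
    qed (use that True e in \<open>auto simp: a_def\<close>)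
    finally show ?thesis by (simp add: mult_ac)
  next
    case False
    then show ?thesis using that e m0[of x] m0[of y] by simp
  qed
  have lip: "norm (m x *\<^sub>R x - m y *\<^sub>R y) \<le> 3 * e\<^sup>2 * norm (x - y)" if "norm y \<le> norm x" for x y
  proof (cases "norm y < e")
    case True
    have "norm (m x *\<^sub>R x - m y *\<^sub>R y) = norm (m x *\<^sub>R (x - y) + (m x - m y) *\<^sub>R y)"
      by (simp add: algebra_simps)
    also have "\<dots> \<le> norm (m x *\<^sub>R (x - y)) + norm ((m x - m y) *\<^sub>R y)" by (rule norm_triangle_ineq)
    also have "\<dots> = m x * norm (x - y) + \<bar>m x - m y\<bar> * norm y" using mn by simp
    also have "\<dots> \<le> e\<^sup>2 * norm (x - y) + (2 * e * norm (x - y)) * e"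
      using True e mn lip_m[OF that] by (intro add_mono mult_mono) auto
    finally show ?thesis by (simp add: power2_eq_square algebra_simps)
  next
    case False
    then show ?thesis using that e m0[of x] m0[of y] by simp
  qed
  have lip': "norm (m x *\<^sub>R x - m y *\<^sub>R y) \<le> 3 * e\<^sup>2 * norm (x - y)" for x y
    using lip[of x y] lip[of y x] by (cases "norm y \<le> norm x") (auto simp: norm_minus_commute)
  have "mollifier \<rho> g e (4 / I * (3 * e\<^sup>2))"
  proof
    show "e > 0" by fact
    show "\<rho> x \<ge> 0" for x using I by (simp add: \<rho>_def r_def)
    show "\<rho> (- x) = \<rho> x" for x by (simp add: \<rho>_def r_def m_def)
    show "norm x > e \<Longrightarrow> \<rho> x = 0" for x by (simp add: \<rho>_def r_def m0)
    have "(\<integral>\<^sup>+x. ennreal (\<rho> x) \<partial>lborel) = ennreal (\<integral>x. \<rho> x \<partial>lborel)"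
      unfolding \<rho>_def using ir I rn by (intro nn_integral_eq_integral) auto
    also have "(\<integral>x. \<rho> x \<partial>lborel) = 1"
      using I unfolding \<rho>_def by (simp add: I_def[symmetric])
    finally show "(\<integral>\<^sup>+x. ennreal (\<rho> x) \<partial>lborel) = 1" by simp
    show "(\<rho> has_derivative (\<lambda>h. g x \<bullet> h)) (at x)" for x
    proof -
      have "((\<lambda>x::'a. e\<^sup>2 - x \<bullet> x) has_derivative (\<lambda>h. - 2 * (x \<bullet> h))) (at x)"
        by (auto intro!: derivative_eq_intros simp: inner_commute)
      from DERIV_compose_FDERIV[where f="\<lambda>u. (max 0 u)\<^sup>2" and g="\<lambda>x. e\<^sup>2 - x \<bullet> x" and x=x, OF DERIV_max_zero_power2 this]
      have "(r has_derivative (\<lambda>h. - 2 * (x \<bullet> h) * (2 * m x))) (at x)"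
        by (simp add: r_def[abs_def] m_def[abs_def])
      then have "((\<lambda>x. r x / I) has_derivative (\<lambda>h. - 2 * (x \<bullet> h) * (2 * m x) / I)) (at x)"
        by (rule bounded_linear.has_derivative[OF bounded_linear_divide])
      then show ?thesis by (simp add: \<rho>_def[abs_def] g_def algebra_simps)
    qed
    show "g (- x) = - g x" for x by (simp add: g_def m_def)
    show "norm x > e \<Longrightarrow> g x = 0" for x by (simp add: g_def m0)
    show "norm (g x - g y) \<le> 4 / I * (3 * e\<^sup>2) * norm (x - y)" for x y
    proof -
      have "g x - g y = (- 4 / I) *\<^sub>R (m x *\<^sub>R x - m y *\<^sub>R y)"
        by (simp add: g_def algebra_simps)
      then have "norm (g x - g y) = 4 / I * norm (m x *\<^sub>R x - m y *\<^sub>R y)" using I by simp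
      also have "\<dots> \<le> 4 / I * (3 * e\<^sup>2 * norm (x - y))"
        using I lip' by (intro mult_left_mono) auto
      finally show ?thesis by simp
    qed
  qed
  then show ?thesis by blast
qed

context mollifier
begin

lemma continuous_mollifier: "continuous_on S \<rho>"
  by (meson continuous_at_imp_continuous_on deriv has_derivative_continuous)

lemma lipschitz_nonneg: "L \<ge> 0"
proof -
  obtain b :: 'a where "b \<in> Basis" using nonempty_Basis by blast
  then show ?thesis
    using order_trans[OF norm_ge_zero grad_lipschitz[of b 0]] by simp
qed

lemma continuous_grad: "continuous_on S g"
proof -
  have "L-lipschitz_on UNIV g"
    using grad_lipschitz lipschitz_nonneg by (intro lipschitz_onI) (auto simp: dist_norm)
  then show ?thesis by (meson continuous_on_subset lipschitz_on_continuous_on top_greatest)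
qed

lemma measurable_mollifier [measurable]: "\<rho> \<in> borel_measurable borel" "g \<in> borel_measurable borel"
  by (auto intro!: borel_measurable_continuous_onI continuous_mollifier continuous_grad)

text \<open>Subtracting the linear part in \<open>F\<close> leaves a derivative that is an increment
  of \<open>g\<close> along the segment, so the mean value theorem gives the bound. The constant
  \<open>L\<close>, in place of the sharp \<open>L / 2\<close>, suffices.\<close>

lemma taylor: "\<bar>\<rho> (x + h) - \<rho> x - g x \<bullet> h\<bar> \<le> L * (norm h)\<^sup>2"
proof -
  define F where "F s = \<rho> (x + s *\<^sub>R h) - s * (g x \<bullet> h)" for s :: real
  have D: "(F has_derivative (\<lambda>d. d * (g (x + s *\<^sub>R h) \<bullet> h - g x \<bullet> h))) (at s)" for s
  proof -
    have 1: "((\<lambda>s. x + s *\<^sub>R h) has_derivative (\<lambda>d. d *\<^sub>R h)) (at s)"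
      by (auto intro!: derivative_eq_intros)
    have "((\<lambda>s. \<rho> (x + s *\<^sub>R h)) has_derivative (\<lambda>d. g (x + s *\<^sub>R h) \<bullet> (d *\<^sub>R h))) (at s)"
      by (rule has_derivative_compose[OF 1 deriv])
    then show ?thesis unfolding F_def
      by (auto intro!: derivative_eq_intros simp: algebra_simps)
  qed
  have "\<exists>s\<in>{0<..<1}. F 1 - F 0 = (1 - 0) * (g (x + s *\<^sub>R h) \<bullet> h - g x \<bullet> h)"
    by (rule mvt_simple[where f' = "\<lambda>s d. d * (g (x + s *\<^sub>R h) \<bullet> h - g x \<bullet> h)"])
       (auto intro: has_derivative_at_withinI[OF D])
  then obtain s where s: "0 < s" "s < 1" "F 1 - F 0 = (g (x + s *\<^sub>R h) - g x) \<bullet> h"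
    by (auto simp: inner_diff_left)
  have "\<bar>F 1 - F 0\<bar> \<le> norm (g (x + s *\<^sub>R h) - g x) * norm h"
    unfolding s(3) by (rule Cauchy_Schwarz_ineq2)
  also have "\<dots> \<le> (L * norm h) * norm h"
  proof (rule mult_right_mono)
    have "norm (g (x + s *\<^sub>R h) - g x) \<le> L * (s * norm h)"
      using grad_lipschitz[of "x + s *\<^sub>R h" x] s by simp
    also have "\<dots> \<le> L * norm h"
      using s lipschitz_nonneg by (intro mult_left_mono mult_left_le_one_le) auto
    finally show "norm (g (x + s *\<^sub>R h) - g x) \<le> L * norm h" .
  qed simp
  finally show ?thesis by (simp add: F_def power2_eq_square algebra_simps)
qed

text \<open>A point of norm \<open>e + 1\<close> lies outside the support of \<open>g\<close> and
  within distance \<open>2 * e + 1\<close> of any point of the support, so the Lipschitz bound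
  applies.\<close>

lemma grad_bound: "norm (g x) \<le> L * (2 * e + 1)"
proof (cases "norm x > e")
  case False
  obtain b :: 'a where b: "b \<in> Basis" using nonempty_Basis by blast
  have "g ((e + 1) *\<^sub>R b) = 0" using e_pos b by (intro grad_supp) simp
  then have "norm (g x) \<le> L * norm (x - (e + 1) *\<^sub>R b)"
    using grad_lipschitz[of x "(e + 1) *\<^sub>R b"] by simp
  also have "norm (x - (e + 1) *\<^sub>R b) \<le> 2 * e + 1"
    using norm_triangle_ineq4[of x "(e + 1) *\<^sub>R b"] False e_pos b by simp
  finally show ?thesis using lipschitz_nonneg by (simp add: mult_left_mono)
qed (use grad_supp lipschitz_nonneg e_pos in auto)

lemma mollifier_bound: "\<exists>B. \<forall>x. \<rho> x \<le> B"
proof -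
  have "compact (\<rho> ` cball 0 e)"
    by (intro compact_continuous_image continuous_mollifier compact_cball)
  then obtain B where B: "\<And>x. x \<in> cball 0 e \<Longrightarrow> \<rho> x \<le> B"
    by (meson bounded_imp_bdd_above bdd_above.unfold compact_imp_bounded imageI)
  have "\<rho> x \<le> max 0 B" for x
    using B[of x] supp[of x] by (cases "norm x > e") auto
  then show ?thesis by blast
qed

end

section \<open>Convolution with the kernel and its derivative\<close>

context mollifier
begin

lemma integrable_conv:
  fixes u :: "'a \<Rightarrow> 'b::euclidean_space"
  assumes u: "integrable lborel u"
  shows "integrable lborel (\<lambda>z. \<rho> (x - z) *\<^sub>R u z)"
proof -
  have [measurable]: "u \<in> borel_measurable borel" using u by auto
  obtain B where B: "\<And>x. \<rho> x \<le> B" using mollifier_bound by blast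
  show ?thesis
  proof (rule Bochner_Integration.integrable_bound[of lborel "\<lambda>z. B *\<^sub>R u z"])
    show "AE z in lborel. norm (\<rho> (x - z) *\<^sub>R u z) \<le> norm (B *\<^sub>R u z)"
      using B nonneg by (intro AE_I2) (auto intro!: mult_right_mono intro: order_trans[OF B abs_ge_self])
  qed (use u in auto)
qed

lemma integrable_grad_conv:
  fixes u :: "'a \<Rightarrow> 'b::euclidean_space"
  assumes u: "integrable lborel u"
  shows "integrable lborel (\<lambda>z. (g (x - z) \<bullet> h) *\<^sub>R u z)"
proof -
  have [measurable]: "u \<in> borel_measurable borel" using u by auto
  define B where "B = L * (2 * e + 1) * norm h"
  have B: "\<bar>g y \<bullet> h\<bar> \<le> B" for y
    using Cauchy_Schwarz_ineq2[of "g y" h] grad_bound[of y] unfolding B_def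
    by (meson mult_right_mono norm_ge_zero order_trans)
  show ?thesis
  proof (rule Bochner_Integration.integrable_bound[of lborel "\<lambda>z. B *\<^sub>R u z"])
    show "AE z in lborel. norm ((g (x - z) \<bullet> h) *\<^sub>R u z) \<le> norm (B *\<^sub>R u z)"
      by (intro AE_I2) (auto intro!: mult_right_mono intro: order_trans[OF B abs_ge_self])
  qed (use u in auto)
qed

text \<open>Values lie in an arbitrary Euclidean space because the same operator mollifies the
  indicator of the set and the vector field used to test its perimeter.\<close>

definition conv :: "('a \<Rightarrow> 'b::euclidean_space) \<Rightarrow> 'a \<Rightarrow> 'b" where
  "conv u x = (\<integral>z. \<rho> (x - z) *\<^sub>R u z \<partial>lborel)"

definition dconv :: "('a \<Rightarrow> 'b::euclidean_space) \<Rightarrow> 'a \<Rightarrow> 'a \<Rightarrow> 'b" where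
  "dconv u x h = (\<integral>z. (g (x - z) \<bullet> h) *\<^sub>R u z \<partial>lborel)"

text \<open>The Lipschitz bound of the kernel gradient passes through the integral at the price of
  the L1 norm of \<open>u\<close>. It makes both the mollified gradient and the derivative of the
  mollified test field continuous.\<close>

lemma dconv_lipschitz:
  fixes u :: "'a \<Rightarrow> 'b::euclidean_space"
  assumes u: "integrable lborel u"
  shows "norm (dconv u x h - dconv u y h) \<le> L * norm (x - y) * norm h * (\<integral>z. norm (u z) \<partial>lborel)"
proof -
  have "dconv u x h - dconv u y h = (\<integral>z. ((g (x - z) - g (y - z)) \<bullet> h) *\<^sub>R u z \<partial>lborel)"
    unfolding dconv_def
    by (subst Bochner_Integration.integral_diff[symmetric, OF integrable_grad_conv[OF u] integrable_grad_conv[OF u]])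
       (simp add: inner_diff_left algebra_simps)
  also have "norm \<dots> \<le> (\<integral>z. (L * norm (x - y) * norm h) * norm (u z) \<partial>lborel)"
  proof (rule Bochner_Integration.integral_norm_bound_integral)
    show "integrable lborel (\<lambda>z. ((g (x - z) - g (y - z)) \<bullet> h) *\<^sub>R u z)"
      using Bochner_Integration.integrable_diff[OF integrable_grad_conv[OF u, of x h] integrable_grad_conv[OF u, of y h]]
      by (simp add: inner_diff_left scaleR_diff_left)
    show "integrable lborel (\<lambda>z. L * norm (x - y) * norm h * norm (u z))" using u by auto
    fix z
    have "\<bar>(g (x - z) - g (y - z)) \<bullet> h\<bar> \<le> norm (g (x - z) - g (y - z)) * norm h"
      by (rule Cauchy_Schwarz_ineq2)
    also have "\<dots> \<le> L * norm (x - y) * norm h"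
      using grad_lipschitz[of "x - z" "y - z"] by (intro mult_right_mono) auto
    finally show "norm (((g (x - z) - g (y - z)) \<bullet> h) *\<^sub>R u z) \<le> L * norm (x - y) * norm h * norm (u z)"
      by (simp add: mult_right_mono)
  qed
  finally show ?thesis by simp
qed

lemma bounded_linear_dconv:
  fixes u :: "'a \<Rightarrow> 'b::euclidean_space"
  assumes u: "integrable lborel u"
  shows "bounded_linear (dconv u x)"
proof (rule bounded_linear_intro)
  show "dconv u x (h + k) = dconv u x h + dconv u x k" for h k
    unfolding dconv_def
    by (subst Bochner_Integration.integral_add[symmetric, OF integrable_grad_conv[OF u] integrable_grad_conv[OF u]])
       (simp add: inner_add_right algebra_simps)
  show "dconv u x (r *\<^sub>R h) = r *\<^sub>R dconv u x h" for r h
    unfolding dconv_def by (simp flip: scaleR_scaleR)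
  show "norm (dconv u x h) \<le> norm h * (L * (2 * e + 1) * (\<integral>z. norm (u z) \<partial>lborel))" for h
  proof -
    have "norm (dconv u x h) \<le> (\<integral>z. (norm h * (L * (2 * e + 1))) * norm (u z) \<partial>lborel)"
      unfolding dconv_def
    proof (rule Bochner_Integration.integral_norm_bound_integral[OF integrable_grad_conv[OF u]])
      fix z
      have "\<bar>g (x - z) \<bullet> h\<bar> \<le> norm (g (x - z)) * norm h" by (rule Cauchy_Schwarz_ineq2)
      also have "\<dots> \<le> L * (2 * e + 1) * norm h"
        using grad_bound by (intro mult_right_mono) auto
      finally have "\<bar>g (x - z) \<bullet> h\<bar> * norm (u z) \<le> (L * (2 * e + 1) * norm h) * norm (u z)"
        by (intro mult_right_mono) auto
      then show "norm ((g (x - z) \<bullet> h) *\<^sub>R u z) \<le> norm h * (L * (2 * e + 1)) * norm (u z)"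
        by (simp add: mult_ac)
    qed (use u in auto)
    then show ?thesis by (simp add: mult.assoc)
  qed
qed

text \<open>The quadratic Taylor remainder of the kernel is integrated against
  \<open>u\<close>.\<close>

lemma conv_has_derivative:
  fixes u :: "'a \<Rightarrow> 'b::euclidean_space"
  assumes u: "integrable lborel u"
  shows "(conv u has_derivative dconv u x) (at x)"
proof (rule has_derivative_of_quadratic_remainder[OF bounded_linear_dconv[OF u]])
  fix h :: 'a
  have int: "integrable lborel (\<lambda>z. (\<rho> (x + h - z) *\<^sub>R u z - \<rho> (x - z) *\<^sub>R u z) - (g (x - z) \<bullet> h) *\<^sub>R u z)"
    by (intro Bochner_Integration.integrable_diff integrable_conv integrable_grad_conv u)
  have "conv u (x + h) - conv u x - dconv u x h = (\<integral>z. (\<rho> (x + h - z) *\<^sub>R u z - \<rho> (x - z) *\<^sub>R u z) - (g (x - z) \<bullet> h) *\<^sub>R u z \<partial>lborel)"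
    unfolding conv_def dconv_def
    by (simp add: Bochner_Integration.integral_diff integrable_conv integrable_grad_conv u)
  also have "norm \<dots> \<le> (\<integral>z. (L * (norm h)\<^sup>2) * norm (u z) \<partial>lborel)"
  proof (rule Bochner_Integration.integral_norm_bound_integral[OF int])
    fix z
    have "(\<rho> (x + h - z) *\<^sub>R u z - \<rho> (x - z) *\<^sub>R u z) - (g (x - z) \<bullet> h) *\<^sub>R u z
       = (\<rho> ((x - z) + h) - \<rho> (x - z) - g (x - z) \<bullet> h) *\<^sub>R u z"
      by (simp add: algebra_simps)
    then show "norm ((\<rho> (x + h - z) *\<^sub>R u z - \<rho> (x - z) *\<^sub>R u z) - (g (x - z) \<bullet> h) *\<^sub>R u z) \<le> L * (norm h)\<^sup>2 * norm (u z)"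
      using taylor[of "x - z" h] by (simp add: mult_right_mono)
  qed (use u in auto)
  finally show "norm (conv u (x + h) - conv u x - dconv u x h) \<le> (L * (\<integral>z. norm (u z) \<partial>lborel)) * (norm h)\<^sup>2"
    by (simp add: mult_ac)
qed

lemma total_shift:
  "(\<integral>\<^sup>+x. ennreal (\<rho> (x - z)) \<partial>lborel) = 1" "(\<integral>\<^sup>+z. ennreal (\<rho> (x - z)) \<partial>lborel) = 1"
proof -
  show 1: "(\<integral>\<^sup>+x. ennreal (\<rho> (x - z)) \<partial>lborel) = 1" for z
    using nn_integral_lborel_shift[of "\<lambda>x. ennreal (\<rho> x)" "- z"] total by simp
  have "\<rho> (x - z) = \<rho> (z - x)" for z using even[of "z - x"] by simp
  then show "(\<integral>\<^sup>+z. ennreal (\<rho> (x - z)) \<partial>lborel) = 1" using 1[of x] by simp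
qed

lemma integrable_mollifier_reflect: "integrable lborel (\<lambda>z. \<rho> (x - z))"
  and integral_mollifier_reflect: "(\<integral>z. \<rho> (x - z) \<partial>lborel) = 1"
proof -
  show "integrable lborel (\<lambda>z. \<rho> (x - z))"
    using total_shift(2)[of x] nonneg by (intro integrableI_nonneg) auto
  show "(\<integral>z. \<rho> (x - z) \<partial>lborel) = 1"
    using total_shift(2)[of x] nonneg by (subst integral_eq_nn_integral) auto
qed

end

text \<open>This is the \<open>D(y)\<close> of the overview, written as the L1 distance between the
  indicator and its translate so that convolution estimates apply directly.\<close>

definition shift_diff :: "'a::euclidean_space set \<Rightarrow> 'a \<Rightarrow> ennreal" where
  "shift_diff S y = (\<integral>\<^sup>+x. ennreal \<bar>indicator S (x + y) - indicator S x\<bar> \<partial>lborel)"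

locale mollified_set = mollifier \<rho> g e L
  for \<rho> :: "'a::euclidean_space \<Rightarrow> real" and g :: "'a \<Rightarrow> 'a" and e L :: real +
  fixes S :: "'a set"
  assumes measurable_set [measurable]: "S \<in> sets borel"
    and finite_set: "emeasure lborel S < \<infinity>"
begin

abbreviation u :: "'a \<Rightarrow> real" where "u \<equiv> indicator S"

lemma integrable_indicator_set: "integrable lborel u"
  using finite_set by (intro integrable_real_indicator) auto

definition f :: "'a \<Rightarrow> real" where "f = conv u"

definition G :: "'a \<Rightarrow> 'a" where "G x = (\<integral>z. u z *\<^sub>R g (x - z) \<partial>lborel)"

lemma integrable_G: "integrable lborel (\<lambda>z. u z *\<^sub>R g (x - z))"
proof (rule Bochner_Integration.integrable_bound[of lborel "\<lambda>z. (L * (2 * e + 1)) * u z"])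
  show "AE z in lborel. norm (u z *\<^sub>R g (x - z)) \<le> norm (L * (2 * e + 1) * u z)"
    using grad_bound by (intro AE_I2) (auto split: split_indicator intro: order_trans[OF grad_bound abs_ge_self])
qed (use integrable_indicator_set in auto)

lemma inner_G: "G x \<bullet> h = dconv u x h"
proof -
  have "G x \<bullet> h = (\<integral>z. (u z *\<^sub>R g (x - z)) \<bullet> h \<partial>lborel)"
    unfolding G_def by (rule integral_inner_left[OF integrable_G, symmetric])
  then show ?thesis by (simp add: dconv_def mult.commute)
qed

lemma f_has_derivative: "(f has_derivative (\<lambda>h. G x \<bullet> h)) (at x)"
  unfolding f_def inner_G by (rule conv_has_derivative[OF integrable_indicator_set])

lemma continuous_f: "continuous_on A f"
  by (meson continuous_at_imp_continuous_on f_has_derivative has_derivative_continuous)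

text \<open>The directional bound is tested in the direction \<open>G x - G y\<close> itself, and
  one factor of its norm is cancelled.\<close>

lemma G_lipschitz: "norm (G x - G y) \<le> L * measure lborel S * norm (x - y)"
proof (cases "G x = G y")
  case False
  define h where "h = G x - G y"
  have "norm h * norm h = dconv u x h - dconv u y h"
    by (simp add: inner_G[symmetric] h_def inner_diff_left[symmetric] dot_square_norm power2_eq_square)
  also have "\<dots> \<le> \<bar>dconv u x h - dconv u y h\<bar>" by simp
  also have "\<dots> \<le> L * norm (x - y) * norm h * (\<integral>z. norm (u z) \<partial>lborel)"
    using dconv_lipschitz[OF integrable_indicator_set, of x h y] by simp
  finally have "norm h * norm h \<le> (L * measure lborel S * norm (x - y)) * norm h" by (simp add: mult_ac)
  then show ?thesis using False by (simp add: h_def)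
qed (use lipschitz_nonneg in auto)

lemma continuous_G: "continuous_on A G"
proof -
  have "(L * measure lborel S)-lipschitz_on UNIV G"
    using G_lipschitz lipschitz_nonneg by (intro lipschitz_onI) (auto simp: dist_norm)
  then show ?thesis by (meson continuous_on_subset lipschitz_on_continuous_on top_greatest)
qed

lemma measurable_f_G [measurable]: "f \<in> borel_measurable borel" "G \<in> borel_measurable borel"
  by (auto intro!: borel_measurable_continuous_onI continuous_f continuous_G)

text \<open>Translation invariance moves the shift from the kernel to the indicator: an increment of
  \<open>f\<close> is a mollified increment of \<open>u\<close>.\<close>

lemma f_shift_diff:
  "f (x + y) - f x = (\<integral>z. \<rho> (x - z) * (u (z + y) - u z) \<partial>lborel)"
  and integrable_f_shift_diff: "integrable lborel (\<lambda>z. \<rho> (x - z) * (u (z + y) - u z))"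
proof -
  have sh: "integrable lborel (\<lambda>z. u (z + y))"
  proof (rule integrableI_nonneg)
    show "(\<integral>\<^sup>+x. ennreal (u (x + y)) \<partial>lborel) < \<infinity>"
      using nn_integral_lborel_shift[of "\<lambda>x. ennreal (u x)" y] finite_set by (simp add: ennreal_indicator)
  qed auto
  have i: "integrable lborel (\<lambda>z. \<rho> (x - z) * u (z + y))" "integrable lborel (\<lambda>z. \<rho> (x - z) * u z)"
    using integrable_conv[OF sh, of x] integrable_conv[OF integrable_indicator_set, of x] by simp_all
  show "integrable lborel (\<lambda>z. \<rho> (x - z) * (u (z + y) - u z))"
    using Bochner_Integration.integrable_diff[OF i] by (simp add: right_diff_distrib)
  have "f (x + y) = (\<integral>z. \<rho> (x - z) * u (z + y) \<partial>lborel)"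
    using lborel_integral_shift[of "\<lambda>z. \<rho> (x + y - z) * u z" y]
    by (simp add: f_def conv_def)
  then show "f (x + y) - f x = (\<integral>z. \<rho> (x - z) * (u (z + y) - u z) \<partial>lborel)"
    using i by (simp add: f_def conv_def right_diff_distrib)
qed

text \<open>Averaging against a kernel of total mass 1 does not increase the L1 norm of an
  increment.\<close>

lemma variation_f_le: "(\<integral>\<^sup>+x. ennreal \<bar>f (x + y) - f x\<bar> \<partial>lborel) \<le> shift_diff S y"
proof -
  have "(\<integral>\<^sup>+x. ennreal \<bar>f (x + y) - f x\<bar> \<partial>lborel) \<le> (\<integral>\<^sup>+x. (\<integral>\<^sup>+z. ennreal \<bar>u (z + y) - u z\<bar> * ennreal (\<rho> (x - z)) \<partial>lborel) \<partial>lborel)"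
  proof (rule nn_integral_mono)
    fix x
    have "ennreal \<bar>f (x + y) - f x\<bar> \<le> (\<integral>\<^sup>+z. ennreal (norm (\<rho> (x - z) * (u (z + y) - u z))) \<partial>lborel)"
      unfolding f_shift_diff
      using integral_norm_bound_ennreal[OF integrable_f_shift_diff[of x y]] by simp
    also have "\<dots> = (\<integral>\<^sup>+z. ennreal \<bar>u (z + y) - u z\<bar> * ennreal (\<rho> (x - z)) \<partial>lborel)"
      using nonneg by (intro nn_integral_cong) (simp add: abs_mult ennreal_mult'[symmetric] mult.commute)
    finally show "ennreal \<bar>f (x + y) - f x\<bar> \<le> \<dots>" .
  qed
  also have "\<dots> = (\<integral>\<^sup>+z. (\<integral>\<^sup>+x. ennreal \<bar>u (z + y) - u z\<bar> * ennreal (\<rho> (x - z)) \<partial>lborel) \<partial>lborel)"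
    by (rule lborel_pair.Fubini') measurable
  also have "\<dots> = (\<integral>\<^sup>+z. ennreal \<bar>u (z + y) - u z\<bar> \<partial>lborel)"
    by (intro nn_integral_cong) (simp add: nn_integral_cmult total_shift)
  finally show ?thesis by (simp add: shift_diff_def)
qed

text \<open>The increment is the integral of \<open>G\<close> along the segment from
  \<open>x\<close> to \<open>x + y\<close>. After exchanging the integrals, translation invariance
  makes the inner one independent of the position on the segment.\<close>

lemma variation_f_le_grad: "(\<integral>\<^sup>+x. ennreal \<bar>f (x + y) - f x\<bar> \<partial>lborel) \<le> (\<integral>\<^sup>+x. ennreal \<bar>G x \<bullet> y\<bar> \<partial>lborel)"
proof -
  have "(\<integral>\<^sup>+x. ennreal \<bar>f (x + y) - f x\<bar> \<partial>lborel) \<le> (\<integral>\<^sup>+x. (\<integral>\<^sup>+s. ennreal \<bar>G (x + s *\<^sub>R y) \<bullet> y\<bar> * indicator {0..1} s \<partial>lborel) \<partial>lborel)"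
  proof (rule nn_integral_mono)
    fix x
    have D: "((\<lambda>s. f (x + s *\<^sub>R y)) has_real_derivative (G (x + s *\<^sub>R y) \<bullet> y)) (at s)" for s
    proof -
      have 1: "((\<lambda>s. x + s *\<^sub>R y) has_derivative (\<lambda>d. d *\<^sub>R y)) (at s)"
        by (auto intro!: derivative_eq_intros)
      have "((\<lambda>s. f (x + s *\<^sub>R y)) has_derivative (\<lambda>d. G (x + s *\<^sub>R y) \<bullet> (d *\<^sub>R y))) (at s)"
        by (rule has_derivative_compose[OF 1 f_has_derivative])
      then show ?thesis unfolding has_field_derivative_def
        by (rule has_derivative_eq_rhs) (simp add: fun_eq_iff)
    qed
    have C: "isCont (\<lambda>s. G (x + s *\<^sub>R y) \<bullet> y) s" for s
    proof -
      have "continuous_on UNIV (\<lambda>s. G (x + s *\<^sub>R y) \<bullet> y)"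
        by (intro continuous_intros continuous_on_compose2[OF continuous_G[of UNIV]]) auto
      then show ?thesis by (simp add: continuous_on_eq_continuous_at)
    qed
    have hb: "has_bochner_integral lborel (\<lambda>s. (G (x + s *\<^sub>R y) \<bullet> y) * indicator {0..1} s) (f (x + 1 *\<^sub>R y) - f (x + 0 *\<^sub>R y))"
      by (rule has_bochner_integral_FTC_Icc_real) (use D C in auto)
    then have "f (x + y) - f x = (\<integral>s. (G (x + s *\<^sub>R y) \<bullet> y) * indicator {0..1} s \<partial>lborel)"
      by (simp add: has_bochner_integral_iff)
    then have "ennreal \<bar>f (x + y) - f x\<bar> \<le> (\<integral>\<^sup>+s. ennreal (norm ((G (x + s *\<^sub>R y) \<bullet> y) * indicator {0..1} s)) \<partial>lborel)"
      using integral_norm_bound_ennreal[of lborel "\<lambda>s. (G (x + s *\<^sub>R y) \<bullet> y) * indicator {0..1} s"] hb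
      by (simp only: has_bochner_integral_iff real_norm_def)
    also have "\<dots> = (\<integral>\<^sup>+s. ennreal \<bar>G (x + s *\<^sub>R y) \<bullet> y\<bar> * indicator {0..1} s \<partial>lborel)"
      by (intro nn_integral_cong) (auto split: split_indicator)
    finally show "ennreal \<bar>f (x + y) - f x\<bar> \<le> \<dots>" .
  qed
  also have "\<dots> = (\<integral>\<^sup>+s. (\<integral>\<^sup>+x. ennreal \<bar>G (x + s *\<^sub>R y) \<bullet> y\<bar> * indicator {0..1} s \<partial>lborel) \<partial>lborel)"
    by (rule lborel_pair.Fubini') measurable
  also have "\<dots> = (\<integral>\<^sup>+s. (\<integral>\<^sup>+x. ennreal \<bar>G x \<bullet> y\<bar> \<partial>lborel) * indicator {0..1::real} s \<partial>lborel)"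
    by (intro nn_integral_cong) (simp add: nn_integral_multc nn_integral_lborel_shift[of "\<lambda>x. ennreal \<bar>G x \<bullet> y\<bar>"])
  also have "\<dots> = (\<integral>\<^sup>+x. ennreal \<bar>G x \<bullet> y\<bar> \<partial>lborel)"
    by (simp add: nn_integral_cmult_indicator)
  finally show ?thesis .
qed

text \<open>Linearizing \<open>f\<close> costs the Taylor remainder of the kernel, integrated over
  the set. The constant depends on the mollifier, but the error is quadratic in \<open>y\<close> and
  so is absorbed by the truncated second moment.\<close>

lemma grad_le_shift_diff:
  "\<exists>K\<ge>0. \<forall>y. norm y \<le> 1 \<longrightarrow> (\<integral>\<^sup>+x. ennreal \<bar>G x \<bullet> y\<bar> \<partial>lborel) \<le> shift_diff S y + ennreal (K * (norm y)\<^sup>2)"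
proof (intro exI conjI allI impI)
  \<comment> \<open>For \<open>norm y \<le> 1\<close> the remainder of the kernel vanishes outside
    the ball of radius \<open>e + 1\<close>; the volume of that ball bounds its integral in
    \<open>x\<close>.\<close>
  let ?V = "measure lborel (cball (0::'a) (e + 1))"
  show "L * ?V * measure lborel S \<ge> 0" using lipschitz_nonneg by simp
  fix y :: 'a
  assume y: "norm y \<le> 1"
  let ?c = "L * (norm y)\<^sup>2"
  have cb: "emeasure lborel (cball (0::'a) (e + 1)) = ennreal ?V"
    using emeasure_bounded_finite[OF bounded_cball, of "0::'a" "e + 1"] by (intro emeasure_eq_ennreal_measure) auto
  have [measurable]: "cball (0::'a) (e + 1) \<in> sets borel" by simp
  have em: "emeasure lborel S = ennreal (measure lborel S)"
    using finite_set by (intro emeasure_eq_ennreal_measure) auto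
  have rem: "ennreal \<bar>G x \<bullet> y\<bar> \<le> ennreal \<bar>f (x + y) - f x\<bar> +
      (\<integral>\<^sup>+z. (ennreal ?c * indicator S z) * indicator (cball 0 (e + 1)) (x - z) \<partial>lborel)" for x
  proof -
    let ?t = "\<lambda>z. (\<rho> (x + y - z) * u z - \<rho> (x - z) * u z) - (g (x - z) \<bullet> y) * u z"
    have i: "integrable lborel (\<lambda>z. \<rho> (x + y - z) * u z)" "integrable lborel (\<lambda>z. \<rho> (x - z) * u z)"
        "integrable lborel (\<lambda>z. (g (x - z) \<bullet> y) * u z)"
      using integrable_conv[OF integrable_indicator_set] integrable_grad_conv[OF integrable_indicator_set, of x y] by auto
    have int: "integrable lborel ?t"
      by (intro Bochner_Integration.integrable_diff i)
    have "f (x + y) - f x - G x \<bullet> y = (\<integral>z. ?t z \<partial>lborel)"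
      unfolding f_def conv_def inner_G dconv_def using i by simp
    then have "ennreal \<bar>f (x + y) - f x - G x \<bullet> y\<bar> \<le> (\<integral>\<^sup>+z. ennreal (norm (?t z)) \<partial>lborel)"
      using integral_norm_bound_ennreal[OF int] by simp
    also have "\<dots> \<le> (\<integral>\<^sup>+z. (ennreal ?c * indicator S z) * indicator (cball 0 (e + 1)) (x - z) \<partial>lborel)"
    proof (rule nn_integral_mono)
      fix z
      have t: "?t z = (\<rho> ((x - z) + y) - \<rho> (x - z) - g (x - z) \<bullet> y) * u z"
        by (simp add: algebra_simps)
      show "ennreal (norm (?t z)) \<le> (ennreal ?c * indicator S z) * indicator (cball 0 (e + 1)) (x - z)"
      proof (cases "norm (x - z) \<le> e + 1")
        case True
        then show ?thesis unfolding t using taylor[of "x - z" y]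
          by (auto split: split_indicator intro!: ennreal_leI)
      next
        case False
        have "norm ((x - z) + y) > e"
          using norm_triangle_ineq4[of "(x - z) + y" y] False y by simp
        then show ?thesis unfolding t using False supp grad_supp by simp
      qed
    qed
    finally have 1: "ennreal \<bar>f (x + y) - f x - G x \<bullet> y\<bar> \<le> \<dots>" .
    have "ennreal \<bar>G x \<bullet> y\<bar> \<le> ennreal (\<bar>f (x + y) - f x\<bar> + \<bar>f (x + y) - f x - G x \<bullet> y\<bar>)"
      by (intro ennreal_leI) linarith
    also have "\<dots> = ennreal \<bar>f (x + y) - f x\<bar> + ennreal \<bar>f (x + y) - f x - G x \<bullet> y\<bar>" by simp
    also have "\<dots> \<le> ennreal \<bar>f (x + y) - f x\<bar> +
      (\<integral>\<^sup>+z. (ennreal ?c * indicator S z) * indicator (cball 0 (e + 1)) (x - z) \<partial>lborel)"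
      by (intro add_left_mono 1)
    finally show ?thesis .
  qed
  have "(\<integral>\<^sup>+x. ennreal \<bar>G x \<bullet> y\<bar> \<partial>lborel) \<le> (\<integral>\<^sup>+x. ennreal \<bar>f (x + y) - f x\<bar> +
      (\<integral>\<^sup>+z. (ennreal ?c * indicator S z) * indicator (cball 0 (e + 1)) (x - z) \<partial>lborel) \<partial>lborel)"
    by (intro nn_integral_mono rem)
  also have "\<dots> = (\<integral>\<^sup>+x. ennreal \<bar>f (x + y) - f x\<bar> \<partial>lborel) +
      (\<integral>\<^sup>+x. (\<integral>\<^sup>+z. (ennreal ?c * indicator S z) * indicator (cball 0 (e + 1)) (x - z) \<partial>lborel) \<partial>lborel)"
    by (rule nn_integral_add) measurable
  also have "(\<integral>\<^sup>+x. (\<integral>\<^sup>+z. (ennreal ?c * indicator S z) * indicator (cball 0 (e + 1)) (x - z) \<partial>lborel) \<partial>lborel)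
     = (\<integral>\<^sup>+z. (\<integral>\<^sup>+x. (ennreal ?c * indicator S z) * indicator (cball 0 (e + 1)) (x - z) \<partial>lborel) \<partial>lborel)"
    by (rule lborel_pair.Fubini') measurable
  also have "\<dots> = (\<integral>\<^sup>+z. (ennreal ?c * indicator S z) * ennreal ?V \<partial>lborel)"
  proof (rule nn_integral_cong)
    fix z :: 'a
    have "(\<integral>\<^sup>+x. indicator (cball 0 (e + 1)) (x - z) \<partial>lborel) = ennreal ?V"
      using nn_integral_lborel_shift[of "indicator (cball (0::'a) (e + 1)) :: 'a \<Rightarrow> ennreal" "- z"] cb by simp
    then show "(\<integral>\<^sup>+x. (ennreal ?c * indicator S z) * indicator (cball 0 (e + 1)) (x - z) \<partial>lborel) = (ennreal ?c * indicator S z) * ennreal ?V"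
      by (subst nn_integral_cmult) auto
  qed
  also have "\<dots> = ennreal (L * ?V * measure lborel S * (norm y)\<^sup>2)"
    using lipschitz_nonneg
    by (simp add: nn_integral_multc nn_integral_cmult em ennreal_mult'[symmetric] ennreal_mult''[symmetric] mult_ac)
  finally show "(\<integral>\<^sup>+x. ennreal \<bar>G x \<bullet> y\<bar> \<partial>lborel) \<le> shift_diff S y + ennreal (L * ?V * measure lborel S * (norm y)\<^sup>2)"
    using variation_f_le[of y] by (meson add_right_mono order_trans)
qed

text \<open>Replacing the indicator by \<open>f\<close> at both \<open>x\<close> and
  \<open>x + y\<close> costs the same L1 distance twice. The estimate holds for all
  \<open>y\<close>, and its error term does not depend on \<open>y\<close>.\<close>

lemma shift_diff_le_grad:
  "shift_diff S y \<le> (\<integral>\<^sup>+x. ennreal \<bar>G x \<bullet> y\<bar> \<partial>lborel) + 2 * (\<integral>\<^sup>+x. ennreal \<bar>f x - u x\<bar> \<partial>lborel)"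
proof -
  have "shift_diff S y \<le> (\<integral>\<^sup>+x. ennreal \<bar>f (x + y) - f x\<bar> + (ennreal \<bar>f (x + y) - u (x + y)\<bar> + ennreal \<bar>f x - u x\<bar>) \<partial>lborel)"
    unfolding shift_diff_def
  proof (rule nn_integral_mono)
    fix x
    have "\<bar>u (x + y) - u x\<bar> \<le> \<bar>f (x + y) - f x\<bar> + (\<bar>f (x + y) - u (x + y)\<bar> + \<bar>f x - u x\<bar>)" by linarith
    then have "ennreal \<bar>u (x + y) - u x\<bar> \<le> ennreal (\<bar>f (x + y) - f x\<bar> + (\<bar>f (x + y) - u (x + y)\<bar> + \<bar>f x - u x\<bar>))"
      by (rule ennreal_leI)
    then show "ennreal \<bar>u (x + y) - u x\<bar> \<le> ennreal \<bar>f (x + y) - f x\<bar> + (ennreal \<bar>f (x + y) - u (x + y)\<bar> + ennreal \<bar>f x - u x\<bar>)"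
      by (simp only: ennreal_plus abs_ge_zero add_nonneg_nonneg)
  qed
  also have "\<dots> = (\<integral>\<^sup>+x. ennreal \<bar>f (x + y) - f x\<bar> \<partial>lborel) + ((\<integral>\<^sup>+x. ennreal \<bar>f (x + y) - u (x + y)\<bar> \<partial>lborel) + (\<integral>\<^sup>+x. ennreal \<bar>f x - u x\<bar> \<partial>lborel))"
    by (rule trans[OF nn_integral_add arg_cong2[where f="(+)", OF refl nn_integral_add]]) measurable
  also have "\<dots> = (\<integral>\<^sup>+x. ennreal \<bar>f (x + y) - f x\<bar> \<partial>lborel) + 2 * (\<integral>\<^sup>+x. ennreal \<bar>f x - u x\<bar> \<partial>lborel)"
  proof -
    have "(\<integral>\<^sup>+x. ennreal \<bar>f (x + y) - u (x + y)\<bar> \<partial>lborel) = (\<integral>\<^sup>+x. ennreal \<bar>f x - u x\<bar> \<partial>lborel)"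
      by (rule nn_integral_lborel_shift[of "\<lambda>x. ennreal \<bar>f x - u x\<bar>"]) measurable
    then show ?thesis by (simp only: mult_2)
  qed
  also have "\<dots> \<le> (\<integral>\<^sup>+x. ennreal \<bar>G x \<bullet> y\<bar> \<partial>lborel) + 2 * (\<integral>\<^sup>+x. ennreal \<bar>f x - u x\<bar> \<partial>lborel)"
    by (intro add_right_mono variation_f_le_grad)
  finally show ?thesis .
qed

text \<open>\<open>f - u\<close> is an average of increments of the indicator over shifts of norm at
  most \<open>e\<close>, so its L1 norm is at most the largest of theirs.\<close>

lemma f_approximates:
  assumes "\<And>z. norm z \<le> e \<Longrightarrow> shift_diff S z \<le> \<eta>"
  shows "(\<integral>\<^sup>+x. ennreal \<bar>f x - u x\<bar> \<partial>lborel) \<le> \<eta>"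
proof -
  have "(\<integral>\<^sup>+x. ennreal \<bar>f x - u x\<bar> \<partial>lborel) \<le> (\<integral>\<^sup>+x. (\<integral>\<^sup>+w. ennreal (\<rho> w) * ennreal \<bar>u (x + w) - u x\<bar> \<partial>lborel) \<partial>lborel)"
  proof (rule nn_integral_mono)
    fix x
    have i: "integrable lborel (\<lambda>z. \<rho> (x - z) * u z)" "integrable lborel (\<lambda>z. \<rho> (x - z) * u x)"
      using integrable_conv[OF integrable_indicator_set] integrable_mollifier_reflect[of x] by auto
    have "f x - u x = (\<integral>z. \<rho> (x - z) * u z - \<rho> (x - z) * u x \<partial>lborel)"
      unfolding f_def conv_def using i integral_mollifier_reflect[of x] by simp
    then have "ennreal \<bar>f x - u x\<bar> \<le> (\<integral>\<^sup>+z. ennreal (norm (\<rho> (x - z) * u z - \<rho> (x - z) * u x)) \<partial>lborel)"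
      using integral_norm_bound_ennreal[OF Bochner_Integration.integrable_diff[OF i]] by simp
    also have "\<dots> = (\<integral>\<^sup>+z. ennreal (\<rho> (x - z)) * ennreal \<bar>u z - u x\<bar> \<partial>lborel)"
    proof (rule nn_integral_cong)
      fix z
      have "norm (\<rho> (x - z) * u z - \<rho> (x - z) * u x) = \<rho> (x - z) * \<bar>u z - u x\<bar>"
        using nonneg[of "x - z"] by (simp only: right_diff_distrib[symmetric] real_norm_def abs_mult abs_of_nonneg)
      then show "ennreal (norm (\<rho> (x - z) * u z - \<rho> (x - z) * u x)) = ennreal (\<rho> (x - z)) * ennreal \<bar>u z - u x\<bar>"
        by (simp add: ennreal_mult'')
    qed
    also have "\<dots> = (\<integral>\<^sup>+z. ennreal (\<rho> (x - (z + x))) * ennreal \<bar>u (z + x) - u x\<bar> \<partial>lborel)"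
      by (rule nn_integral_lborel_shift[symmetric]) measurable
    also have "\<dots> = (\<integral>\<^sup>+w. ennreal (\<rho> w) * ennreal \<bar>u (x + w) - u x\<bar> \<partial>lborel)"
      using even by (simp add: add.commute)
    finally show "ennreal \<bar>f x - u x\<bar> \<le> \<dots>" .
  qed
  also have "\<dots> = (\<integral>\<^sup>+w. (\<integral>\<^sup>+x. ennreal (\<rho> w) * ennreal \<bar>u (x + w) - u x\<bar> \<partial>lborel) \<partial>lborel)"
    by (rule lborel_pair.Fubini') measurable
  also have "\<dots> \<le> (\<integral>\<^sup>+w. ennreal (\<rho> w) * \<eta> \<partial>lborel)"
  proof (rule nn_integral_mono)
    fix w
    show "(\<integral>\<^sup>+x. ennreal (\<rho> w) * ennreal \<bar>u (x + w) - u x\<bar> \<partial>lborel) \<le> ennreal (\<rho> w) * \<eta>"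
    proof (cases "norm w \<le> e")
      case True
      then show ?thesis using assms[OF True]
        by (subst nn_integral_cmult) (auto simp: shift_diff_def intro!: mult_left_mono)
    qed (simp add: supp)
  qed
  also have "\<dots> = \<eta>" using total by (simp add: nn_integral_multc)
  finally show ?thesis .
qed

end

section \<open>Perimeter and mollified gradients\<close>

lemma perimeter_fields_unfold:
  assumes "\<phi> \<in> perimeter_fields"
  obtains D :: "'a::euclidean_space \<Rightarrow> 'a \<Rightarrow>\<^sub>L 'a" and K where
    "\<And>x. (\<phi> has_derivative blinfun_apply (D x)) (at x)" "continuous_on UNIV D"
    "\<And>x. norm x > K \<Longrightarrow> \<phi> x = 0" "\<And>x. norm x > K \<Longrightarrow> D x = 0"
    "\<And>x. norm (\<phi> x) \<le> 1" "\<And>x. divergence \<phi> x = (\<Sum>b\<in>Basis. blinfun_apply (D x) b \<bullet> b)"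
proof -
  obtain D :: "'a \<Rightarrow> 'a \<Rightarrow>\<^sub>L 'a" where D: "\<And>x. (\<phi> has_derivative blinfun_apply (D x)) (at x)" "continuous_on UNIV D"
    using assms unfolding perimeter_fields_def C1_def by blast
  have "bounded {x. \<phi> x \<noteq> 0}"
    using assms bounded_subset[OF compact_imp_bounded closure_subset] unfolding perimeter_fields_def by blast
  then obtain K where K: "\<And>x. \<phi> x \<noteq> 0 \<Longrightarrow> norm x \<le> K" unfolding bounded_iff by auto
  have K0: "\<phi> x = 0" if "norm x > K" for x using K[of x] that by fastforce
  have "D x = 0" if x: "norm x > K" for x
  proof -
    have op: "open {x::'a. norm x > K}" by (intro open_Collect_less continuous_intros)
    have "(\<phi> has_derivative (\<lambda>h. 0)) (at x)"
      by (rule has_derivative_transform_within_open[OF has_derivative_const op]) (use x K0 in auto)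
    then have "blinfun_apply (D x) = (\<lambda>h. 0)" using D(1) by (rule has_derivative_unique[rotated])
    then show ?thesis by (intro blinfun_eqI) (simp add: fun_eq_iff)
  qed
  moreover have "divergence \<phi> x = (\<Sum>b\<in>Basis. blinfun_apply (D x) b \<bullet> b)" for x
    unfolding divergence_def using frechet_derivative_at[OF D(1)] by metis
  moreover have "norm (\<phi> x) \<le> 1" for x using assms by (auto simp: perimeter_fields_def)
  ultimately show ?thesis using that D K0 by blast
qed

lemma continuous_bounded_on_cball:
  fixes F :: "'a::euclidean_space \<Rightarrow> real"
  assumes "continuous_on UNIV F"
  shows "\<exists>B. \<forall>x. norm x \<le> K \<longrightarrow> \<bar>F x\<bar> \<le> B"
proof -
  have "bounded (F ` cball 0 K)"
    by (intro compact_imp_bounded compact_continuous_image continuous_on_subset[OF assms]) auto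
  then obtain a where a: "\<forall>y\<in>F ` cball 0 K. norm y \<le> a" unfolding bounded_iff by blast
  have "\<bar>F x\<bar> \<le> a" if "norm x \<le> K" for x
    using bspec[OF a, of "F x"] that by simp
  then show ?thesis by blast
qed

text \<open>Each difference quotient of an integrable function has integral 0 by translation
  invariance; compact support and a bounded derivative let dominated convergence carry this to the
  limit.\<close>

lemma integral_directional_derivative_eq_0:
  fixes F :: "'a::euclidean_space \<Rightarrow> real"
  assumes D: "\<And>x. (F has_derivative F' x) (at x)" and cont: "continuous_on UNIV (\<lambda>x. F' x b)"
    and supp: "\<And>x. norm x > K \<Longrightarrow> F x = 0" and b: "norm b \<le> 1"
  shows "(\<integral>x. F' x b \<partial>lborel) = 0"
proof -
  have contF: "continuous_on UNIV F"
    by (meson continuous_at_imp_continuous_on D has_derivative_continuous)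
  have [measurable]: "F \<in> borel_measurable borel" "(\<lambda>x. F' x b) \<in> borel_measurable borel"
    by (intro borel_measurable_continuous_onI contF cont)+
  have iF: "integrable lborel F" by (rule integrable_continuous_bounded_support[OF contF supp])
  have iFs: "integrable lborel (\<lambda>x. F (x + y))" for y
  proof (rule integrable_continuous_bounded_support[of _ "K + norm y"])
    show "continuous_on UNIV (\<lambda>x. F (x + y))"
      by (intro continuous_on_compose2[OF contF] continuous_intros) auto
    show "F (x + y) = 0" if "norm x > K + norm y" for x
      using norm_triangle_ineq4[of "x + y" y] that by (intro supp) simp
  qed
  have ray: "((\<lambda>s. F (x + s *\<^sub>R b)) has_real_derivative F' (x + s *\<^sub>R b) b) (at s)" for x s
  proof -
    have 1: "((\<lambda>s. x + s *\<^sub>R b) has_derivative (\<lambda>d. d *\<^sub>R b)) (at s)"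
      by (auto intro!: derivative_eq_intros)
    have "((\<lambda>s. F (x + s *\<^sub>R b)) has_derivative (\<lambda>d. F' (x + s *\<^sub>R b) (d *\<^sub>R b))) (at s)"
      by (rule has_derivative_compose[OF 1 D])
    moreover have "F' (x + s *\<^sub>R b) (d *\<^sub>R b) = F' (x + s *\<^sub>R b) b * d" for d
      using linear_cmul[OF has_derivative_linear[OF D]] by simp
    ultimately show ?thesis by (simp add: has_field_derivative_def)
  qed
  \<comment> \<open>The quotients vanish outside radius \<open>K + 1\<close> because the step has
    length at most 1; the mean value point moves at most 1 further, hence the radius
    \<open>K + 2\<close>.\<close>
  obtain B where B: "\<And>x. norm x \<le> K + 2 \<Longrightarrow> \<bar>F' x b\<bar> \<le> B"
    using continuous_bounded_on_cball[OF cont] by metis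
  define q where "q n x = (F (x + inverse (real (Suc n)) *\<^sub>R b) - F x) / inverse (real (Suc n))" for n x
  have "(\<lambda>n. \<integral>x. q n x \<partial>lborel) \<longlonglongrightarrow> (\<integral>x. F' x b \<partial>lborel)"
  proof (rule integral_dominated_convergence[where w="\<lambda>x. B * indicator (cball 0 (K + 1)) x"])
    show "q n \<in> borel_measurable lborel" for n unfolding q_def[abs_def] by measurable
    show "integrable lborel (\<lambda>x. B * indicator (cball (0::'a) (K + 1)) x)"
      using emeasure_bounded_finite[OF bounded_cball, of "0::'a" "K + 1"]
      by (intro integrable_mult_right integrable_real_indicator) auto
    show "AE x in lborel. (\<lambda>n. q n x) \<longlonglongrightarrow> F' x b"
    proof (rule AE_I2)
      fix x
      have "((\<lambda>h. (F (x + (0 + h) *\<^sub>R b) - F (x + 0 *\<^sub>R b)) / h) \<longlongrightarrow> F' (x + 0 *\<^sub>R b) b) (at 0)"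
        using ray[of x 0] unfolding DERIV_def .
      then have "((\<lambda>h. (F (x + h *\<^sub>R b) - F x) / h) \<longlongrightarrow> F' x b) (at 0)" by simp
      then show "(\<lambda>n. q n x) \<longlonglongrightarrow> F' x b" unfolding q_def
        by (rule filterlim_compose) (rule filterlim_atI[OF LIMSEQ_inverse_real_of_nat], simp)
    qed
    show "AE x in lborel. norm (q n x) \<le> B * indicator (cball 0 (K + 1)) x" for n
    proof (rule AE_I2)
      fix x
      define h where "h = inverse (real (Suc n))"
      have h: "0 < h" "h \<le> 1" by (auto simp: h_def field_simps)
      have hb: "norm (s *\<^sub>R b) \<le> 1" if "0 \<le> s" "s \<le> h" for s
        using that h b mult_mono[of s 1 "norm b" 1] by simp
      show "norm (q n x) \<le> B * indicator (cball 0 (K + 1)) x"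
      proof (cases "norm x \<le> K + 1")
        case True
        have "\<exists>z>0. z < h \<and> F (x + h *\<^sub>R b) - F (x + 0 *\<^sub>R b) = (h - 0) * F' (x + z *\<^sub>R b) b"
          by (rule MVT2[OF h(1)]) (rule ray)
        then obtain z where z: "0 < z" "z < h" and eq: "F (x + h *\<^sub>R b) - F x = h * F' (x + z *\<^sub>R b) b"
          by auto
        have qz: "q n x = F' (x + z *\<^sub>R b) b"
          unfolding q_def h_def[symmetric] eq using h(1) by simp
        have "norm (x + z *\<^sub>R b) \<le> K + 2"
          using norm_triangle_ineq[of x "z *\<^sub>R b"] True hb[of z] z by simp
        then show ?thesis using B True qz by simp
      next
        case False
        have "norm (x + h *\<^sub>R b) > K"
          using norm_triangle_ineq4[of "x + h *\<^sub>R b" "h *\<^sub>R b"] hb[of h] h False by simp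
        then show ?thesis unfolding q_def h_def[symmetric] using False supp[of x] supp[of "x + h *\<^sub>R b"] by simp
      qed
    qed
  qed measurable
  moreover have "(\<integral>x. q n x \<partial>lborel) = 0" for n
    unfolding q_def using iF iFs lborel_integral_shift[of F] by simp
  ultimately show ?thesis by (simp add: LIMSEQ_const_iff)
qed

text \<open>The previous lemma is applied to each product
  \<open>f x * (\<phi> x \<bullet> b)\<close>, whose support is bounded because that of \<phi> is,
  and the results are summed over the basis.\<close>

lemma integral_mult_divergence:
  fixes f :: "'a::euclidean_space \<Rightarrow> real" and G :: "'a \<Rightarrow> 'a"
  assumes D: "\<And>x. (f has_derivative (\<lambda>h. G x \<bullet> h)) (at x)" and contG: "continuous_on UNIV G"
    and \<phi>: "\<phi> \<in> perimeter_fields"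
  shows "(\<integral>x. f x * divergence \<phi> x \<partial>lborel) = - (\<integral>x. G x \<bullet> \<phi> x \<partial>lborel)"
    "integrable lborel (\<lambda>x. G x \<bullet> \<phi> x)"
proof -
  obtain E :: "'a \<Rightarrow> 'a \<Rightarrow>\<^sub>L 'a" and K where E: "\<And>x. (\<phi> has_derivative blinfun_apply (E x)) (at x)" "continuous_on UNIV E"
    and K: "\<And>x. norm x > K \<Longrightarrow> \<phi> x = 0" "\<And>x. norm x > K \<Longrightarrow> E x = 0"
    and "\<And>x. norm (\<phi> x) \<le> 1"
    and div: "\<And>x. divergence \<phi> x = (\<Sum>b\<in>Basis. blinfun_apply (E x) b \<bullet> b)"
    by (rule perimeter_fields_unfold[OF \<phi>], rule that)
  have contf: "continuous_on UNIV f"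
    by (meson continuous_at_imp_continuous_on D has_derivative_continuous)
  have cont\<phi>: "continuous_on UNIV \<phi>"
    by (meson continuous_at_imp_continuous_on E(1) has_derivative_continuous)
  let ?F' = "\<lambda>b x h. (G x \<bullet> h) * (\<phi> x \<bullet> b) + f x * (blinfun_apply (E x) h \<bullet> b)"
  have cont: "continuous_on UNIV (\<lambda>x. ?F' b x b)" for b
    by (intro continuous_intros contf cont\<phi> contG E(2))
  have zero: "(\<integral>x. ?F' b x b \<partial>lborel) = 0" if "b \<in> Basis" for b
  proof (rule integral_directional_derivative_eq_0[where F="\<lambda>x. f x * (\<phi> x \<bullet> b)" and F'="?F' b" and K=K])
    show "((\<lambda>x. f x * (\<phi> x \<bullet> b)) has_derivative ?F' b x) (at x)" for x
      by (rule has_derivative_eq_rhs, (rule derivative_intros D E(1))+) (simp add: fun_eq_iff)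
  qed (use K that cont in auto)
  have ib: "integrable lborel (\<lambda>x. ?F' b x b)" for b
    by (rule integrable_continuous_bounded_support[OF cont, of K]) (use K in auto)
  show i1: "integrable lborel (\<lambda>x. G x \<bullet> \<phi> x)"
    by (rule integrable_continuous_bounded_support[of _ K]) (use K in \<open>auto intro!: continuous_intros contG cont\<phi>\<close>)
  have i2: "integrable lborel (\<lambda>x. f x * divergence \<phi> x)"
    unfolding div by (rule integrable_continuous_bounded_support[of _ K]) (use K in \<open>auto intro!: continuous_intros contf E(2)\<close>)
  have "(\<integral>x. G x \<bullet> \<phi> x + f x * divergence \<phi> x \<partial>lborel) = (\<integral>x. (\<Sum>b\<in>Basis. ?F' b x b) \<partial>lborel)"
    by (intro Bochner_Integration.integral_cong refl)
       (simp add: div sum.distrib sum_distrib_left euclidean_inner[of "G _" "\<phi> _"])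
  also have "\<dots> = (\<Sum>b\<in>Basis. \<integral>x. ?F' b x b \<partial>lborel)"
    by (rule Bochner_Integration.integral_sum) (rule ib)
  also have "\<dots> = 0" using zero by (intro sum.neutral) auto
  finally show "(\<integral>x. f x * divergence \<phi> x \<partial>lborel) = - (\<integral>x. G x \<bullet> \<phi> x \<partial>lborel)"
    using i1 i2 by simp
qed

lemma divergence_bounded:
  fixes \<phi> :: "'a::euclidean_space \<Rightarrow> 'a"
  assumes "\<phi> \<in> perimeter_fields"
  shows "\<exists>B\<ge>0. \<forall>x. \<bar>divergence \<phi> x\<bar> \<le> B" "divergence \<phi> \<in> borel_measurable borel"
proof -
  obtain E :: "'a \<Rightarrow> 'a \<Rightarrow>\<^sub>L 'a" and K where "\<And>x. (\<phi> has_derivative blinfun_apply (E x)) (at x)"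
    and E: "continuous_on UNIV E" and "\<And>x. norm x > K \<Longrightarrow> \<phi> x = 0"
    and K: "\<And>x. norm x > K \<Longrightarrow> E x = 0" and "\<And>x. norm (\<phi> x) \<le> 1"
    and div: "\<And>x. divergence \<phi> x = (\<Sum>b\<in>Basis. blinfun_apply (E x) b \<bullet> b)"
    by (rule perimeter_fields_unfold[OF assms], rule that)
  have cont: "continuous_on UNIV (divergence \<phi>)"
    unfolding div[abs_def] by (intro continuous_intros E)
  then show "divergence \<phi> \<in> borel_measurable borel" by (rule borel_measurable_continuous_onI)
  obtain B where B: "\<And>x. norm x \<le> K \<Longrightarrow> \<bar>divergence \<phi> x\<bar> \<le> B"
    using continuous_bounded_on_cball[OF cont] by metis
  have "\<bar>divergence \<phi> x\<bar> \<le> max 0 B" for x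
    using B[of x] K[of x] div[of x] by (cases "norm x > K") auto
  then show "\<exists>B\<ge>0. \<forall>x. \<bar>divergence \<phi> x\<bar> \<le> B" by (meson max.cobounded1)
qed

section \<open>Total mass of the mollified gradient against the perimeter\<close>

context mollified_set
begin

text \<open>This is the lower semicontinuity side of the comparison: exchanging \<open>u\<close> for
  \<open>f\<close> costs \<open>B\<close> times their L1 distance, and after integration by parts
  \<open>norm (\<phi> x) \<le> 1\<close> bounds the pairing with \<open>G\<close>.\<close>

lemma integral_divergence_le:
  assumes \<phi>: "\<phi> \<in> perimeter_fields" and B: "\<And>x. \<bar>divergence \<phi> x\<bar> \<le> B"
  shows "ennreal (\<integral>x. u x * divergence \<phi> x \<partial>lborel) \<le>
    (\<integral>\<^sup>+x. ennreal (norm (G x)) \<partial>lborel) + ennreal B * (\<integral>\<^sup>+x. ennreal \<bar>f x - u x\<bar> \<partial>lborel)"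
proof -
  have [measurable]: "divergence \<phi> \<in> borel_measurable borel" by (rule divergence_bounded[OF \<phi>])
  note ibp = integral_mult_divergence[OF f_has_derivative continuous_G \<phi>]
  have if1: "integrable lborel f"
  proof (rule integrableI_bounded)
    have "(\<integral>\<^sup>+x. ennreal (norm (f x)) \<partial>lborel) \<le> (\<integral>\<^sup>+x. (\<integral>\<^sup>+z. ennreal (u z) * ennreal (\<rho> (x - z)) \<partial>lborel) \<partial>lborel)"
    proof (rule nn_integral_mono)
      fix x
      have "ennreal (norm (f x)) \<le> (\<integral>\<^sup>+z. ennreal (norm (\<rho> (x - z) *\<^sub>R u z)) \<partial>lborel)"
        unfolding f_def conv_def by (rule integral_norm_bound_ennreal[OF integrable_conv[OF integrable_indicator_set]])
      also have "\<dots> = (\<integral>\<^sup>+z. ennreal (u z) * ennreal (\<rho> (x - z)) \<partial>lborel)"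
        using nonneg by (intro nn_integral_cong) (auto split: split_indicator)
      finally show "ennreal (norm (f x)) \<le> \<dots>" .
    qed
    also have "\<dots> = (\<integral>\<^sup>+z. (\<integral>\<^sup>+x. ennreal (u z) * ennreal (\<rho> (x - z)) \<partial>lborel) \<partial>lborel)"
      by (rule lborel_pair.Fubini') measurable
    also have "\<dots> = emeasure lborel S"
      by (simp add: nn_integral_cmult total_shift ennreal_indicator)
    finally show "(\<integral>\<^sup>+x. ennreal (norm (f x)) \<partial>lborel) < \<infinity>" using finite_set by simp
  qed simp
  have mb: "integrable lborel (\<lambda>x. v x * divergence \<phi> x)" if v: "integrable lborel v" for v :: "'a \<Rightarrow> real"
  proof (rule Bochner_Integration.integrable_bound[of lborel "\<lambda>x. B * v x"])
    show "AE x in lborel. norm (v x * divergence \<phi> x) \<le> norm (B * v x)"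
      using B by (intro AE_I2) (auto simp: abs_mult mult.commute[of B] intro!: mult_left_mono intro: order_trans[OF B abs_ge_self])
  qed (use v in auto)
  have id: "integrable lborel (\<lambda>x. (u x - f x) * divergence \<phi> x)"
    by (intro mb Bochner_Integration.integrable_diff integrable_indicator_set if1)
  have "(\<integral>x. u x * divergence \<phi> x \<partial>lborel) = (\<integral>x. f x * divergence \<phi> x + (u x - f x) * divergence \<phi> x \<partial>lborel)"
    by (simp add: algebra_simps)
  also have "\<dots> = - (\<integral>x. G x \<bullet> \<phi> x \<partial>lborel) + (\<integral>x. (u x - f x) * divergence \<phi> x \<partial>lborel)"
    using id mb[OF if1] ibp(1) by (subst Bochner_Integration.integral_add) auto
  also have "\<dots> \<le> norm (\<integral>x. G x \<bullet> \<phi> x \<partial>lborel) + norm (\<integral>x. (u x - f x) * divergence \<phi> x \<partial>lborel)"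
    by (simp add: abs_le_iff)
  finally have "ennreal (\<integral>x. u x * divergence \<phi> x \<partial>lborel) \<le>
      ennreal (norm (\<integral>x. G x \<bullet> \<phi> x \<partial>lborel) + norm (\<integral>x. (u x - f x) * divergence \<phi> x \<partial>lborel))"
    by (rule ennreal_leI)
  also have "\<dots> = ennreal (norm (\<integral>x. G x \<bullet> \<phi> x \<partial>lborel)) + ennreal (norm (\<integral>x. (u x - f x) * divergence \<phi> x \<partial>lborel))"
    by simp
  also have "\<dots> \<le> (\<integral>\<^sup>+x. ennreal (norm (G x \<bullet> \<phi> x)) \<partial>lborel) + (\<integral>\<^sup>+x. ennreal (norm ((u x - f x) * divergence \<phi> x)) \<partial>lborel)"
    by (intro add_mono integral_norm_bound_ennreal ibp(2) id)
  also have "\<dots> \<le> (\<integral>\<^sup>+x. ennreal (norm (G x)) \<partial>lborel) + (\<integral>\<^sup>+x. ennreal B * ennreal \<bar>f x - u x\<bar> \<partial>lborel)"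
  proof (intro add_mono nn_integral_mono)
    fix x
    have "norm (\<phi> x) \<le> 1" using \<phi> by (auto simp: perimeter_fields_def)
    then have "norm (G x \<bullet> \<phi> x) \<le> norm (G x) * 1"
      using Cauchy_Schwarz_ineq2[of "G x" "\<phi> x"] mult_left_mono[of "norm (\<phi> x)" 1 "norm (G x)"] by simp
    then show "ennreal (norm (G x \<bullet> \<phi> x)) \<le> ennreal (norm (G x))" by (intro ennreal_leI) simp
    have B0: "0 \<le> B" using B[of x] by linarith
    have "norm ((u x - f x) * divergence \<phi> x) \<le> \<bar>f x - u x\<bar> * B"
      using mult_left_mono[OF B[of x], of "\<bar>u x - f x\<bar>"] by (simp add: abs_mult abs_minus_commute)
    then show "ennreal (norm ((u x - f x) * divergence \<phi> x)) \<le> ennreal B * ennreal \<bar>f x - u x\<bar>"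
      using B0 by (simp add: ennreal_mult[symmetric] mult.commute ennreal_leI)
  qed
  also have "(\<integral>\<^sup>+x. ennreal B * ennreal \<bar>f x - u x\<bar> \<partial>lborel) = ennreal B * (\<integral>\<^sup>+x. ennreal \<bar>f x - u x\<bar> \<partial>lborel)"
    by (rule nn_integral_cmult) measurable
  finally show ?thesis .
qed

text \<open>Testing against the mollification of \<open>- sgn G\<close>, cut off to a large ball, recovers the
  total mass of \<open>G\<close> up to the cutoff.\<close>

lemma integral_norm_G_cball_le_perimeter:
  "ereal (\<integral>x. indicator (cball 0 K) x * norm (G x) \<partial>lborel) \<le> perimeter S"
proof -
  \<comment> \<open>The minus sign anticipates integration by parts: the pairing that results is
    between \<open>G\<close> and \<open>- v\<close>, which is \<open>norm (G z)\<close> on the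
    ball.\<close>
  define v where "v z = - (indicator (cball 0 K) z *\<^sub>R sgn (G z))" for z
  have [measurable]: "cball (0::'a) K \<in> sets borel" by simp
  have [measurable]: "v \<in> borel_measurable borel" unfolding v_def[abs_def] sgn_div_norm by measurable
  have v1: "norm (v z) \<le> indicator (cball 0 K) z" for z
    by (auto simp: v_def norm_sgn split: split_indicator)
  have icb: "integrable lborel (indicator (cball 0 K) :: 'a \<Rightarrow> real)"
    using emeasure_bounded_finite[OF bounded_cball, of "0::'a" K] by (intro integrable_real_indicator) auto
  have iv: "integrable lborel v"
    by (rule Bochner_Integration.integrable_bound[OF icb]) (use v1 in auto)
  define \<phi> where "\<phi> = conv v"
  define D where "D x = Blinfun (dconv v x)" for x
  have D: "blinfun_apply (D x) = dconv v x" for x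
    unfolding D_def by (rule bounded_linear_Blinfun_apply[OF bounded_linear_dconv[OF iv]])
  have der: "(\<phi> has_derivative blinfun_apply (D x)) (at x)" for x
    unfolding \<phi>_def D by (rule conv_has_derivative[OF iv])
  have Dlip: "norm (D x - D y) \<le> (L * (\<integral>z. norm (v z) \<partial>lborel)) * norm (x - y)" for x y
  proof (rule norm_blinfun_bound)
    show "norm (blinfun_apply (D x - D y) h) \<le> L * (\<integral>z. norm (v z) \<partial>lborel) * norm (x - y) * norm h" for h
      using dconv_lipschitz[OF iv, of x h y] by (simp add: blinfun.diff_left D mult_ac)
  qed (use lipschitz_nonneg in auto)
  have "(L * (\<integral>z. norm (v z) \<partial>lborel))-lipschitz_on UNIV D"
    using Dlip lipschitz_nonneg by (intro lipschitz_onI) (auto simp: dist_norm)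
  then have contD: "continuous_on UNIV D" by (rule lipschitz_on_continuous_on)
  have supp\<phi>: "norm x \<le> K + e" if "\<phi> x \<noteq> 0" for x
  proof (rule ccontr)
    assume x: "\<not> norm x \<le> K + e"
    have z0: "\<rho> (x - z) *\<^sub>R v z = 0" for z
    proof (cases "norm z \<le> K")
      case True
      then have "norm (x - z) > e" using x norm_triangle_ineq2[of x z] by linarith
      then show ?thesis by (simp add: supp)
    qed (simp add: v_def)
    have "\<phi> x = 0" unfolding \<phi>_def conv_def z0 by simp
    then show False using that by simp
  qed
  have bd\<phi>: "norm (\<phi> x) \<le> 1" for x
  proof -
    have "norm (\<phi> x) \<le> (\<integral>z. \<rho> (x - z) \<partial>lborel)"
      unfolding \<phi>_def conv_def
    proof (rule Bochner_Integration.integral_norm_bound_integral[OF integrable_conv[OF iv] integrable_mollifier_reflect])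
      fix z
      have "norm (v z) \<le> 1" using v1[of z] by (auto split: split_indicator_asm)
      then show "norm (\<rho> (x - z) *\<^sub>R v z) \<le> \<rho> (x - z)"
        using nonneg[of "x - z"] by (simp add: mult_left_le)
    qed
    then show ?thesis by (simp add: integral_mollifier_reflect)
  qed
  have "\<phi> \<in> perimeter_fields"
  proof -
    have "bounded {x. \<phi> x \<noteq> 0}" unfolding bounded_iff using supp\<phi> by blast
    then have "compact (closure {x. \<phi> x \<noteq> 0})" by simp
    moreover have "C1 \<phi>" unfolding C1_def using der contD by blast
    ultimately show ?thesis using bd\<phi> by (simp add: perimeter_fields_def)
  qed
  then have "ereal (\<integral>x. u x * divergence \<phi> x \<partial>lborel) \<le> perimeter S"
    unfolding perimeter_def by (rule SUP_upper)
  moreover have "(\<integral>x. u x * divergence \<phi> x \<partial>lborel) = (\<integral>x. indicator (cball 0 K) x * norm (G x) \<partial>lborel)"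
  proof -
    have div: "divergence \<phi> x = (\<integral>z. g (x - z) \<bullet> v z \<partial>lborel)" for x
    proof -
      have "divergence \<phi> x = (\<Sum>b\<in>Basis. dconv v x b \<bullet> b)"
        unfolding divergence_def using frechet_derivative_at[OF der[of x]] by (simp add: D)
      also have "\<dots> = (\<Sum>b\<in>Basis. \<integral>z. ((g (x - z) \<bullet> b) *\<^sub>R v z) \<bullet> b \<partial>lborel)"
        unfolding dconv_def by (intro sum.cong refl integral_inner_left[symmetric] integrable_grad_conv[OF iv])
      also have "\<dots> = (\<integral>z. (\<Sum>b\<in>Basis. ((g (x - z) \<bullet> b) *\<^sub>R v z) \<bullet> b) \<partial>lborel)"
        by (rule Bochner_Integration.integral_sum[symmetric]) (intro integrable_inner_left integrable_grad_conv[OF iv])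
      also have "\<dots> = (\<integral>z. g (x - z) \<bullet> v z \<partial>lborel)"
        by (intro Bochner_Integration.integral_cong refl) (simp add: euclidean_inner[of "g _" "v _"])
      finally show ?thesis .
    qed
    define B where "B = L * (2 * e + 1)"
    have gv: "norm (u x * (g (x - z) \<bullet> v z)) \<le> B * (u x * indicator (cball 0 K) z)" for x z
    proof -
      have "\<bar>g (x - z) \<bullet> v z\<bar> \<le> norm (g (x - z)) * norm (v z)" by (rule Cauchy_Schwarz_ineq2)
      also have "\<dots> \<le> B * indicator (cball 0 K) z"
        using grad_bound[of "x - z"] v1[of z] lipschitz_nonneg e_pos by (intro mult_mono) (auto simp: B_def)
      finally show ?thesis by (auto split: split_indicator)
    qed
    have B0: "B \<ge> 0" using lipschitz_nonneg e_pos by (simp add: B_def)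
    \<comment> \<open>Absolute integrability on the product, as Fubini requires: \<open>x\<close>
      ranges over a set of finite measure, \<open>z\<close> over a ball, and the gradient of the
      kernel is bounded.\<close>
    have ip: "integrable (lborel \<Otimes>\<^sub>M lborel) (\<lambda>(x, z). u x * (g (x - z) \<bullet> v z))"
    proof (rule Bochner_Integration.integrable_bound[where f="\<lambda>(x, z). B * (u x * indicator (cball (0::'a) K) z)"])
      show "integrable (lborel \<Otimes>\<^sub>M lborel) (\<lambda>(x, z). B * (u x * indicator (cball (0::'a) K) z))"
      proof (rule integrableI_bounded)
        have "(\<integral>\<^sup>+p. ennreal (norm (case p of (x, z) \<Rightarrow> B * (u x * indicator (cball (0::'a) K) z))) \<partial>(lborel \<Otimes>\<^sub>M lborel))
          = (\<integral>\<^sup>+x. (\<integral>\<^sup>+z. ennreal (B * u x) * indicator (cball (0::'a) K) z \<partial>lborel) \<partial>lborel)"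
          using B0 by (subst lborel.nn_integral_fst[symmetric])
            (auto intro!: nn_integral_cong split: split_indicator)
        also have "\<dots> = (\<integral>\<^sup>+x. ennreal B * indicator S x * emeasure lborel (cball (0::'a) K) \<partial>lborel)"
          using B0 by (intro nn_integral_cong, subst nn_integral_cmult) (auto split: split_indicator)
        also have "\<dots> = ennreal B * emeasure lborel S * emeasure lborel (cball (0::'a) K)"
          by (simp add: nn_integral_multc nn_integral_cmult)
        also have "\<dots> < \<infinity>"
          using finite_set emeasure_bounded_finite[OF bounded_cball, of "0::'a" K]
          by (simp add: ennreal_mult_less_top)
        finally show "(\<integral>\<^sup>+p. ennreal (norm (case p of (x, z) \<Rightarrow> B * (u x * indicator (cball (0::'a) K) z))) \<partial>(lborel \<Otimes>\<^sub>M lborel)) < \<infinity>" .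
      qed measurable
      show "AE p in lborel \<Otimes>\<^sub>M lborel. norm (case p of (x, z) \<Rightarrow> u x * (g (x - z) \<bullet> v z)) \<le>
         norm (case p of (x, z) \<Rightarrow> B * (u x * indicator (cball (0::'a) K) z))"
      proof (rule AE_I2)
        fix p :: "'a \<times> 'a"
        obtain x z where p: "p = (x, z)" by (cases p)
        show "norm (case p of (x, z) \<Rightarrow> u x * (g (x - z) \<bullet> v z)) \<le>
          norm (case p of (x, z) \<Rightarrow> B * (u x * indicator (cball (0::'a) K) z))"
          using order_trans[OF gv[of x z] abs_ge_self] by (simp only: p case_prod_conv real_norm_def)
      qed
    qed measurable
    have "(\<integral>x. u x * divergence \<phi> x \<partial>lborel) = (\<integral>x. (\<integral>z. u x * (g (x - z) \<bullet> v z) \<partial>lborel) \<partial>lborel)"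
      by (simp add: div)
    also have "\<dots> = (\<integral>z. (\<integral>x. u x * (g (x - z) \<bullet> v z) \<partial>lborel) \<partial>lborel)"
      by (rule lborel_pair.Fubini_integral[symmetric]) (use ip in simp)
    also have "\<dots> = (\<integral>z. indicator (cball 0 K) z * norm (G z) \<partial>lborel)"
    proof (intro Bochner_Integration.integral_cong refl)
      fix z
      have "(\<integral>x. u x * (g (x - z) \<bullet> v z) \<partial>lborel) = (\<integral>x. (u x *\<^sub>R g (z - x)) \<bullet> (- v z) \<partial>lborel)"
      proof (intro Bochner_Integration.integral_cong refl)
        fix x
        \<comment> \<open>Oddness of \<open>g\<close> turns the kernel centred at \<open>z\<close>
          into the one defining \<open>G z\<close>; its sign cancels the one built into
          \<open>v\<close>.\<close>
        have "g (x - z) = - g (z - x)" using grad_odd[of "z - x"] by simp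
        then show "u x * (g (x - z) \<bullet> v z) = (u x *\<^sub>R g (z - x)) \<bullet> (- v z)" by simp
      qed
      also have "\<dots> = G z \<bullet> (- v z)"
        unfolding G_def by (rule integral_inner_left[OF integrable_G])
      also have "\<dots> = indicator (cball 0 K) z * norm (G z)"
        by (cases "G z = 0") (simp_all add: v_def sgn_div_norm dot_square_norm power2_eq_square)
      finally show "(\<integral>x. u x * (g (x - z) \<bullet> v z) \<partial>lborel) = indicator (cball 0 K) z * norm (G z)" .
    qed
    finally show ?thesis .
  qed
  ultimately show ?thesis by simp
qed

text \<open>The bound on balls is uniform in the radius, so monotone convergence removes the
  cut-off.\<close>

lemma nn_integral_norm_G_le_perimeter:
  assumes "perimeter S = ereal p"
  shows "(\<integral>\<^sup>+x. ennreal (norm (G x)) \<partial>lborel) \<le> ennreal p"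
proof -
  have [measurable]: "cball (0::'a) K \<in> sets borel" for K by simp
  have cK: "(\<integral>\<^sup>+x. ennreal (indicator (cball 0 K) x * norm (G x)) \<partial>lborel) \<le> ennreal p" for K
  proof -
    have "integrable lborel (\<lambda>x. indicator (cball 0 K) x *\<^sub>R norm (G x))"
      by (intro borel_integrable_compact continuous_intros continuous_G) auto
    then have "(\<integral>\<^sup>+x. ennreal (indicator (cball 0 K) x * norm (G x)) \<partial>lborel) =
        ennreal (\<integral>x. indicator (cball 0 K) x * norm (G x) \<partial>lborel)"
      by (intro nn_integral_eq_integral) auto
    also have "\<dots> \<le> ennreal p"
      using integral_norm_G_cball_le_perimeter[of K] unfolding assms by (intro ennreal_leI) simp
    finally show ?thesis .
  qed
  have "(\<lambda>n. \<integral>\<^sup>+x. ennreal (indicator (cball 0 (real n)) x * norm (G x)) \<partial>lborel) \<longlonglongrightarrow>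
     (\<integral>\<^sup>+x. ennreal (norm (G x)) \<partial>lborel)"
  proof (rule nn_integral_LIMSEQ)
    show "incseq (\<lambda>n x. ennreal (indicator (cball 0 (real n)) x * norm (G x)))"
      by (auto simp: incseq_def le_fun_def intro!: ennreal_leI split: split_indicator)
    show "(\<lambda>n. ennreal (indicator (cball 0 (real n)) x * norm (G x))) \<longlonglongrightarrow> ennreal (norm (G x))" for x
    proof -
      obtain N where N: "norm x \<le> real N" using real_arch_simple by blast
      have "\<forall>\<^sub>F n in sequentially. ennreal (norm (G x)) = ennreal (indicator (cball 0 (real n)) x * norm (G x))"
        using eventually_ge_at_top[of N] by eventually_elim (use N in auto)
      then show ?thesis by (rule Lim_transform_eventually[OF tendsto_const])
    qed
  qed measurable
  then show ?thesis by (rule LIMSEQ_le_const2) (use cK in blast)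
qed

end

section \<open>Isotropic displacements\<close>

text \<open>Both parts of the symmetric difference complete the same intersection to a set of
  measure \<open>emeasure lborel S\<close>; that measure is finite, so the intersection cancels and
  the two parts have equal size. This is the origin of the factor 2 in front of the heat
  loss.\<close>

lemma shift_diff_eq:
  fixes S :: "'a::euclidean_space set"
  assumes [measurable]: "S \<in> sets borel" and fin: "emeasure lborel S < \<infinity>"
  shows "shift_diff S y = 2 * (\<integral>\<^sup>+x. indicator S x * indicator (- S) (x + y) \<partial>lborel)"
proof -
  have [measurable]: "- S \<in> sets borel" by auto
  let ?h = "\<integral>\<^sup>+x. indicator S x * indicator (- S) (x + y) \<partial>lborel"
  let ?k = "\<integral>\<^sup>+x. indicator (- S) x * indicator S (x + y) \<partial>lborel"
  let ?a = "\<integral>\<^sup>+x. indicator S x * indicator S (x + y) \<partial>lborel"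
  have "(\<integral>\<^sup>+x. indicator S x \<partial>lborel) = (\<integral>\<^sup>+x. indicator S x * indicator (- S) (x + y) + indicator S x * indicator S (x + y) \<partial>lborel)"
    by (rule nn_integral_cong) (auto split: split_indicator)
  then have 1: "emeasure lborel S = ?h + ?a" by (simp add: nn_integral_add)
  have "emeasure lborel S = (\<integral>\<^sup>+x. indicator S (x + y) \<partial>lborel)"
    using nn_integral_lborel_shift[of "indicator S :: 'a \<Rightarrow> ennreal" y] by simp
  also have "\<dots> = (\<integral>\<^sup>+x. indicator (- S) x * indicator S (x + y) + indicator S x * indicator S (x + y) \<partial>lborel)"
    by (auto intro!: nn_integral_cong split: split_indicator)
  finally have 2: "emeasure lborel S = ?k + ?a" by (simp add: nn_integral_add)
  have "?a < \<infinity>" using 1 fin by (metis ennreal_add_less_top infinity_ennreal_def)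
  moreover have "?a + ?k = ?a + ?h" using 1 2 by (simp only: add.commute[of ?a])
  ultimately have hk: "?k = ?h" by (simp only: ennreal_add_left_cancel infinity_ennreal_def less_irrefl) auto
  have "shift_diff S y = (\<integral>\<^sup>+x. indicator S x * indicator (- S) (x + y) + indicator (- S) x * indicator S (x + y) \<partial>lborel)"
    unfolding shift_diff_def by (auto intro!: nn_integral_cong split: split_indicator)
  also have "\<dots> = ?h + ?k" by (simp add: nn_integral_add)
  finally show ?thesis unfolding hk mult_2 .
qed

lemma shift_diff_le_measure:
  fixes S :: "'a::euclidean_space set"
  assumes [measurable]: "S \<in> sets borel" and fin: "emeasure lborel S < \<infinity>"
  shows "shift_diff S y \<le> 2 * emeasure lborel S"
proof -
  have "(\<integral>\<^sup>+x. indicator S x * indicator (- S) (x + y) \<partial>lborel) \<le> (\<integral>\<^sup>+x. indicator S x \<partial>lborel)"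
    by (intro nn_integral_mono) (auto split: split_indicator)
  then show ?thesis unfolding shift_diff_eq[OF assms] by (simp add: mult_left_mono)
qed

text \<open>By the preceding identity it is enough to treat points of \<open>S\<close> that leave
  \<open>S\<close>. Openness keeps each such point inside under small shifts, and the indicator of
  \<open>S\<close> is an integrable majorant.\<close>

lemma shift_diff_small:
  fixes S :: "'a::euclidean_space set"
  assumes op: "open S" and fin: "emeasure lborel S < \<infinity>" and "\<eta> > 0"
  shows "\<exists>\<delta>>0. \<forall>z. norm z \<le> \<delta> \<longrightarrow> shift_diff S z \<le> \<eta>"
proof (rule ccontr)
  assume neg: "\<not> ?thesis"
  have S[measurable]: "S \<in> sets borel" using op by simp
  have [measurable]: "- S \<in> sets borel" by auto
  have "\<forall>n. \<exists>z. norm z \<le> inverse (real (Suc n)) \<and> \<not> shift_diff S z \<le> \<eta>"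
    using neg by (metis inverse_positive_iff_positive of_nat_0_less_iff zero_less_Suc)
  then obtain z where z: "\<And>n. norm (z n) \<le> inverse (real (Suc n))" "\<And>n. \<not> shift_diff S (z n) \<le> \<eta>" by metis
  have z0: "z \<longlonglongrightarrow> 0"
    by (rule Lim_null_comparison[OF _ LIMSEQ_inverse_real_of_nat]) (use z in auto)
  have "(\<lambda>n. \<integral>\<^sup>+x. indicator S x * indicator (- S) (x + z n) \<partial>lborel) \<longlonglongrightarrow> (\<integral>\<^sup>+x. 0 \<partial>(lborel :: 'a measure))"
  proof (rule nn_integral_dominated_convergence[where w="indicator S"])
    show "(\<integral>\<^sup>+x. indicator S x \<partial>lborel) < \<infinity>" using fin by simp
    show "AE x in lborel. (\<lambda>n. indicator S x * indicator (- S) (x + z n) :: ennreal) \<longlonglongrightarrow> 0"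
    proof (rule AE_I2)
      fix x
      show "(\<lambda>n. indicator S x * indicator (- S) (x + z n) :: ennreal) \<longlonglongrightarrow> 0"
      proof (cases "x \<in> S")
        case True
        have "(\<lambda>n. x + z n) \<longlonglongrightarrow> x + 0" by (intro tendsto_intros z0)
        then have "\<forall>\<^sub>F n in sequentially. x + z n \<in> S"
          using op True by (auto simp: tendsto_def)
        then have "\<forall>\<^sub>F n in sequentially. 0 = (indicator S x * indicator (- S) (x + z n) :: ennreal)"
          by eventually_elim auto
        then show ?thesis by (rule Lim_transform_eventually[OF tendsto_const])
      qed simp
    qed
  qed (auto split: split_indicator)
  then have "(\<lambda>n. 2 * (\<integral>\<^sup>+x. indicator S x * indicator (- S) (x + z n) \<partial>lborel)) \<longlonglongrightarrow> 2 * 0"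
    by (intro ennreal_tendsto_cmult) auto
  then have "(\<lambda>n. shift_diff S (z n)) \<longlonglongrightarrow> 0"
    unfolding shift_diff_eq[OF S fin] by simp
  then have "\<forall>\<^sub>F n in sequentially. shift_diff S (z n) < \<eta>"
    using \<open>\<eta> > 0\<close> by (rule order_tendstoD)
  then obtain n where "shift_diff S (z n) < \<eta>" by (auto simp: eventually_sequentially)
  then show False using z(2)[of n] by simp
qed

lemma shift_diff_measurable [measurable]:
  fixes S :: "'a::euclidean_space set"
  assumes [measurable]: "S \<in> sets borel"
  shows "shift_diff S \<in> borel_measurable borel"
proof -
  have "(\<lambda>y. \<integral>\<^sup>+x. ennreal \<bar>indicator S (x + y) - indicator S x\<bar> \<partial>(lborel :: 'a measure)) \<in> borel_measurable borel"
    by measurable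
  then show ?thesis by (simp add: shift_diff_def[abs_def])
qed

text \<open>After Fubini the displacement is frozen first, and the integral over starting points is
  half of \<open>shift_diff\<close>.\<close>

lemma heat_loss_eq_shift_diff:
  fixes M :: "'w measure" and X :: "real \<Rightarrow> 'w \<Rightarrow> 'a::euclidean_space"
  assumes "prob_space M" and [measurable]: "X t \<in> borel_measurable M"
    and S[measurable]: "S \<in> sets borel" and fin: "emeasure lborel S < \<infinity>"
  shows "ennreal (2 * heat_loss M X S t) = (\<integral>\<^sup>+\<omega>. shift_diff S (X t \<omega>) \<partial>M)" "0 \<le> heat_loss M X S t"
proof -
  interpret prob_space M by fact
  interpret P: pair_sigma_finite M "lborel :: 'a measure" ..
  have [measurable]: "- S \<in> sets borel" by auto
  define k where "k x = prob {\<omega>\<in>space M. x + X t \<omega> \<in> - S}" for x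
  have law: "measure (law_from M X x t) (- S) = k x" for x
    unfolding law_from_def k_def
    by (subst measure_distr) (auto intro!: arg_cong[where f=prob])
  have km: "k \<in> borel_measurable borel"
    unfolding k_def by measurable
  have hl: "heat_loss M X S t = (\<integral>x. indicator S x * k x \<partial>lborel)"
    unfolding heat_loss_def set_lebesgue_integral_def law by simp
  have int: "integrable lborel (\<lambda>x. indicator S x * k x)"
  proof (rule Bochner_Integration.integrable_bound[of lborel "indicator S :: 'a \<Rightarrow> real"])
    show "integrable lborel (indicator S :: 'a \<Rightarrow> real)"
      using fin by (intro integrable_real_indicator) auto
  qed (use km in \<open>auto simp: k_def split: split_indicator\<close>)
  show "0 \<le> heat_loss M X S t" unfolding hl by (intro integral_nonneg_AE) (auto simp: k_def)
  have "ennreal (heat_loss M X S t) = (\<integral>\<^sup>+x. ennreal (indicator S x * k x) \<partial>lborel)"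
    unfolding hl using int by (intro nn_integral_eq_integral[symmetric]) (auto simp: k_def)
  also have "\<dots> = (\<integral>\<^sup>+x. (\<integral>\<^sup>+\<omega>. indicator S x * indicator (- S) (x + X t \<omega>) \<partial>M) \<partial>lborel)"
  proof (rule nn_integral_cong)
    fix x
    have "ennreal (k x) = (\<integral>\<^sup>+\<omega>. indicator {\<omega>\<in>space M. x + X t \<omega> \<in> - S} \<omega> \<partial>M)"
      unfolding k_def by (subst nn_integral_indicator) (auto simp: emeasure_eq_measure)
    also have "\<dots> = (\<integral>\<^sup>+\<omega>. indicator (- S) (x + X t \<omega>) \<partial>M)"
      by (intro nn_integral_cong) (auto split: split_indicator)
    finally show "ennreal (indicator S x * k x) = (\<integral>\<^sup>+\<omega>. indicator S x * indicator (- S) (x + X t \<omega>) \<partial>M)"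
      by (auto split: split_indicator)
  qed
  also have "\<dots> = (\<integral>\<^sup>+\<omega>. (\<integral>\<^sup>+x. indicator S x * indicator (- S) (x + X t \<omega>) \<partial>lborel) \<partial>M)"
    by (rule P.Fubini') measurable
  finally have "ennreal (2 * heat_loss M X S t) = 2 * (\<integral>\<^sup>+\<omega>. (\<integral>\<^sup>+x. indicator S x * indicator (- S) (x + X t \<omega>) \<partial>lborel) \<partial>M)"
    by (simp add: ennreal_mult'[of 2])
  also have "\<dots> = (\<integral>\<^sup>+\<omega>. shift_diff S (X t \<omega>) \<partial>M)"
    unfolding shift_diff_eq[OF S fin] by (rule nn_integral_cmult[symmetric]) measurable
  finally show "ennreal (2 * heat_loss M X S t) = (\<integral>\<^sup>+\<omega>. shift_diff S (X t \<omega>) \<partial>M)" .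
qed

text \<open>The witness is the Householder reflection exchanging \<open>a\<close> and \<open>b\<close>, which is self-adjoint.\<close>

lemma orthogonal_transformation_swapping:
  fixes a b :: "'a::euclidean_space"
  assumes "norm a = norm b"
  obtains T where "orthogonal_transformation T" "\<And>x. a \<bullet> x = b \<bullet> T x"
proof (cases "a = b")
  case True
  then show ?thesis using that[of "\<lambda>x. x"] by simp
next
  case False
  define w where "w = a - b"
  define T where "T x = x - (2 * (w \<bullet> x) / (w \<bullet> w)) *\<^sub>R w" for x
  have ww: "w \<bullet> w \<noteq> 0" using False by (simp add: w_def)
  have "a \<bullet> a = b \<bullet> b" using assms by (simp add: dot_square_norm)
  \<comment> \<open>Equality of the norms enters here: it makes the reflection coefficient applied
    to \<open>b\<close> collapse, so that \<open>b\<close> is sent to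
    \<open>b + w = a\<close>.\<close>
  then have bw: "w \<bullet> w = - 2 * (b \<bullet> w)"
    by (simp add: w_def inner_diff_left inner_diff_right inner_commute)
  have lin: "linear T"
    unfolding T_def[abs_def]
    by (rule linearI) (auto simp: inner_add_right algebra_simps add_divide_distrib)
  have "T x \<bullet> T y = x \<bullet> y" for x y
    using ww by (simp add: T_def inner_diff_left inner_diff_right inner_commute field_simps)
  then have "orthogonal_transformation T" using lin by (simp add: orthogonal_transformation_def)
  moreover have "a \<bullet> x = b \<bullet> T x" for x
  proof -
    have "b \<bullet> T x = b \<bullet> x - 2 * (w \<bullet> x) * (b \<bullet> w) / (w \<bullet> w)" by (simp add: T_def inner_diff_right)
    also have "\<dots> = b \<bullet> x + (w \<bullet> x) * ((w \<bullet> w) / (w \<bullet> w))" unfolding bw by (simp add: field_simps)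
    also have "\<dots> = a \<bullet> x" using ww by (simp add: w_def inner_diff_left)
    finally show ?thesis by simp
  qed
  ultimately show ?thesis by (rule that)
qed

text \<open>An orthogonal map carries the direction \<open>v\<close> to that of \<open>e\<close>. It
  preserves both the law and the unit ball, so the truncation does not destroy the symmetry.\<close>

lemma isotropic_truncated_moment:
  fixes Y :: "'w \<Rightarrow> 'a::euclidean_space"
  assumes Y[measurable]: "Y \<in> borel_measurable M"
    and iso: "\<And>T. orthogonal_transformation T \<Longrightarrow> distr M borel (\<lambda>\<omega>. T (Y \<omega>)) = distr M borel Y"
    and "norm e = 1"
  shows "(\<integral>\<^sup>+\<omega>. ennreal \<bar>v \<bullet> Y \<omega>\<bar> * indicator (cball 0 1) (Y \<omega>) \<partial>M)
    = ennreal (norm v) * (\<integral>\<^sup>+\<omega>. ennreal \<bar>e \<bullet> Y \<omega>\<bar> * indicator (cball 0 1) (Y \<omega>) \<partial>M)"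
proof -
  have [measurable]: "cball (0::'a) 1 \<in> sets borel" by simp
  obtain T where T: "orthogonal_transformation T" "\<And>x. v \<bullet> x = (norm v *\<^sub>R e) \<bullet> T x"
    using orthogonal_transformation_swapping[of v "norm v *\<^sub>R e"] \<open>norm e = 1\<close> by auto
  have [measurable]: "T \<in> borel_measurable borel"
    using T(1) by (intro borel_measurable_continuous_onI linear_continuous_on)
      (auto simp: orthogonal_transformation_def linear_conv_bounded_linear)
  let ?F = "\<lambda>y. ennreal (norm v) * (ennreal \<bar>e \<bullet> y\<bar> * indicator (cball 0 1) y)"
  have "(\<integral>\<^sup>+\<omega>. ennreal \<bar>v \<bullet> Y \<omega>\<bar> * indicator (cball 0 1) (Y \<omega>) \<partial>M) = (\<integral>\<^sup>+\<omega>. ?F (T (Y \<omega>)) \<partial>M)"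
    using T(2) orthogonal_transformation_norm[OF T(1)]
    by (intro nn_integral_cong) (auto simp: abs_mult ennreal_mult split: split_indicator)
  also have "\<dots> = (\<integral>\<^sup>+y. ?F y \<partial>distr M borel (\<lambda>\<omega>. T (Y \<omega>)))"
    by (rule nn_integral_distr[symmetric]) measurable
  also have "\<dots> = (\<integral>\<^sup>+\<omega>. ?F (Y \<omega>) \<partial>M)"
    unfolding iso[OF T(1)] by (rule nn_integral_distr) measurable
  finally show ?thesis by (simp add: nn_integral_cmult)
qed

context mollified_set
begin

lemma nn_integral_inner_G_isotropic:
  fixes Y :: "'w \<Rightarrow> 'a"
  assumes "prob_space M" and Y[measurable]: "Y \<in> borel_measurable M"
    and iso: "\<And>T. orthogonal_transformation T \<Longrightarrow> distr M borel (\<lambda>\<omega>. T (Y \<omega>)) = distr M borel Y"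
    and "norm b = 1"
  shows "(\<integral>\<^sup>+\<omega>. (\<integral>\<^sup>+x. ennreal \<bar>G x \<bullet> Y \<omega>\<bar> \<partial>lborel) * indicator (cball 0 1) (Y \<omega>) \<partial>M)
    = (\<integral>\<^sup>+x. ennreal (norm (G x)) \<partial>lborel) * (\<integral>\<^sup>+\<omega>. ennreal \<bar>b \<bullet> Y \<omega>\<bar> * indicator (cball 0 1) (Y \<omega>) \<partial>M)"
proof -
  interpret prob_space M by fact
  interpret P: pair_sigma_finite M "lborel :: 'a measure" ..
  have [measurable]: "cball (0::'a) 1 \<in> sets borel" by simp
  have "(\<integral>\<^sup>+\<omega>. (\<integral>\<^sup>+x. ennreal \<bar>G x \<bullet> Y \<omega>\<bar> \<partial>lborel) * indicator (cball 0 1) (Y \<omega>) \<partial>M)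
     = (\<integral>\<^sup>+\<omega>. (\<integral>\<^sup>+x. ennreal \<bar>G x \<bullet> Y \<omega>\<bar> * indicator (cball 0 1) (Y \<omega>) \<partial>lborel) \<partial>M)"
    by (intro nn_integral_cong nn_integral_multc[symmetric]) measurable
  also have "\<dots> = (\<integral>\<^sup>+x. (\<integral>\<^sup>+\<omega>. ennreal \<bar>G x \<bullet> Y \<omega>\<bar> * indicator (cball 0 1) (Y \<omega>) \<partial>M) \<partial>lborel)"
    by (rule P.Fubini'[symmetric]) measurable
  also have "\<dots> = (\<integral>\<^sup>+x. ennreal (norm (G x)) * (\<integral>\<^sup>+\<omega>. ennreal \<bar>b \<bullet> Y \<omega>\<bar> * indicator (cball 0 1) (Y \<omega>) \<partial>M) \<partial>lborel)"
    by (intro nn_integral_cong isotropic_truncated_moment[OF Y iso \<open>norm b = 1\<close>])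
  also have "\<dots> = (\<integral>\<^sup>+x. ennreal (norm (G x)) \<partial>lborel) * (\<integral>\<^sup>+\<omega>. ennreal \<bar>b \<bullet> Y \<omega>\<bar> * indicator (cball 0 1) (Y \<omega>) \<partial>M)"
    by (rule nn_integral_multc) measurable
  finally show ?thesis .
qed

end

text \<open>The kernel radius is the \<open>\<delta>\<close> below which translates of
  \<open>S\<close> differ from \<open>S\<close> by at most \<open>\<eta>\<close>.\<close>

lemma mollified_set_exists:
  fixes S :: "'a::euclidean_space set"
  assumes op: "open S" and fin: "emeasure lborel S < \<infinity>" and "\<eta> > 0"
  obtains \<rho> g e L where "mollified_set \<rho> g e L S"
    "(\<integral>\<^sup>+x. ennreal \<bar>mollified_set.f \<rho> S x - indicator S x\<bar> \<partial>lborel) \<le> \<eta>"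
proof -
  obtain \<delta> where \<delta>: "\<delta> > 0" "\<And>z. norm z \<le> \<delta> \<Longrightarrow> shift_diff S z \<le> \<eta>"
    using shift_diff_small[OF assms] by blast
  obtain \<rho> :: "'a \<Rightarrow> real" and g L where "mollifier \<rho> g \<delta> L" using mollifier_exists[OF \<delta>(1)] by blast
  then interpret mollifier \<rho> g \<delta> L .
  interpret mollified_set \<rho> g \<delta> L S by unfold_locales (use op fin in auto)
  show ?thesis using that[of \<rho> g \<delta> L] f_approximates[of \<eta>] \<delta>(2) mollified_set_axioms by blast
qed

text \<open>The mollifier is chosen after the law of \<open>Y\<close>. The total error is then an
  arbitrary \<open>\<epsilon>\<close>, and the bound holds with the exact perimeter and without a
  quadratic term.\<close>

lemma shift_diff_expectation_le:
  fixes Y :: "'w \<Rightarrow> 'a::euclidean_space"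
  assumes op: "open S" and fin: "emeasure lborel S < \<infinity>" and per: "perimeter S = ereal p"
    and "prob_space M" and Y[measurable]: "Y \<in> borel_measurable M"
    and iso: "\<And>T. orthogonal_transformation T \<Longrightarrow> distr M borel (\<lambda>\<omega>. T (Y \<omega>)) = distr M borel Y"
    and b: "norm b = 1"
  shows "(\<integral>\<^sup>+\<omega>. shift_diff S (Y \<omega>) * indicator (cball 0 1) (Y \<omega>) \<partial>M)
    \<le> ennreal p * (\<integral>\<^sup>+\<omega>. ennreal \<bar>b \<bullet> Y \<omega>\<bar> * indicator (cball 0 1) (Y \<omega>) \<partial>M)"
proof (rule ennreal_le_epsilon)
  fix \<epsilon> :: real
  assume "\<epsilon> > 0"
  interpret M: prob_space M by fact
  have [measurable]: "cball (0::'a) 1 \<in> sets borel" by simp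
  have "ennreal (\<epsilon> / 2) > 0" using \<open>\<epsilon> > 0\<close> by simp
  then obtain \<rho> g e L where "mollified_set \<rho> g e L S"
    and ap: "(\<integral>\<^sup>+x. ennreal \<bar>mollified_set.f \<rho> S x - indicator S x\<bar> \<partial>lborel) \<le> ennreal (\<epsilon> / 2)"
    using mollified_set_exists[OF op fin] by blast
  then interpret mollified_set \<rho> g e L S by simp
  have "(\<integral>\<^sup>+\<omega>. shift_diff S (Y \<omega>) * indicator (cball 0 1) (Y \<omega>) \<partial>M)
     \<le> (\<integral>\<^sup>+\<omega>. (\<integral>\<^sup>+x. ennreal \<bar>G x \<bullet> Y \<omega>\<bar> \<partial>lborel) * indicator (cball 0 1) (Y \<omega>) + ennreal \<epsilon> \<partial>M)"
  proof (rule nn_integral_mono)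
    fix \<omega>
    have "2 * (\<integral>\<^sup>+x. ennreal \<bar>f x - u x\<bar> \<partial>lborel) \<le> 2 * ennreal (\<epsilon> / 2)"
      using ap by (rule mult_left_mono) simp
    also have "\<dots> = ennreal \<epsilon>"
      using \<open>\<epsilon> > 0\<close> by (simp flip: ennreal_numeral ennreal_mult)
    finally have "shift_diff S (Y \<omega>) \<le> (\<integral>\<^sup>+x. ennreal \<bar>G x \<bullet> Y \<omega>\<bar> \<partial>lborel) + ennreal \<epsilon>"
      by (intro order_trans[OF shift_diff_le_grad] add_left_mono)
    then show "shift_diff S (Y \<omega>) * indicator (cball 0 1) (Y \<omega>) \<le>
        (\<integral>\<^sup>+x. ennreal \<bar>G x \<bullet> Y \<omega>\<bar> \<partial>lborel) * indicator (cball 0 1) (Y \<omega>) + ennreal \<epsilon>"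
      by (simp split: split_indicator)
  qed
  also have "\<dots> = (\<integral>\<^sup>+\<omega>. (\<integral>\<^sup>+x. ennreal \<bar>G x \<bullet> Y \<omega>\<bar> \<partial>lborel) * indicator (cball 0 1) (Y \<omega>) \<partial>M) + (\<integral>\<^sup>+\<omega>. ennreal \<epsilon> \<partial>M)"
    by (rule nn_integral_add) measurable
  also have "\<dots> = (\<integral>\<^sup>+x. ennreal (norm (G x)) \<partial>lborel) * (\<integral>\<^sup>+\<omega>. ennreal \<bar>b \<bullet> Y \<omega>\<bar> * indicator (cball 0 1) (Y \<omega>) \<partial>M) + ennreal \<epsilon>"
    using nn_integral_inner_G_isotropic[OF \<open>prob_space M\<close> Y iso b] by (simp add: M.emeasure_space_1)
  also have "\<dots> \<le> ennreal p * (\<integral>\<^sup>+\<omega>. ennreal \<bar>b \<bullet> Y \<omega>\<bar> * indicator (cball 0 1) (Y \<omega>) \<partial>M) + ennreal \<epsilon>"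
    by (intro add_right_mono mult_right_mono nn_integral_norm_G_le_perimeter[OF per]) simp
  finally show "(\<integral>\<^sup>+\<omega>. shift_diff S (Y \<omega>) * indicator (cball 0 1) (Y \<omega>) \<partial>M)
    \<le> ennreal p * (\<integral>\<^sup>+\<omega>. ennreal \<bar>b \<bullet> Y \<omega>\<bar> * indicator (cball 0 1) (Y \<omega>) \<partial>M) + ennreal \<epsilon>" .
qed

text \<open>A test field with value above \<open>c\<close> is fixed first; the mollifier is then
  taken fine enough that exchanging the indicator for its mollification costs less than the
  gap.\<close>

lemma mollified_gradient_near_perimeter:
  fixes S :: "'a::euclidean_space set"
  assumes op: "open S" and fin: "emeasure lborel S < \<infinity>" and c: "ereal c < perimeter S"
  obtains \<rho> g e L where "mollified_set \<rho> g e L S"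
    "ennreal c \<le> (\<integral>\<^sup>+x. ennreal (norm (mollified_set.G g S x)) \<partial>lborel)"
proof -
  obtain \<phi> where \<phi>: "\<phi> \<in> perimeter_fields" "c < (\<integral>x. indicator S x * divergence \<phi> x \<partial>lborel)"
    using c unfolding perimeter_def less_SUP_iff by auto
  let ?i = "\<integral>x. indicator S x * divergence \<phi> x \<partial>lborel"
  obtain B where B: "B \<ge> 0" "\<And>x. \<bar>divergence \<phi> x\<bar> \<le> B"
    using divergence_bounded(1)[OF \<phi>(1)] by blast
  \<comment> \<open>The \<open>+ 1\<close> keeps the quotient meaningful when \<open>B = 0\<close>
    and still gives \<open>B * \<eta> \<le> ?i - c\<close>.\<close>
  define \<eta> where "\<eta> = (?i - c) / (B + 1)"
  have \<eta>: "\<eta> > 0" "B * \<eta> \<le> ?i - c"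
    using \<phi>(2) B(1) by (auto simp: \<eta>_def field_simps)
  have "ennreal \<eta> > 0" using \<eta> by simp
  then obtain \<rho> g e L where ms: "mollified_set \<rho> g e L S"
    and ap: "(\<integral>\<^sup>+x. ennreal \<bar>mollified_set.f \<rho> S x - indicator S x\<bar> \<partial>lborel) \<le> ennreal \<eta>"
    using mollified_set_exists[OF op fin] by blast
  interpret mollified_set \<rho> g e L S by fact
  have "ennreal ?i \<le> (\<integral>\<^sup>+x. ennreal (norm (G x)) \<partial>lborel) + ennreal B * (\<integral>\<^sup>+x. ennreal \<bar>f x - u x\<bar> \<partial>lborel)"
    by (rule integral_divergence_le[OF \<phi>(1) B(2)])
  also have "\<dots> \<le> (\<integral>\<^sup>+x. ennreal (norm (G x)) \<partial>lborel) + ennreal B * ennreal \<eta>"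
    using ap by (intro add_left_mono mult_left_mono) auto
  also have "ennreal B * ennreal \<eta> \<le> ennreal (?i - c)"
    using \<eta> B(1) by (simp add: ennreal_mult[symmetric] ennreal_leI)
  finally have le: "ennreal ?i \<le> (\<integral>\<^sup>+x. ennreal (norm (G x)) \<partial>lborel) + ennreal (?i - c)"
    by (simp add: add_left_mono)
  have "ennreal c \<le> (\<integral>\<^sup>+x. ennreal (norm (G x)) \<partial>lborel)"
  proof (cases "c \<ge> 0")
    case True
    have "ennreal c + ennreal (?i - c) \<le> (\<integral>\<^sup>+x. ennreal (norm (G x)) \<partial>lborel) + ennreal (?i - c)"
      using le True \<phi>(2) by (simp flip: ennreal_plus)
    then show ?thesis by (simp add: ennreal_add_left_cancel_le add.commute)
  qed (simp add: ennreal_neg)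
  then show ?thesis using that ms by blast
qed

text \<open>The order of the quantifiers matters: \<open>K\<close> comes from a mollifier that
  depends on \<open>S\<close> and \<open>c\<close> alone, so the same \<open>K\<close> serves the
  laws of \<open>X t\<close> for all \<open>t\<close>.\<close>

lemma shift_diff_expectation_ge:
  fixes S :: "'a::euclidean_space set"
  assumes op: "open S" and fin: "emeasure lborel S < \<infinity>" and c: "ereal c < perimeter S"
  shows "\<exists>K\<ge>0. \<forall>(M :: 'w measure) Y b. prob_space M \<longrightarrow> Y \<in> borel_measurable M \<longrightarrow>
    (\<forall>T. orthogonal_transformation T \<longrightarrow> distr M borel (\<lambda>\<omega>. T (Y \<omega>)) = distr M borel Y) \<longrightarrow> norm b = 1 \<longrightarrow>
    ennreal c * (\<integral>\<^sup>+\<omega>. ennreal \<bar>b \<bullet> Y \<omega>\<bar> * indicator (cball 0 1) (Y \<omega>) \<partial>M)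
     \<le> (\<integral>\<^sup>+\<omega>. shift_diff S (Y \<omega>) * indicator (cball 0 1) (Y \<omega>) \<partial>M)
       + ennreal K * (\<integral>\<^sup>+\<omega>. ennreal (min 1 ((norm (Y \<omega>))\<^sup>2)) \<partial>M)"
proof -
  obtain \<rho> g e L where ms: "mollified_set \<rho> g e L S"
    and cG: "ennreal c \<le> (\<integral>\<^sup>+x. ennreal (norm (mollified_set.G g S x)) \<partial>lborel)"
    using mollified_gradient_near_perimeter[OF assms] by blast
  interpret mollified_set \<rho> g e L S by fact
  have [measurable]: "cball (0::'a) 1 \<in> sets borel" by simp
  obtain K where K: "K \<ge> 0"
    "\<And>y. norm y \<le> 1 \<Longrightarrow> (\<integral>\<^sup>+x. ennreal \<bar>G x \<bullet> y\<bar> \<partial>lborel) \<le> shift_diff S y + ennreal (K * (norm y)\<^sup>2)"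
    using grad_le_shift_diff by blast
  show ?thesis
  proof (intro exI[of _ K] conjI K(1) allI impI)
    fix M :: "'w measure" and Y :: "'w \<Rightarrow> 'a" and b :: 'a
    assume M: "prob_space M" and Y[measurable]: "Y \<in> borel_measurable M"
      and iso: "\<forall>T. orthogonal_transformation T \<longrightarrow> distr M borel (\<lambda>\<omega>. T (Y \<omega>)) = distr M borel Y"
      and b: "norm b = 1"
    have "ennreal c * (\<integral>\<^sup>+\<omega>. ennreal \<bar>b \<bullet> Y \<omega>\<bar> * indicator (cball 0 1) (Y \<omega>) \<partial>M)
       \<le> (\<integral>\<^sup>+x. ennreal (norm (G x)) \<partial>lborel) * (\<integral>\<^sup>+\<omega>. ennreal \<bar>b \<bullet> Y \<omega>\<bar> * indicator (cball 0 1) (Y \<omega>) \<partial>M)"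
      using cG by (rule mult_right_mono) simp
    also have "\<dots> = (\<integral>\<^sup>+\<omega>. (\<integral>\<^sup>+x. ennreal \<bar>G x \<bullet> Y \<omega>\<bar> \<partial>lborel) * indicator (cball 0 1) (Y \<omega>) \<partial>M)"
      using iso by (intro nn_integral_inner_G_isotropic[symmetric] M Y b) auto
    also have "\<dots> \<le> (\<integral>\<^sup>+\<omega>. shift_diff S (Y \<omega>) * indicator (cball 0 1) (Y \<omega>) + ennreal K * ennreal (min 1 ((norm (Y \<omega>))\<^sup>2)) \<partial>M)"
    proof (rule nn_integral_mono)
      fix \<omega>
      show "(\<integral>\<^sup>+x. ennreal \<bar>G x \<bullet> Y \<omega>\<bar> \<partial>lborel) * indicator (cball 0 1) (Y \<omega>) \<le>
        shift_diff S (Y \<omega>) * indicator (cball 0 1) (Y \<omega>) + ennreal K * ennreal (min 1 ((norm (Y \<omega>))\<^sup>2))"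
      proof (cases "norm (Y \<omega>) \<le> 1")
        case True
        then have "(norm (Y \<omega>))\<^sup>2 \<le> 1" by (simp add: abs_square_le_1)
        then show ?thesis using True K(2)[OF True] K(1) by (simp add: min_def ennreal_mult)
      qed simp
    qed
    also have "\<dots> = (\<integral>\<^sup>+\<omega>. shift_diff S (Y \<omega>) * indicator (cball 0 1) (Y \<omega>) \<partial>M)
       + (\<integral>\<^sup>+\<omega>. ennreal K * ennreal (min 1 ((norm (Y \<omega>))\<^sup>2)) \<partial>M)"
      by (rule nn_integral_add) measurable
    also have "(\<integral>\<^sup>+\<omega>. ennreal K * ennreal (min 1 ((norm (Y \<omega>))\<^sup>2)) \<partial>M) = ennreal K * (\<integral>\<^sup>+\<omega>. ennreal (min 1 ((norm (Y \<omega>))\<^sup>2)) \<partial>M)"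
      by (rule nn_integral_cmult) measurable
    finally show "ennreal c * (\<integral>\<^sup>+\<omega>. ennreal \<bar>b \<bullet> Y \<omega>\<bar> * indicator (cball 0 1) (Y \<omega>) \<partial>M)
     \<le> (\<integral>\<^sup>+\<omega>. shift_diff S (Y \<omega>) * indicator (cball 0 1) (Y \<omega>) \<partial>M)
       + ennreal K * (\<integral>\<^sup>+\<omega>. ennreal (min 1 ((norm (Y \<omega>))\<^sup>2)) \<partial>M)" .
  qed
qed

section \<open>First moments through characteristic functions\<close>

context prob_space
begin

text \<open>Inside the unit ball the truncated kernel differs from
  \<open>pi / 2 * \<bar>b \<bullet> Y \<omega>\<bar>\<close> by a quadratic term. Outside it is at
  most \<open>2 / r0\<close>, and there the truncated square equals 1. The last bound provides
  finiteness of \<open>W\<close>.\<close>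

lemma truncated_moment_cosine_bounds:
  fixes Y :: "'a \<Rightarrow> 'b::euclidean_space"
  assumes [measurable]: "random_variable borel Y" and b: "norm b = 1" and "r0 > 0"
  defines "m \<equiv> \<integral>\<^sup>+\<omega>. ennreal \<bar>b \<bullet> Y \<omega>\<bar> * indicator (cball 0 1) (Y \<omega>) \<partial>M"
    and "Q \<equiv> \<integral>\<^sup>+\<omega>. ennreal (min 1 ((norm (Y \<omega>))\<^sup>2)) \<partial>M"
    and "W \<equiv> \<integral>\<^sup>+\<omega>. (\<integral>\<^sup>+r. ennreal (1 - cos (r * (b \<bullet> Y \<omega>))) * (ennreal (1 / r\<^sup>2) * indicator {r0..} r) \<partial>lborel) \<partial>M"
  shows "W \<le> ennreal (pi / 2) * m + ennreal (2 / r0) * Q"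
    "ennreal (pi / 2) * m \<le> W + ennreal (r0 / 2) * Q"
    "W \<le> ennreal (2 / r0)"
proof -
  have [measurable]: "cball (0::'b) 1 \<in> sets borel" by simp
  let ?w = "\<lambda>z. \<integral>\<^sup>+r. ennreal (1 - cos (r * z)) * (ennreal (1 / r\<^sup>2) * indicator {r0..} r) \<partial>lborel"
  note w = truncated_cosine_kernel_bounds[OF \<open>r0 > 0\<close>]
  have [measurable]: "?w \<in> borel_measurable borel" by measurable
  have "W \<le> (\<integral>\<^sup>+\<omega>. ennreal (pi / 2) * (ennreal \<bar>b \<bullet> Y \<omega>\<bar> * indicator (cball 0 1) (Y \<omega>))
      + ennreal (2 / r0) * ennreal (min 1 ((norm (Y \<omega>))\<^sup>2)) \<partial>M)"
    unfolding W_def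
  proof (rule nn_integral_mono)
    fix \<omega>
    show "?w (b \<bullet> Y \<omega>) \<le> ennreal (pi / 2) * (ennreal \<bar>b \<bullet> Y \<omega>\<bar> * indicator (cball 0 1) (Y \<omega>))
      + ennreal (2 / r0) * ennreal (min 1 ((norm (Y \<omega>))\<^sup>2))"
    proof (cases "norm (Y \<omega>) \<le> 1")
      case True
      then have "ennreal (pi / 2 * \<bar>b \<bullet> Y \<omega>\<bar>) = ennreal (pi / 2) * (ennreal \<bar>b \<bullet> Y \<omega>\<bar> * indicator (cball 0 1) (Y \<omega>))"
        by (subst ennreal_mult) auto
      then show ?thesis using w(2)[of "b \<bullet> Y \<omega>"] by (simp only: add_increasing2 zero_le)
    next
      case False
      then have "1 \<le> (norm (Y \<omega>))\<^sup>2" by (simp add: one_le_power)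
      then show ?thesis using w(1)[of "b \<bullet> Y \<omega>"] by (simp add: min_def add_increasing)
    qed
  qed
  also have "\<dots> = ennreal (pi / 2) * m + ennreal (2 / r0) * Q"
    unfolding m_def Q_def by (subst nn_integral_add) (auto simp: nn_integral_cmult)
  finally show "W \<le> ennreal (pi / 2) * m + ennreal (2 / r0) * Q" .
  have "ennreal (pi / 2) * m = (\<integral>\<^sup>+\<omega>. ennreal (pi / 2) * (ennreal \<bar>b \<bullet> Y \<omega>\<bar> * indicator (cball 0 1) (Y \<omega>)) \<partial>M)"
    unfolding m_def by (rule nn_integral_cmult[symmetric]) measurable
  also have "\<dots> \<le> (\<integral>\<^sup>+\<omega>. ?w (b \<bullet> Y \<omega>) + ennreal (r0 / 2) * ennreal (min 1 ((norm (Y \<omega>))\<^sup>2)) \<partial>M)"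
  proof (rule nn_integral_mono)
    fix \<omega>
    show "ennreal (pi / 2) * (ennreal \<bar>b \<bullet> Y \<omega>\<bar> * indicator (cball 0 1) (Y \<omega>))
      \<le> ?w (b \<bullet> Y \<omega>) + ennreal (r0 / 2) * ennreal (min 1 ((norm (Y \<omega>))\<^sup>2))"
    proof (cases "norm (Y \<omega>) \<le> 1")
      case True
      then have "(norm (Y \<omega>))\<^sup>2 \<le> 1" by (simp add: abs_square_le_1)
      then have min: "min 1 ((norm (Y \<omega>))\<^sup>2) = (norm (Y \<omega>))\<^sup>2" by simp
      have "\<bar>b \<bullet> Y \<omega>\<bar> \<le> \<bar>norm (Y \<omega>)\<bar>" using Cauchy_Schwarz_ineq2[of b "Y \<omega>"] b by simp
      then have "(b \<bullet> Y \<omega>)\<^sup>2 \<le> (norm (Y \<omega>))\<^sup>2" by (simp only: abs_le_square_iff)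
      then have le: "ennreal (r0 / 2 * (b \<bullet> Y \<omega>)\<^sup>2) \<le> ennreal (r0 / 2) * ennreal (min 1 ((norm (Y \<omega>))\<^sup>2))"
        using \<open>r0 > 0\<close> unfolding min by (subst ennreal_mult[symmetric]) (auto intro!: ennreal_leI mult_left_mono)
      have "ennreal (pi / 2) * (ennreal \<bar>b \<bullet> Y \<omega>\<bar> * indicator (cball 0 1) (Y \<omega>)) = ennreal (pi / 2 * \<bar>b \<bullet> Y \<omega>\<bar>)"
        using True by (subst ennreal_mult) auto
      also have "\<dots> \<le> ?w (b \<bullet> Y \<omega>) + ennreal (r0 / 2 * (b \<bullet> Y \<omega>)\<^sup>2)" by (rule w(3))
      also have "\<dots> \<le> ?w (b \<bullet> Y \<omega>) + ennreal (r0 / 2) * ennreal (min 1 ((norm (Y \<omega>))\<^sup>2))"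
        by (rule add_left_mono[OF le])
      finally show ?thesis .
    qed simp
  qed
  also have "\<dots> = W + ennreal (r0 / 2) * Q"
    unfolding W_def Q_def by (subst nn_integral_add) (auto simp: nn_integral_cmult)
  finally show "ennreal (pi / 2) * m \<le> W + ennreal (r0 / 2) * Q" .
  have "W \<le> (\<integral>\<^sup>+\<omega>. ennreal (2 / r0) \<partial>M)" unfolding W_def by (intro nn_integral_mono w(1))
  then show "W \<le> ennreal (2 / r0)" by (simp add: emeasure_space_1)
qed

text \<open>The truncated square of the norm is at most the sum of those of the coordinates: if some
  coordinate is truncated the sum is at least 1, and otherwise Pythagoras applies.\<close>

lemma nn_integral_min_one_norm_sq_le:
  fixes Y :: "'a \<Rightarrow> 'b::euclidean_space"
  assumes [measurable]: "random_variable borel Y"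
    and cf: "\<And>b r. b \<in> Basis \<Longrightarrow> 0 \<le> r \<Longrightarrow> expectation (\<lambda>\<omega>. cos (r * (b \<bullet> Y \<omega>))) = exp (- (t * \<psi> r))"
    and B: "\<And>r. r \<in> {0..1} \<Longrightarrow> \<psi> r \<le> B" "0 \<le> B" and "t \<ge> 0"
  shows "(\<integral>\<^sup>+\<omega>. ennreal (min 1 ((norm (Y \<omega>))\<^sup>2)) \<partial>M) \<le> ennreal (real DIM('b) * (8 * B) * t)"
proof -
  have "(\<integral>\<^sup>+\<omega>. ennreal (min 1 ((norm (Y \<omega>))\<^sup>2)) \<partial>M) \<le> (\<integral>\<^sup>+\<omega>. (\<Sum>b\<in>Basis. ennreal (min 1 ((b \<bullet> Y \<omega>)\<^sup>2))) \<partial>M)"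
  proof (rule nn_integral_mono)
    fix \<omega>
    have "min 1 ((norm (Y \<omega>))\<^sup>2) \<le> (\<Sum>b\<in>Basis. min 1 ((b \<bullet> Y \<omega>)\<^sup>2))"
    proof (cases "\<exists>b\<in>Basis. 1 \<le> (b \<bullet> Y \<omega>)\<^sup>2")
      case True
      then obtain b where b: "b \<in> Basis" "1 \<le> (b \<bullet> Y \<omega>)\<^sup>2" by blast
      then have "1 \<le> min 1 ((b \<bullet> Y \<omega>)\<^sup>2)" by simp
      also have "\<dots> \<le> (\<Sum>b\<in>Basis. min 1 ((b \<bullet> Y \<omega>)\<^sup>2))"
        using b by (intro member_le_sum) auto
      finally show ?thesis by simp
    next
      case False
      have "(norm (Y \<omega>))\<^sup>2 = (\<Sum>b\<in>Basis. (b \<bullet> Y \<omega>)\<^sup>2)"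
        unfolding power2_norm_eq_inner by (subst euclidean_inner) (simp add: power2_eq_square inner_commute)
      also have "\<dots> = (\<Sum>b\<in>Basis. min 1 ((b \<bullet> Y \<omega>)\<^sup>2))"
        using False by (intro sum.cong) auto
      finally show ?thesis by simp
    qed
    then show "ennreal (min 1 ((norm (Y \<omega>))\<^sup>2)) \<le> (\<Sum>b\<in>Basis. ennreal (min 1 ((b \<bullet> Y \<omega>)\<^sup>2)))"
      by (subst sum_ennreal) (auto intro: ennreal_leI)
  qed
  also have "\<dots> = (\<Sum>b\<in>Basis. \<integral>\<^sup>+\<omega>. ennreal (min 1 ((b \<bullet> Y \<omega>)\<^sup>2)) \<partial>M)"
    by (rule nn_integral_sum) measurable
  also have "\<dots> \<le> (\<Sum>b\<in>(Basis :: 'b set). ennreal (8 * B * t))"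
    using cf B(1) \<open>t \<ge> 0\<close> by (intro sum_mono nn_integral_min_one_sq_le) auto
  also have "\<dots> = ennreal (real DIM('b) * (8 * B) * t)"
    using B(2) \<open>t \<ge> 0\<close> by (simp add: ennreal_of_nat_eq_real_of_nat ennreal_mult[symmetric] mult_ac)
  finally show ?thesis .
qed

lemma continuous_expectation_cos:
  fixes Z :: "'a \<Rightarrow> real"
  assumes [measurable]: "random_variable borel Z"
  shows "continuous_on UNIV (\<lambda>r. expectation (\<lambda>\<omega>. cos (r * Z \<omega>)))"
proof (rule continuous_at_imp_continuous_on, rule ballI, rule continuous_at_sequentiallyI)
  fix r :: real and s :: "nat \<Rightarrow> real"
  assume s: "s \<longlonglongrightarrow> r"
  show "(\<lambda>n. expectation (\<lambda>\<omega>. cos (s n * Z \<omega>))) \<longlonglongrightarrow> expectation (\<lambda>\<omega>. cos (r * Z \<omega>))"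
    by (rule integral_dominated_convergence[where w="\<lambda>_. 1"]) (auto intro!: tendsto_intros s AE_I2)
qed

end

lemma Re_characteristic_exponent:
  fixes M :: "'w measure" and X :: "real \<Rightarrow> 'w \<Rightarrow> 'a::euclidean_space"
  assumes "prob_space M" and [measurable]: "X t \<in> borel_measurable M"
    and ce: "characteristic_exponent M X (\<lambda>\<xi>. complex_of_real (\<psi> (norm \<xi>)))"
    and "t \<ge> 0" "r \<ge> 0" and b: "norm b = 1"
  shows "(\<integral>\<omega>. cos (r * (b \<bullet> X t \<omega>)) \<partial>M) = exp (- (t * \<psi> r))"
proof -
  interpret prob_space M by fact
  have int: "integrable M (\<lambda>\<omega>. iexp (X t \<omega> \<bullet> (r *\<^sub>R b)))"
    by (rule integrable_const_bound[where B=1]) auto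
  have "(CLINT \<omega>|M. iexp (X t \<omega> \<bullet> (r *\<^sub>R b))) = exp (- (complex_of_real t * complex_of_real (\<psi> (norm (r *\<^sub>R b)))))"
    using ce \<open>t \<ge> 0\<close> unfolding characteristic_exponent_def by blast
  also have "\<dots> = complex_of_real (exp (- (t * \<psi> r)))"
    using b \<open>r \<ge> 0\<close> by (simp flip: exp_of_real)
  finally have "Re (CLINT \<omega>|M. iexp (X t \<omega> \<bullet> (r *\<^sub>R b))) = exp (- (t * \<psi> r))" by simp
  moreover have "Re (CLINT \<omega>|M. iexp (X t \<omega> \<bullet> (r *\<^sub>R b))) = (\<integral>\<omega>. Re (iexp (X t \<omega> \<bullet> (r *\<^sub>R b))) \<partial>M)"
    by (rule integral_bounded_linear[OF bounded_linear_Re int, symmetric])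
  ultimately show ?thesis by (simp add: Re_exp inner_commute)
qed

section \<open>Small-time limit of the heat loss\<close>

theorem theorem2:
  fixes \<Omega> :: "'a::euclidean_space set"
    and M :: "'w measure"
    and X :: "real \<Rightarrow> 'w \<Rightarrow> 'a"
    and \<psi> :: "real \<Rightarrow> real"
    and \<alpha> :: real
  assumes "open \<Omega>"
    and "emeasure lborel \<Omega> < \<infinity>"
    and "perimeter \<Omega> < \<infinity>"
    and "levy_process M X"
    and "isotropic M X"
    and "characteristic_exponent M X (\<lambda>\<xi>. complex_of_real (\<psi> (norm \<xi>)))"
    and "1 < \<alpha>" and "\<alpha> \<le> 2"
    and "regularly_varying \<psi> \<alpha>"
  shows "((\<lambda>t. generalized_inverse \<psi> (1 / t) * heat_loss M X \<Omega> t)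
           \<longlongrightarrow> inverse pi * Gamma (1 - 1 / \<alpha>) * real_of_ereal (perimeter \<Omega>)) (at_right 0)"
proof -
  interpret levy_process M X by fact
  have prob: "prob_space M" by unfold_locales
  note ce = assms(6) and rv = assms(9)
  have \<Omega>[measurable]: "\<Omega> \<in> sets borel" using assms(1) by simp
  have [measurable]: "cball (0::'a) 1 \<in> sets borel" by simp
  have Xm[measurable]: "X t \<in> borel_measurable M" if "t \<ge> 0" for t by (rule random_variable[OF that])
  have iso: "distr M borel (\<lambda>\<omega>. T (X t \<omega>)) = distr M borel (X t)" if "t > 0" "orthogonal_transformation T" for t T
    using assms(5) that unfolding isotropic_def by blast
  obtain b :: 'a where b: "b \<in> Basis" using nonempty_Basis by blast
  then have nb: "norm b = 1" by simp
  have cf: "expectation (\<lambda>\<omega>. cos (r * (c \<bullet> X t \<omega>))) = exp (- (t * \<psi> r))" if "t \<ge> 0" "r \<ge> 0" "norm c = 1" for t r c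
    using Re_characteristic_exponent[OF prob Xm ce] that by blast

  have zero: "\<psi> 0 = 0" using cf[of 1 0 b] nb by (simp add: prob_space)
  have nonneg: "\<psi> r \<ge> 0" if "r \<ge> 0" for r
  proof -
    have "expectation (\<lambda>\<omega>. cos (r * (b \<bullet> X 1 \<omega>))) \<le> expectation (\<lambda>\<omega>. 1)"
      by (intro integral_mono integrable_const_bound[where B=1]) (auto simp: Xm)
    then show ?thesis using cf[of 1 r b] that nb by (simp add: prob_space)
  qed
  \<comment> \<open>At time 1 the characteristic function along \<open>b\<close> is continuous by
    dominated convergence and positive because it is an exponential, so its logarithm recovers
    \<psi> continuously.\<close>
  have cont: "continuous_on {0..} \<psi>"
  proof -
    have "continuous_on {0..} (\<lambda>r. - ln (expectation (\<lambda>\<omega>. cos (r * (b \<bullet> X 1 \<omega>)))))"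
      using cf[of 1 _ b] nb
      by (intro continuous_intros continuous_on_subset[OF continuous_expectation_cos]) (auto simp: Xm)
    moreover have "- ln (expectation (\<lambda>\<omega>. cos (r * (b \<bullet> X 1 \<omega>)))) = \<psi> r" if "r \<in> {0..}" for r
      using cf[of 1 r b] nb that by simp
    ultimately show ?thesis by (rule continuous_on_eq)
  qed
  obtain B where B: "B \<ge> 0" "\<And>r. r \<in> {0..1} \<Longrightarrow> \<psi> r \<le> B"
  proof -
    have "compact (\<psi> ` {0..1})"
      by (intro compact_continuous_image continuous_on_subset[OF cont]) auto
    then obtain B where "\<And>r. r \<in> {0..1} \<Longrightarrow> \<psi> r \<le> B"
      by (meson bounded_imp_bdd_above bdd_above.unfold compact_imp_bounded imageI)
    then show ?thesis using that[of "max 0 B"] by (simp add: le_max_iff_disj)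
  qed
  define K0 where "K0 = real DIM('a) * (8 * B)"
  have K0: "K0 \<ge> 0" using B(1) by (simp add: K0_def)

  define R where "R t = generalized_inverse \<psi> (1 / t)" for t
  have superlinear: "filterlim (\<lambda>r. \<psi> r / r) at_top at_top"
    by (rule regularly_varying_superlinear[OF rv cont assms(7)])
  have \<psi>_top: "filterlim \<psi> at_top at_top"
  proof (rule filterlim_at_top_mono[OF superlinear])
    show "\<forall>\<^sub>F r in at_top. \<psi> r / r \<le> \<psi> r"
      using eventually_ge_at_top[of 1]
    proof eventually_elim
      case (elim r)
      then show ?case using nonneg[of r] mult_right_mono[of 1 r "\<psi> r"] by (simp add: field_simps)
    qed
  qed
  have R: "R t > 0" "\<psi> (R t) = 1 / t" if "t > 0" for t
    using generalized_inverse_attained[OF cont zero \<psi>_top, of "1 / t"] that by (auto simp: R_def)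
  have R_top: "filterlim R at_top (at_right 0)"
  proof -
    have "filterlim (\<lambda>t::real. 1 / t) at_top (at_right 0)" by real_asymp
    then show ?thesis unfolding R_def
      by (rule filterlim_compose[OF generalized_inverse_at_top[OF cont zero \<psi>_top]])
  qed
  \<comment> \<open>As \<open>\<psi> (R t) = 1 / t\<close>, the product \<open>R t * t\<close> is
    the reciprocal of \<open>\<psi> (R t) / R t\<close>, so superlinearity applies. This disposes of
    all terms of order \<open>t\<close> at once.\<close>
  have Rt: "((\<lambda>t. R t * t) \<longlongrightarrow> 0) (at_right 0)"
  proof -
    have "filterlim (\<lambda>t. \<psi> (R t) / R t) at_top (at_right 0)"
      by (rule filterlim_compose[OF superlinear R_top])
    then have "((\<lambda>t. inverse (\<psi> (R t) / R t)) \<longlongrightarrow> 0) (at_right 0)"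
      by (rule filterlim_compose[OF tendsto_inverse_0_at_top, rotated]) (rule filterlim_ident)
    moreover have "\<forall>\<^sub>F t in at_right 0. inverse (\<psi> (R t) / R t) = R t * t"
      using eventually_at_right_less[of 0] by eventually_elim (simp add: R)
    ultimately show ?thesis by (rule Lim_transform_eventually)
  qed

  define W where "W r0 t = (\<integral>\<^sup>+r. ennreal (1 - exp (- (t * \<psi> r))) * (ennreal (1 / r\<^sup>2) * indicator {r0..} r) \<partial>lborel)" for r0 t
  obtain r0 where r0: "r0 > 0" and limW: "((\<lambda>t. ennreal (R t) * W r0 t) \<longlongrightarrow> ennreal (Gamma (1 - 1 / \<alpha>))) (at_right 0)"
    using scaled_exponent_integral_limit[OF rv cont assms(7) zero nonneg] unfolding R_def W_def by blast
  define m where "m t = (\<integral>\<^sup>+\<omega>. ennreal \<bar>b \<bullet> X t \<omega>\<bar> * indicator (cball 0 1) (X t \<omega>) \<partial>M)" for t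
  define Q where "Q t = (\<integral>\<^sup>+\<omega>. ennreal (min 1 ((norm (X t \<omega>))\<^sup>2)) \<partial>M)" for t
  define DA where "DA t = (\<integral>\<^sup>+\<omega>. shift_diff \<Omega> (X t \<omega>) * indicator (cball 0 1) (X t \<omega>) \<partial>M)" for t
  have Q: "Q t \<le> ennreal (K0 * t)" if "t > 0" for t
    unfolding Q_def K0_def using that
    by (intro nn_integral_min_one_norm_sq_le[OF Xm cf B(2,1)]) auto
  have kernel: "W r0 t = (\<integral>\<^sup>+\<omega>. (\<integral>\<^sup>+r. ennreal (1 - cos (r * (b \<bullet> X t \<omega>))) * (ennreal (1 / r\<^sup>2) * indicator {r0..} r) \<partial>lborel) \<partial>M)" if "t > 0" for t
    unfolding W_def using that r0
    by (intro nn_integral_one_minus_cos_exponent[symmetric] cf nb) (auto simp: Xm)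
  define w where "w t = enn2real (W r0 t)" for t
  define m' where "m' t = enn2real (m t)" for t
  have m_fin: "m t = ennreal (m' t)" if "t > 0" for t
  proof -
    have "m t \<le> (\<integral>\<^sup>+\<omega>. 1 \<partial>M)" unfolding m_def
    proof (rule nn_integral_mono)
      fix \<omega>
      have "\<bar>b \<bullet> X t \<omega>\<bar> \<le> norm (X t \<omega>)" using Cauchy_Schwarz_ineq2[of b "X t \<omega>"] nb by simp
      then show "ennreal \<bar>b \<bullet> X t \<omega>\<bar> * indicator (cball 0 1) (X t \<omega>) \<le> 1"
        by (auto split: split_indicator)
    qed
    also have "\<dots> = 1" by (simp add: emeasure_space_1)
    finally have "m t < top" by (rule le_less_trans) simp
    then show ?thesis by (simp add: m'_def)
  qed
  note bounds = truncated_moment_cosine_bounds[OF Xm nb r0, folded m_def Q_def]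
  have w_fin: "W r0 t = ennreal (w t)" if "t > 0" for t
  proof -
    have "W r0 t \<le> ennreal (2 / r0)" using bounds(3)[of t] kernel[OF that] that by simp
    then have "W r0 t < top" by (rule le_less_trans) simp
    then show ?thesis by (simp add: w_def)
  qed
  have nn: "w t \<ge> 0" "m' t \<ge> 0" for t by (simp_all add: w_def m'_def)
  have limw: "((\<lambda>t. R t * w t) \<longlongrightarrow> Gamma (1 - 1 / \<alpha>)) (at_right 0)"
  proof (rule tendsto_ennrealD)
    have "\<forall>\<^sub>F t in at_right 0. ennreal (R t) * W r0 t = ennreal (R t * w t)"
      using eventually_at_right_less[of 0]
      by eventually_elim (use R nn in \<open>simp add: w_fin ennreal_mult less_imp_le\<close>)
    then show "((\<lambda>t. ennreal (R t * w t)) \<longlongrightarrow> ennreal (Gamma (1 - 1 / \<alpha>))) (at_right 0)"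
      by (rule Lim_transform_eventually[OF limW])
    show "\<forall>\<^sub>F t in at_right 0. 0 \<le> R t * w t"
      using eventually_at_right_less[of 0] by eventually_elim (use R nn in \<open>simp add: less_imp_le\<close>)
    show "0 \<le> Gamma (1 - 1 / \<alpha>)" using assms(7) by (intro less_imp_le Gamma_real_pos) simp
  qed
  \<comment> \<open>Both cut-offs together shift the first moment by a multiple of
    \<open>Q t\<close>, hence by O(t), and the moment inherits the asymptotics of
    \<open>w t\<close>.\<close>
  have m_lower: "w t \<le> pi / 2 * m' t + 2 / r0 * (K0 * t)"
    and m_upper: "pi / 2 * m' t \<le> w t + r0 / 2 * (K0 * t)" if "t > 0" for t
  proof -
    have "ennreal (w t) \<le> ennreal (pi / 2) * m t + ennreal (2 / r0) * Q t"
      using bounds(1)[of t] kernel[OF that] w_fin[OF that] that by simp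
    also have "\<dots> \<le> ennreal (pi / 2) * ennreal (m' t) + ennreal (2 / r0) * ennreal (K0 * t)"
      unfolding m_fin[OF that] by (intro add_left_mono mult_left_mono Q that) simp
    also have "\<dots> = ennreal (pi / 2 * m' t + 2 / r0 * (K0 * t))"
      using nn r0 K0 that by (simp add: ennreal_mult[symmetric] flip: ennreal_plus)
    finally show "w t \<le> pi / 2 * m' t + 2 / r0 * (K0 * t)"
      using nn r0 K0 that by (subst (asm) ennreal_le_iff) auto
    have "ennreal (pi / 2 * m' t) = ennreal (pi / 2) * m t"
      unfolding m_fin[OF that] using nn by (intro ennreal_mult) auto
    also have "\<dots> \<le> ennreal (w t) + ennreal (r0 / 2) * Q t"
      using bounds(2)[of t] kernel[OF that] w_fin[OF that] that by simp
    also have "\<dots> \<le> ennreal (w t) + ennreal (r0 / 2) * ennreal (K0 * t)"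
      by (intro add_left_mono mult_left_mono Q that) simp
    also have "\<dots> = ennreal (w t + r0 / 2 * (K0 * t))"
      using nn r0 K0 that by (simp add: ennreal_mult[symmetric] flip: ennreal_plus)
    finally show "pi / 2 * m' t \<le> w t + r0 / 2 * (K0 * t)"
      using nn r0 K0 that by (subst (asm) ennreal_le_iff) auto
  qed

  define p where "p = real_of_ereal (perimeter \<Omega>)"
  \<comment> \<open>Together with \<open>perimeter \<Omega> < \<infinity>\<close> this excludes both
    infinite values, so that \<open>p\<close> faithfully represents the perimeter.\<close>
  have per0: "perimeter \<Omega> \<ge> 0"
  proof -
    obtain \<rho> g e L where "mollified_set \<rho> g e L \<Omega>"
      using mollified_set_exists[OF assms(1,2), of 1] by (metis zero_less_one)
    then interpret mollified_set \<rho> g e L \<Omega> .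
    have "0 \<le> ereal (\<integral>x. indicator (cball 0 1) x * norm (G x) \<partial>lborel)" by simp
    also have "\<dots> \<le> perimeter \<Omega>" by (rule integral_norm_G_cball_le_perimeter)
    finally show ?thesis .
  qed
  have per: "perimeter \<Omega> = ereal p"
    using assms(3) per0 unfolding p_def by (cases "perimeter \<Omega>") auto
  have p0: "p \<ge> 0" using per0 unfolding per by simp
  define V where "V = measure lborel \<Omega>"
  have V: "emeasure lborel \<Omega> = ennreal V" "V \<ge> 0"
    using assms(2) by (auto simp: V_def emeasure_eq_ennreal_measure)
  let ?H = "heat_loss M X \<Omega>"
  have H: "ennreal (2 * ?H t) = (\<integral>\<^sup>+\<omega>. shift_diff \<Omega> (X t \<omega>) \<partial>M)" "0 \<le> ?H t" if "t > 0" for t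
    using heat_loss_eq_shift_diff[where M=M and X=X and t=t, OF prob Xm \<Omega> assms(2)] that by auto

  \<comment> \<open>Displacements longer than 1 contribute at most \<open>2 * V\<close> each, and on
    that event the truncated square in \<open>Q t\<close> is 1.\<close>
  have upper: "2 * ?H t \<le> p * m' t + 2 * V * (K0 * t)" if "t > 0" for t
  proof -
    have [measurable]: "X t \<in> borel_measurable M" using that by (intro Xm) simp
    have "ennreal (2 * ?H t) \<le> (\<integral>\<^sup>+\<omega>. shift_diff \<Omega> (X t \<omega>) * indicator (cball 0 1) (X t \<omega>)
        + ennreal (2 * V) * ennreal (min 1 ((norm (X t \<omega>))\<^sup>2)) \<partial>M)"
      unfolding H(1)[OF that]
    proof (rule nn_integral_mono)
      fix \<omega>
      show "shift_diff \<Omega> (X t \<omega>) \<le> shift_diff \<Omega> (X t \<omega>) * indicator (cball 0 1) (X t \<omega>)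
        + ennreal (2 * V) * ennreal (min 1 ((norm (X t \<omega>))\<^sup>2))"
      proof (cases "norm (X t \<omega>) \<le> 1")
        case False
        then have "1 \<le> (norm (X t \<omega>))\<^sup>2" by (simp add: one_le_power)
        then have "min 1 ((norm (X t \<omega>))\<^sup>2) = 1" by simp
        then show ?thesis
          using shift_diff_le_measure[OF \<Omega> assms(2), of "X t \<omega>"] V False by (simp add: ennreal_mult)
      qed simp
    qed
    also have "\<dots> = DA t + ennreal (2 * V) * Q t"
      unfolding DA_def Q_def by (subst nn_integral_add) (auto simp: nn_integral_cmult)
    also have "\<dots> \<le> ennreal p * m t + ennreal (2 * V) * ennreal (K0 * t)"
      unfolding DA_def m_def using that
      by (intro add_mono mult_left_mono Q shift_diff_expectation_le[OF assms(1,2) per prob _ _ nb] iso) auto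
    also have "\<dots> = ennreal (p * m' t + 2 * V * (K0 * t))"
      using nn V K0 that p0 by (simp add: m_fin ennreal_mult[symmetric] flip: ennreal_plus)
    finally show ?thesis
      using nn V K0 that p0 by (subst (asm) ennreal_le_iff) auto
  qed
  have lower: "\<exists>K\<ge>0. \<forall>t>0. c * m' t \<le> 2 * ?H t + K * (K0 * t)" if c: "0 \<le> c" "c < p" for c
  proof -
    have "ereal c < perimeter \<Omega>" using c by (simp add: per)
    from shift_diff_expectation_ge[OF assms(1,2) this, where 'w='w]
    obtain K where K: "K \<ge> 0" and *: "\<And>(M :: 'w measure) Y b. prob_space M \<Longrightarrow> Y \<in> borel_measurable M \<Longrightarrow>
      (\<forall>T. orthogonal_transformation T \<longrightarrow> distr M borel (\<lambda>\<omega>. T (Y \<omega>)) = distr M borel Y) \<Longrightarrow> norm b = 1 \<Longrightarrow>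
      ennreal c * (\<integral>\<^sup>+\<omega>. ennreal \<bar>b \<bullet> Y \<omega>\<bar> * indicator (cball 0 1) (Y \<omega>) \<partial>M)
       \<le> (\<integral>\<^sup>+\<omega>. shift_diff \<Omega> (Y \<omega>) * indicator (cball 0 1) (Y \<omega>) \<partial>M)
         + ennreal K * (\<integral>\<^sup>+\<omega>. ennreal (min 1 ((norm (Y \<omega>))\<^sup>2)) \<partial>M)" by blast
    have "c * m' t \<le> 2 * ?H t + K * (K0 * t)" if t: "t > 0" for t
    proof -
      have "ennreal (c * m' t) = ennreal c * m t" using c nn t by (simp add: m_fin ennreal_mult)
      also have "\<dots> \<le> DA t + ennreal K * Q t"
        unfolding DA_def m_def Q_def using t iso by (intro * prob Xm nb) auto
      also have "\<dots> \<le> ennreal (2 * ?H t) + ennreal K * ennreal (K0 * t)"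
      proof (intro add_mono mult_left_mono Q t)
        show "DA t \<le> ennreal (2 * ?H t)" unfolding DA_def H(1)[OF t]
          by (intro nn_integral_mono) (auto split: split_indicator)
      qed simp
      also have "\<dots> = ennreal (2 * ?H t + K * (K0 * t))"
        using H(2)[OF t] K K0 t by (simp add: ennreal_mult[symmetric] flip: ennreal_plus)
      finally show ?thesis
        using H(2)[OF t] K K0 t by (subst (asm) ennreal_le_iff) auto
    qed
    then show ?thesis using K by blast
  qed

  \<comment> \<open>\<open>2 * ?H t\<close> behaves like \<open>p * m' t\<close>, and
    \<open>m' t\<close> like \<open>2 / pi * w t\<close>; the factors 2 cancel, which leaves
    \<open>Gamma (1 - 1 / \<alpha>)\<close> over \<pi>.\<close>
  define \<kappa> where "\<kappa> = Gamma (1 - 1 / \<alpha>) / pi"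
  have \<kappa>: "\<kappa> > 0" unfolding \<kappa>_def using assms(7) by (intro divide_pos_pos Gamma_real_pos) auto
  have lim_affine: "((\<lambda>t. c / pi * (R t * w t) + d * (R t * t)) \<longlongrightarrow> c * \<kappa>) (at_right 0)" for c d
  proof -
    have "((\<lambda>t. c / pi * (R t * w t) + d * (R t * t)) \<longlongrightarrow> c / pi * Gamma (1 - 1 / \<alpha>) + d * 0) (at_right 0)"
      by (intro tendsto_intros limw Rt)
    then show ?thesis by (simp add: \<kappa>_def)
  qed
  have "((\<lambda>t. R t * ?H t) \<longlongrightarrow> p * \<kappa>) (at_right 0)"
  proof (rule order_tendstoI)
    fix y assume y: "p * \<kappa> < y"
    \<comment> \<open>Collects, per unit of \<open>t\<close> and halved, the costs of the frequency
      cut-off and of the displacements outside the unit ball.\<close>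
    define d where "d = p / pi * (r0 / 2 * K0) + V * K0"
    show "\<forall>\<^sub>F t in at_right 0. R t * ?H t < y"
      using order_tendstoD(2)[OF lim_affine[of p d] y] eventually_at_right_less[of 0]
    proof eventually_elim
      case (elim t)
      have "2 * ?H t \<le> p * m' t + 2 * V * (K0 * t)" using upper elim by simp
      moreover have "p * m' t \<le> p * (2 / pi * (w t + r0 / 2 * (K0 * t)))"
        using m_upper[of t] elim p0 by (intro mult_left_mono) (auto simp: field_simps)
      ultimately have "2 * ?H t \<le> p * (2 / pi * (w t + r0 / 2 * (K0 * t))) + 2 * V * (K0 * t)" by linarith
      also have "\<dots> = 2 * (p / pi * w t + d * t)" by (simp add: d_def algebra_simps)
      finally have "?H t \<le> p / pi * w t + d * t" by simp
      then have "R t * ?H t \<le> R t * (p / pi * w t + d * t)"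
        using R(1)[of t] elim by (intro mult_left_mono) auto
      then show ?case using elim by (simp add: algebra_simps)
    qed
  next
    fix y assume y: "y < p * \<kappa>"
    show "\<forall>\<^sub>F t in at_right 0. y < R t * ?H t"
    \<comment> \<open>For negative \<open>y\<close> nonnegativity of the heat loss is enough.
      Otherwise \<open>y < p * \<kappa>\<close> forces \<open>p > 0\<close>, which leaves room for a
      nonnegative \<open>c\<close> strictly between \<open>y / \<kappa>\<close> and
      \<open>p\<close>.\<close>
    proof (cases "y < 0")
      case True
      show ?thesis
        using eventually_at_right_less[of 0]
        by eventually_elim (use True R H(2) in \<open>smt (verit) mult_nonneg_nonneg\<close>)
    next
      case False
      have "y / \<kappa> < p" using y \<kappa> by (simp add: field_simps)
      then obtain c where c: "y / \<kappa> < c" "c < p" using dense by blast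
      then have c0: "0 \<le> c" "y < c * \<kappa>"
        using False \<kappa> by (auto simp: field_simps intro: order_trans[of 0 "y / \<kappa>" c])
      obtain K where K: "K \<ge> 0" "\<And>t. t > 0 \<Longrightarrow> c * m' t \<le> 2 * ?H t + K * (K0 * t)"
        using lower[OF c0(1) c(2)] by blast
      \<comment> \<open>The counterpart for the lower bound, with \<open>K\<close> in place of the
        volume; \<open>K\<close> depends on \<open>c\<close> but not on \<open>t\<close>, so
        \<open>d\<close> is a constant in the limit.\<close>
      define d where "d = - (c / pi * (2 / r0 * K0)) - K * K0 / 2"
      show ?thesis
        using order_tendstoD(1)[OF lim_affine[of c d] c0(2)] eventually_at_right_less[of 0]
      proof eventually_elim
        case (elim t)
        have "c * m' t \<le> 2 * ?H t + K * (K0 * t)" using K elim by simp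
        moreover have "c * (2 / pi * (w t - 2 / r0 * (K0 * t))) \<le> c * m' t"
          using m_lower[of t] elim c0 by (intro mult_left_mono) (auto simp: field_simps)
        ultimately have "c * (2 / pi * (w t - 2 / r0 * (K0 * t))) - K * (K0 * t) \<le> 2 * ?H t" by linarith
        also have "c * (2 / pi * (w t - 2 / r0 * (K0 * t))) - K * (K0 * t) = 2 * (c / pi * w t + d * t)"
          by (simp add: d_def algebra_simps)
        finally have "c / pi * w t + d * t \<le> ?H t" by simp
        then have "R t * (c / pi * w t + d * t) \<le> R t * ?H t"
          using R(1)[of t] elim by (intro mult_left_mono) auto
        then show ?case using elim by (simp add: algebra_simps)
      qed
    qed
  qed
  moreover have "p * \<kappa> = inverse pi * Gamma (1 - 1 / \<alpha>) * real_of_ereal (perimeter \<Omega>)"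
    by (simp add: p_def \<kappa>_def field_simps)
  ultimately show ?thesis unfolding R_def by simp
qed

end
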